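(* Let $T>0$, let $d,q\ge 1$ be integers, $p\in[2,+\infty)$, $b:[0,T]\times\mathbb{R}^d\times\mathcal{P}_p(\mathbb{R}^d)\to\mathbb{R}^d$, $\sigma,\theta:[0,T]\times\mathbb{R}^d\times\mathcal{P}_p(\mathbb{R}^d)\to\mathbb{M}_{d\times q}$, and let $X_0,Y_0$ be $\mathcal{F}_0$-measurable $\mathbb{R}^d$-valued random variables with $\|X_0\|_p\vee\|Y_0\|_p<+\infty$. Assume that there are $\rho>0$ and $L,\tilde L>0$ such that for all $0\le s\le t\le T$, $x,y\in\mathbb{R}^d$, $\mu,\nu\in\mathcal{P}_p(\mathbb{R}^d)$, and for each $f\in\{b,\sigma,\theta\}$ (with the Euclidean norm for $b$ and the operator norm for $\sigma,\theta$), $$\|f(t,x,\mu)-f(s,x,\mu)\|\le \tilde L\big(1+|x|+\mathcal{W}_p(\mu,\delta_0)\big)(t-s)^\rho,\qquad \|f(t,x,\mu)-f(t,y,\nu)\|\le L\big(|x-y|+\mathcal{W}_p(\mu,\nu)\big).$$ Let $X=(X_t)_{t\in[0,T]}$ be the solution of $dX_t=b(t,X_t,\mu_t)\,dt+\sigma(t,X_t,\mu_t)\,dB_t$ with initial value $X_0$, where $\mu_t$ is the distribution of $X_t$. For an integer $M\ge1$ let $h=T/M$ and let $\bar X^M=(\bar X^M_t)_{t\in[0,T]}$ be the continuous-time Euler scheme with step $h$ (defined in the context). Then: (a) There is a constant $C$ depending on $p,d,b,\sigma,T,L$ such that for every $t\in[0,T]$ and every $M\ge1$, $$\Big\|\sup_{u\in[0,t]}|X_u|\Big\|_p\vee\Big\|\sup_{u\in[0,t]}|\bar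 X^M_u|\Big\|_p\le C(1+\|X_0\|_p).$$ Moreover, there is a constant $\kappa$ depending on $L,b,\sigma,\|X_0\|_p,p,d,T$ such that for all $0\le s\le t\le T$ and all $M\ge1$, $$\|\bar X^M_t-\bar X^M_s\|_p\vee\|X_t-X_s\|_p\le\kappa\sqrt{t-s}.$$ (b) There is a constant $\tilde C$ depending on $p,d,T,L,\tilde L,\rho,\|X_0\|_p$ such that (for every $M\ge1$) $$\Big\|\sup_{t\in[0,T]}|X_t-\bar X^M_t|\Big\|_p\le\tilde C\,h^{\frac12\wedge\rho}.$$
   Context: $(\Omega,\mathcal{F},(\mathcal{F}_t)_{t\ge0},\mathbb{P})$ is a filtered probability space satisfying the usual conditions and $(B_t)_{t\ge 0}$ is an $(\mathcal{F}_t)$-standard Brownian motion with values in $\mathbb{R}^q$. $\mathbb{M}_{d\times q}$ is the set of real $d\times q$ matrices with operator norm $\sup_{|z|\le1}|Az|$. $\mathcal{P}_p(\mathbb{R}^d)$ is the set of probability distributions on $\mathbb{R}^d$ with finite $p$-th moment, $\mathcal{W}_p$ the $L^p$-Wasserstein distance (for the Euclidean norm $|\cdot|$), $\delta_0$ the Dirac mass at $0$. $\|U\|_p=(\mathbb{E}|U|^p)^{1/p}$. Under the stated assumptions the equation has a unique strong solution $X$ with continuous paths and $\mathbb{E}\sup_{t\in[0,T]}|X_t|^p<\infty$. ($\theta$ and $Y_0$ are the diffusion coefficient and initial value of a companion equation $dY_t=b(t,Y_t,\nu_t)\,dt+\theta(t,Y_t,\nu_t)\,dB_t$, $\nu_t$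 the distribution of $Y_t$; they do not enter the definition of $X$ or $\bar X^M$.) Euler scheme: with $t_m=mT/M$, $m=0,\dots,M$, set $\bar X^M_0=X_0$ and recursively, for $m=0,\dots,M-1$ and $t\in[t_m,t_{m+1}]$, $$\bar X^M_t=\bar X^M_{t_m}+b(t_m,\bar X^M_{t_m},\bar\mu^M_{t_m})(t-t_m)+\sigma(t_m,\bar X^M_{t_m},\bar\mu^M_{t_m})(B_t-B_{t_m}),$$ where $\bar\mu^M_{t_m}$ is the distribution of $\bar X^M_{t_m}$.
   Formalization: In (b) the constant C̃ may also depend on b and σ (as C and κ do); without this the claim fails, e.g. b(t,x,μ)=K+x, σ=θ=0, X_0=Y_0=0, M=1 gives error at least K(e^T−1−T), unbounded in K. *)

theory Defs
  imports "HOL-Probability.Probability"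
begin

section \<open>Norms in \<open>L\<^sup>p\<close>\<close>

text \<open>
  Norms of random variables take values in \<^typ>\<open>ennreal\<close>, so that an inequality
  \<open>Lp_norm M p U \<le> ennreal c\<close> includes the finiteness of the left-hand side. The exponents
  are positive in all uses, hence the value at infinity.
\<close>

definition ennreal_powr :: "ennreal \<Rightarrow> real \<Rightarrow> ennreal" where
  "ennreal_powr x r = (if x = \<top> then \<top> else ennreal (enn2real x powr r))"

definition Lp_norm :: "'a measure \<Rightarrow> real \<Rightarrow> ('a \<Rightarrow> ennreal) \<Rightarrow> ennreal" where
  "Lp_norm M p U = ennreal_powr (\<integral>\<^sup>+ \<omega>. ennreal_powr (U \<omega>) p \<partial>M) (1 / p)"

abbreviation Lp_norm_vec :: "'a measure \<Rightarrow> real \<Rightarrow> ('a \<Rightarrow> 'b::real_normed_vector) \<Rightarrow> ennreal" where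
  "Lp_norm_vec M p U \<equiv> Lp_norm M p (\<lambda>\<omega>. ennreal (norm (U \<omega>)))"

definition sup_norm :: "real set \<Rightarrow> (real \<Rightarrow> 'a \<Rightarrow> 'b::real_normed_vector) \<Rightarrow> 'a \<Rightarrow> ennreal" where
  "sup_norm I X \<omega> = (SUP u\<in>I. ennreal (norm (X u \<omega>)))"


section \<open>Wasserstein distance\<close>

definition law :: "'a measure \<Rightarrow> ('a \<Rightarrow> 'b::topological_space) \<Rightarrow> 'b measure" where
  "law M U = distr M borel U"

definition finite_moment_measures :: "real \<Rightarrow> 'b::euclidean_space measure set" where
  "finite_moment_measures p =
     {\<mu>. prob_space \<mu> \<and> sets \<mu> = sets borel \<and> (\<integral>\<^sup>+ x. ennreal (norm x powr p) \<partial>\<mu>) < \<infinity>}"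

definition couplings :: "'b::euclidean_space measure \<Rightarrow> 'b measure \<Rightarrow> ('b \<times> 'b) measure set" where
  "couplings \<mu> \<nu> = {\<pi>. prob_space \<pi> \<and> sets \<pi> = sets (borel \<Otimes>\<^sub>M borel) \<and>
                      distr \<pi> borel fst = \<mu> \<and> distr \<pi> borel snd = \<nu>}"

definition wasserstein :: "real \<Rightarrow> 'b::euclidean_space measure \<Rightarrow> 'b measure \<Rightarrow> real" where
  "wasserstein p \<mu> \<nu> =
     enn2real (INF \<pi>\<in>couplings \<mu> \<nu>. \<integral>\<^sup>+ z. ennreal (norm (fst z - snd z) powr p) \<partial>\<pi>) powr (1 / p)"


section \<open>Filtrations and Brownian motion\<close>

text \<open>
  Time is \<^typ>\<open>real\<close>; only the indices \<open>t \<ge> 0\<close> of a filtration or a process are constrained.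
\<close>

definition usual_filtration :: "'a measure \<Rightarrow> (real \<Rightarrow> 'a measure) \<Rightarrow> bool" where
  "usual_filtration M F \<longleftrightarrow>
     prob_space M \<and> complete_measure M \<and>
     (\<forall>t\<ge>0. subalgebra M (F t)) \<and>
     (\<forall>s t. 0 \<le> s \<and> s \<le> t \<longrightarrow> sets (F s) \<subseteq> sets (F t)) \<and>
     (\<forall>s\<ge>0. (\<Inter>t\<in>{s<..}. sets (F t)) = sets (F s)) \<and>
     null_sets M \<subseteq> sets (F 0)"

definition brownian_motion ::
  "'a measure \<Rightarrow> (real \<Rightarrow> 'a measure) \<Rightarrow> (real \<Rightarrow> 'a \<Rightarrow> real ^ 'q) \<Rightarrow> bool" where
  "brownian_motion M F B \<longleftrightarrow>
     (\<forall>t\<ge>0. B t \<in> borel_measurable (F t)) \<and>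
     (AE \<omega> in M. B 0 \<omega> = 0) \<and>
     (AE \<omega> in M. continuous_on {0..} (\<lambda>t. B t \<omega>)) \<and>
     (\<forall>s t. 0 \<le> s \<and> s < t \<longrightarrow>
        prob_space.indep_set M (sets (F s))
          (sets (vimage_algebra (space M) (\<lambda>\<omega>. B t \<omega> - B s \<omega>) borel)) \<and>
        distributed M lborel (\<lambda>\<omega>. B t \<omega> - B s \<omega>)
          (\<lambda>x. ennreal (\<Prod>i\<in>UNIV. normal_density 0 (sqrt (t - s)) (x $ i))))"


section \<open>The Ito integral on \<open>[0,T]\<close>\<close>

definition simple_integrand ::
  "(real \<Rightarrow> 'a measure) \<Rightarrow> real \<Rightarrow> nat \<Rightarrow> (nat \<Rightarrow> real) \<Rightarrow> (nat \<Rightarrow> 'a \<Rightarrow> real ^ 'q ^ 'd) \<Rightarrow> bool" where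
  "simple_integrand F T n \<tau> \<xi> \<longleftrightarrow>
     0 \<le> \<tau> 0 \<and> (\<forall>i<n. \<tau> i \<le> \<tau> (Suc i)) \<and> \<tau> n \<le> T \<and>
     (\<forall>i<n. \<xi> i \<in> borel_measurable (F (\<tau> i)) \<and> (\<exists>K. \<forall>\<omega>\<in>space (F (\<tau> i)). norm (\<xi> i \<omega>) \<le> K))"

definition simple_process ::
  "nat \<Rightarrow> (nat \<Rightarrow> real) \<Rightarrow> (nat \<Rightarrow> 'a \<Rightarrow> real ^ 'q ^ 'd) \<Rightarrow> real \<Rightarrow> 'a \<Rightarrow> real ^ 'q ^ 'd" where
  "simple_process n \<tau> \<xi> s \<omega> = (\<Sum>i<n. indicator {\<tau> i<..\<tau> (Suc i)} s *\<^sub>R \<xi> i \<omega>)"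

definition simple_integral ::
  "(real \<Rightarrow> 'a \<Rightarrow> real ^ 'q) \<Rightarrow> nat \<Rightarrow> (nat \<Rightarrow> real) \<Rightarrow> (nat \<Rightarrow> 'a \<Rightarrow> real ^ 'q ^ 'd) \<Rightarrow>
    real \<Rightarrow> 'a \<Rightarrow> real ^ 'd" where
  "simple_integral B n \<tau> \<xi> t \<omega> =
     (\<Sum>i<n. \<xi> i \<omega> *v (B (min (\<tau> (Suc i)) t) \<omega> - B (min (\<tau> i) t) \<omega>))"

definition progressively_measurable ::
  "(real \<Rightarrow> 'a measure) \<Rightarrow> real \<Rightarrow> (real \<Rightarrow> 'a \<Rightarrow> 'b::topological_space) \<Rightarrow> bool" where
  "progressively_measurable F T H \<longleftrightarrow>
     (\<forall>t\<in>{0..T}. (\<lambda>(s, \<omega>). H s \<omega>) \<in> borel_measurable (restrict_space borel {0..t} \<Otimes>\<^sub>M F t))"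

text \<open>
  \<open>J\<close> is a continuous version of \<open>t \<mapsto> \<integral>\<^sub>0\<^sup>t H\<^sub>s dB\<^sub>s\<close>, the \<open>L\<^sup>2\<close>-limit of the integrals of
  simple processes approximating \<open>H\<close> in \<open>L\<^sup>2(ds \<otimes> P)\<close>. This determines \<open>J\<close> on \<open>[0,T]\<close> up to
  indistinguishability. The norm of \<^typ>\<open>real ^ 'q ^ 'd\<close> used here is the Frobenius norm, which
  defines the same convergence as the operator norm.
\<close>

definition has_ito_integral ::
  "'a measure \<Rightarrow> (real \<Rightarrow> 'a measure) \<Rightarrow> (real \<Rightarrow> 'a \<Rightarrow> real ^ 'q) \<Rightarrow> real \<Rightarrow>
    (real \<Rightarrow> 'a \<Rightarrow> real ^ 'q ^ 'd) \<Rightarrow> (real \<Rightarrow> 'a \<Rightarrow> real ^ 'd) \<Rightarrow> bool" where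
  "has_ito_integral M F B T H J \<longleftrightarrow>
     progressively_measurable F T H \<and>
     (\<integral>\<^sup>+ \<omega>. (\<integral>\<^sup>+ s\<in>{0..T}. ennreal ((norm (H s \<omega>))\<^sup>2) \<partial>lborel) \<partial>M) < \<infinity> \<and>
     (\<forall>t\<in>{0..T}. J t \<in> borel_measurable (F t)) \<and>
     (AE \<omega> in M. continuous_on {0..T} (\<lambda>t. J t \<omega>)) \<and>
     (\<exists>n \<tau> \<xi>.
        (\<forall>k. simple_integrand F T (n k) (\<tau> k) (\<xi> k)) \<and>
        (\<lambda>k. \<integral>\<^sup>+ \<omega>. (\<integral>\<^sup>+ s\<in>{0..T}.
             ennreal ((norm (simple_process (n k) (\<tau> k) (\<xi> k) s \<omega> - H s \<omega>))\<^sup>2) \<partial>lborel) \<partial>M)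
          \<longlonglongrightarrow> 0 \<and>
        (\<forall>t\<in>{0..T}.
          (\<lambda>k. \<integral>\<^sup>+ \<omega>. ennreal ((norm (simple_integral B (n k) (\<tau> k) (\<xi> k) t \<omega> - J t \<omega>))\<^sup>2) \<partial>M)
            \<longlonglongrightarrow> 0))"


section \<open>The McKean-Vlasov equation and its Euler scheme\<close>

definition op_norm :: "real ^ 'q ^ 'd \<Rightarrow> real" where
  "op_norm A = onorm ((*v) A)"

text \<open>
  The coefficients are total functions; only their values on \<open>[0,T] \<times> \<real>\<^sup>d \<times> P\<^sub>p(\<real>\<^sup>d)\<close> matter.
\<close>

definition hoelder_lipschitz ::
  "real \<Rightarrow> real \<Rightarrow> real \<Rightarrow> real \<Rightarrow> real \<Rightarrow> ('c::minus \<Rightarrow> real) \<Rightarrow>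
    (real \<Rightarrow> 'b::euclidean_space \<Rightarrow> 'b measure \<Rightarrow> 'c) \<Rightarrow> bool" where
  "hoelder_lipschitz T p \<rho> L L' nrm f \<longleftrightarrow>
     (\<forall>s t. 0 \<le> s \<and> s \<le> t \<and> t \<le> T \<longrightarrow>
       (\<forall>x y. \<forall>\<mu>\<in>finite_moment_measures p. \<forall>\<nu>\<in>finite_moment_measures p.
          nrm (f t x \<mu> - f s x \<mu>)
            \<le> L' * (1 + norm x + wasserstein p \<mu> (return borel 0)) * (t - s) powr \<rho> \<and>
          nrm (f t x \<mu> - f t y \<nu>) \<le> L * (norm (x - y) + wasserstein p \<mu> \<nu>)))"

text \<open>
  The moment bound singles out the class in which the equation is well-posed; in particular the
  laws of \<open>X\<^sub>t\<close> lie in the domain of the coefficients.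
\<close>

definition mckean_vlasov_solution ::
  "'a measure \<Rightarrow> (real \<Rightarrow> 'a measure) \<Rightarrow> (real \<Rightarrow> 'a \<Rightarrow> real ^ 'q) \<Rightarrow> real \<Rightarrow> real \<Rightarrow>
    (real \<Rightarrow> real ^ 'd \<Rightarrow> (real ^ 'd) measure \<Rightarrow> real ^ 'd) \<Rightarrow>
    (real \<Rightarrow> real ^ 'd \<Rightarrow> (real ^ 'd) measure \<Rightarrow> real ^ 'q ^ 'd) \<Rightarrow>
    ('a \<Rightarrow> real ^ 'd) \<Rightarrow> (real \<Rightarrow> 'a \<Rightarrow> real ^ 'd) \<Rightarrow> bool" where
  "mckean_vlasov_solution M F B T p b \<sigma> X0 X \<longleftrightarrow>
     (\<forall>t\<in>{0..T}. X t \<in> borel_measurable (F t)) \<and>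
     (\<forall>\<omega>\<in>space M. continuous_on {0..T} (\<lambda>t. X t \<omega>)) \<and>
     Lp_norm M p (sup_norm {0..T} X) < \<infinity> \<and>
     (AE \<omega> in M. set_integrable lborel {0..T} (\<lambda>s. b s (X s \<omega>) (law M (X s)))) \<and>
     (\<exists>J. has_ito_integral M F B T (\<lambda>s \<omega>. \<sigma> s (X s \<omega>) (law M (X s))) J \<and>
          (AE \<omega> in M. \<forall>t\<in>{0..T}.
             X t \<omega> = X0 \<omega> + (LINT s:{0..t}|lborel. b s (X s \<omega>) (law M (X s))) + J t \<omega>))"

definition euler_scheme ::
  "'a measure \<Rightarrow> (real \<Rightarrow> 'a \<Rightarrow> real ^ 'q) \<Rightarrow> real \<Rightarrow>
    (real \<Rightarrow> real ^ 'd \<Rightarrow> (real ^ 'd) measure \<Rightarrow> real ^ 'd) \<Rightarrow>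
    (real \<Rightarrow> real ^ 'd \<Rightarrow> (real ^ 'd) measure \<Rightarrow> real ^ 'q ^ 'd) \<Rightarrow>
    ('a \<Rightarrow> real ^ 'd) \<Rightarrow> nat \<Rightarrow> (real \<Rightarrow> 'a \<Rightarrow> real ^ 'd) \<Rightarrow> bool" where
  "euler_scheme M B T b \<sigma> X0 N Xb \<longleftrightarrow>
     (\<forall>\<omega>\<in>space M. Xb 0 \<omega> = X0 \<omega>) \<and>
     (\<forall>m<N. let tm = real m * T / real N in
        \<forall>t\<in>{tm..real (Suc m) * T / real N}. \<forall>\<omega>\<in>space M.
          Xb t \<omega> = Xb tm \<omega>
            + (t - tm) *\<^sub>R b tm (Xb tm \<omega>) (law M (Xb tm))
            + \<sigma> tm (Xb tm \<omega>) (law M (Xb tm)) *v (B t \<omega> - B tm \<omega>))"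

end

theory Submission
  imports Defs
begin

text \<open>
  No Ito formula is used: everything is reduced to finite sums along grids. For a sum of terms
  \<open>\<zeta>\<^sub>j (B(s\<^sub>j\<^sub>+\<^sub>1) - B(s\<^sub>j))\<close> with \<open>\<zeta>\<^sub>j\<close> known at time \<open>s\<^sub>j\<close>, a second order Taylor bound for
  \<open>|x + y|\<close> to the power \<open>p\<close>, in which the first order term has mean zero, and a discrete Gronwall argument bound the
  \<open>p\<close>-th moment, and a pathwise version of Doob's inequality bounds that of the running maximum.
  The coefficients along the solution are continuous in time, so the solution is the limit of its
  Riemann and Ito sums along refinements of the Euler grid, while the Euler scheme equals such sums
  exactly. By Fatou's lemma the bounds pass to the solution, to the scheme, and to their difference,
  whose coefficients are controlled by the Hoelder and Lipschitz conditions, by the increments of the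
  scheme, and by the difference itself; an exponentially weighted supremum closes the estimates.
\<close>

section \<open>Elementary inequalities\<close>

text \<open>The stochastic integral is given only as an \<open>L^2\<close> limit, whereas the claims
  concern \<open>p\<close>-th moments of suprema. Hence every estimate is proved for finite sums
  with constants independent of the mesh, and only inequalities pass to the limit: Fatou's lemma
  asks for no more than almost sure convergence along a subsequence, and that is what
  \<open>L^2\<close> convergence supplies. Closing the weighted supremum means subtracting half of
  it, so it must be known to be finite beforehand. For the solution the moment bound in its
  definition gives this. For the scheme a bound that depends on the number of steps is enough,
  because it does not survive in the final constant. All grids refine the Euler grid. Therefore
  solution minus scheme is a process of the same kind as its two terms, and one closing argument
  serves all three. The constants have to be fixed before the probability space, the step number,
  \<open>\<rho>\<close> and \<open>L'\<close> are known. They are therefore explicit expressions;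
  only the bound of the coefficients at the origin needs an argument of its own to be free of
  \<open>\<rho>\<close> and \<open>L'\<close>.\<close>

lemma powr_le_taylor2:
  fixes u q :: real
  assumes q: "q \<ge> 1" and u: "-(3/4) \<le> u" "u \<le> 5/4"
  shows "(1 + u) powr q \<le> 1 + q * u + q\<^sup>2 * 4 powr q / 2 * u\<^sup>2"
proof (cases "u = 0")
  case False
  define df where "df = (\<lambda>(m::nat) (t::real). if m = 0 then (1 + t) powr q
     else if m = 1 then q * (1 + t) powr (q - 1) else q * (q - 1) * (1 + t) powr (q - 2))"
  have "\<exists>t. (if u < 0 then u < t \<and> t < 0 else 0 < t \<and> t < u) \<and>
        (1 + u) powr q = (\<Sum>m<2. df m 0 / fact m * (u - 0) ^ m) + df 2 t / fact 2 * (u - 0) ^ 2"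
  proof (rule Taylor[where a = "-(3/4)" and b = "5/4"])
    show "\<forall>m t. m < 2 \<and> - (3 / 4) \<le> t \<and> t \<le> 5 / 4 \<longrightarrow> (df m has_real_derivative df (Suc m) t) (at t)"
    proof (intro allI impI, elim conjE)
      fix m :: nat and t :: real assume m: "m < 2" and t: "- (3 / 4) \<le> t"
      consider "m = 0" | "m = 1" using m by linarith
      then show "(df m has_real_derivative df (Suc m) t) (at t)"
        by cases (use t in \<open>auto simp: df_def[abs_def] intro!: derivative_eq_intros\<close>)
    qed
  qed (use u False in \<open>auto simp: df_def\<close>)
  then obtain t where t: "(if u < 0 then u < t \<and> t < 0 else 0 < t \<and> t < u)"
    and eq: "(1 + u) powr q = (\<Sum>m<2. df m 0 / fact m * u ^ m) + df 2 t / 2 * u\<^sup>2"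
    by (auto simp: numeral_2_eq_2)
  \<comment> \<open>The intermediate point keeps \<open>1 + t\<close> in \<open>[1/4, 9/4]\<close>,
    away from 0, so that one constant bounds \<open>(1 + t) powr (q - 2)\<close> for either sign of
    \<open>q - 2\<close>. Both signs occur, as \<open>q\<close> will be
    \<open>p / 2\<close>.\<close>
  have tb: "1/4 \<le> 1 + t" "1 + t \<le> 9/4" using t u by (auto split: if_splits)
  have "(1 + t) powr (q - 2) \<le> 4 powr q"
  proof (cases "q \<ge> 2")
    case True
    have "(1 + t) powr (q - 2) \<le> 4 powr (q - 2)" using tb True by (intro powr_mono2) auto
    also have "\<dots> \<le> 4 powr q" by simp
    finally show ?thesis .
  next
    case False
    have "(1 + t) powr (q - 2) \<le> (1/4) powr (q - 2)" using tb False by (intro powr_mono2') auto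
    also have "\<dots> = 4 powr (2 - q)" by (simp add: powr_divide powr_minus_divide[symmetric] powr_minus[symmetric])
    also have "\<dots> \<le> 4 powr q" using q by (simp)
    finally show ?thesis .
  qed
  moreover have "q * (q - 1) \<le> q\<^sup>2" using q by (simp add: power2_eq_square)
  ultimately have "q * (q - 1) * (1 + t) powr (q - 2) \<le> q\<^sup>2 * 4 powr q"
    using q by (intro mult_mono) auto
  then have "df 2 t / 2 * u\<^sup>2 \<le> q\<^sup>2 * 4 powr q / 2 * u\<^sup>2"
    by (intro mult_right_mono) (auto simp: df_def)
  moreover have "(\<Sum>m<2. df m 0 / fact m * u ^ m) = 1 + q * u"
    by (simp add: df_def numeral_2_eq_2)
  ultimately show ?thesis using eq by linarith
qed simp

lemma power2_powr_half: "0 \<le> r \<Longrightarrow> (r\<^sup>2) powr (p / 2) = r powr p" for r p :: real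
proof (cases "r = 0")
  case False
  moreover assume "0 \<le> r"
  ultimately have "r\<^sup>2 = r powr 2" by simp
  then show ?thesis by (simp only: powr_powr) simp
qed simp

text \<open>The first two summands serve the case \<open>norm y \<le> norm x / 2\<close>, the last
  two the opposite case.\<close>

definition taylor_const :: "real \<Rightarrow> real" where
  "taylor_const p = p + p\<^sup>2 * 2 powr p + 3 powr p + p * 2 powr p"

text \<open>The linear term is kept exactly because it will have mean zero. For small
  \<open>y\<close> this is Taylor's formula for the squared norm raised to the power
  \<open>p / 2\<close>; for large \<open>y\<close> the left-hand side and the linear term are both
  at most a constant times \<open>norm y powr p\<close>.\<close>

lemma norm_add_powr_le:
  fixes x y :: "'b::real_inner"
  assumes p: "p \<ge> 2"
  shows "norm (x + y) powr p \<le> norm x powr p + p * norm x powr (p - 2) * (x \<bullet> y)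
    + taylor_const p * (norm x powr (p - 2) * (norm y)\<^sup>2 + norm y powr p)"
proof (cases "norm y \<le> norm x / 2")
  case True
  show ?thesis
  proof (cases "x = 0")
    case True with \<open>norm y \<le> norm x / 2\<close> show ?thesis by (auto simp: taylor_const_def)
  next
    case False
    define a where "a = norm x"
    have a: "a > 0" using False by (simp add: a_def)
    define c where "c = norm y"
    have c: "0 \<le> c" "c \<le> a / 2" using True by (auto simp: a_def c_def)
    \<comment> \<open>Relative change of the squared norm. From \<open>c \<le> a / 2\<close> it is
      at most \<open>2 * 1/2 + 1/4\<close> and at least \<open>1/4 - 1\<close>, which is the
      interval of the Taylor bound.\<close>
    define u where "u = (2 * (x \<bullet> y) + c\<^sup>2) / a\<^sup>2"
    have xy: "\<bar>x \<bullet> y\<bar> \<le> a * c" unfolding a_def c_def by (rule Cauchy_Schwarz_ineq2)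
    have sq: "(norm (x + y))\<^sup>2 = a\<^sup>2 * (1 + u)"
      using a by (simp add: u_def power2_norm_eq_inner a_def c_def inner_add inner_commute field_simps)
    have ac: "a * c \<le> a\<^sup>2 / 2" using c a by (simp add: power2_eq_square)
    have cc: "c\<^sup>2 \<le> a\<^sup>2 / 4" using power_mono[OF c(2) c(1), of 2] by (simp add: power_divide)
    have u1: "u \<le> 5/4" unfolding u_def using a xy ac cc by (simp add: divide_le_eq abs_le_iff)
    have ge: "(a - c)\<^sup>2 \<le> 2 * (x \<bullet> y) + c\<^sup>2 + a\<^sup>2" using xy by (simp add: power2_diff abs_le_iff)
    have "(a/2)\<^sup>2 \<le> (a - c)\<^sup>2" using c a by (intro power_mono) auto
    with ge have "a\<^sup>2/4 \<le> 2 * (x \<bullet> y) + c\<^sup>2 + a\<^sup>2" by (simp add: power_divide)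
    then have u2: "-(3/4) \<le> u" unfolding u_def using a by (simp add: le_divide_eq)
    have "c\<^sup>2 \<le> c * (a / 2)" using mult_left_mono[OF c(2) c(1)] by (simp add: power2_eq_square)
    then have "\<bar>2 * (x \<bullet> y) + c\<^sup>2\<bar> \<le> 2 * (a * c) + c * (a / 2)"
      using xy zero_le_power2[of c] by linarith
    also have "\<dots> = 5/2 * (a * c)" by simp
    finally have "(2 * (x \<bullet> y) + c\<^sup>2)\<^sup>2 \<le> (5/2 * (a * c))\<^sup>2" by (rule power2_le_iff_abs_le[THEN iffD2, rotated]) (use a c in auto)
    \<comment> \<open>The factor \<open>25/4\<close> is rounded up. As \<open>u\<close> is of order
      \<open>c / a\<close>, its square turns \<open>a powr p\<close> into
      \<open>a powr (p - 2)\<close> times the square of \<open>c\<close>.\<close>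
    also have "\<dots> \<le> 7 * (a\<^sup>2 * c\<^sup>2)" by (simp add: power_mult_distrib power_divide)
    finally have "(2 * (x \<bullet> y) + c\<^sup>2)\<^sup>2 / a\<^sup>2 \<le> 7 * c\<^sup>2" using a
      by (simp add: divide_le_eq mult_ac)
    moreover have "a\<^sup>2 * u\<^sup>2 = (2 * (x \<bullet> y) + c\<^sup>2)\<^sup>2 / a\<^sup>2"
      using a by (simp add: u_def power_divide power2_eq_square)
    ultimately have usq: "a\<^sup>2 * u\<^sup>2 \<le> 7 * c\<^sup>2" by simp
    have pa: "a powr p = a powr (p - 2) * a\<^sup>2"
      using a by (simp add: powr_diff)
    have u0: "0 \<le> 1 + u" using u2 by simp
    have "norm (x + y) powr p = ((norm (x + y))\<^sup>2) powr (p/2)"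
      by (simp add: power2_powr_half)
    also have "\<dots> = a powr p * (1 + u) powr (p/2)"
      unfolding sq using a u0 by (simp add: powr_mult power2_powr_half)
    also have "\<dots> \<le> a powr p * (1 + p/2 * u + (p/2)\<^sup>2 * 4 powr (p/2) / 2 * u\<^sup>2)"
      using p u1 u2 by (intro mult_left_mono powr_le_taylor2) auto
    also have "4 powr (p/2) = 2 powr p"
      using powr_powr[of 2 2 "p/2"] by simp
    also have "a powr p * (1 + p/2 * u + (p/2)\<^sup>2 * 2 powr p / 2 * u\<^sup>2)
       = a powr p + p * a powr (p - 2) * (x \<bullet> y) + p/2 * (a powr (p - 2) * c\<^sup>2)
         + p\<^sup>2 * 2 powr p / 8 * (a powr (p - 2) * (a\<^sup>2 * u\<^sup>2))"
    proof -
      have "a\<^sup>2 * u = 2 * (x \<bullet> y) + c\<^sup>2" using a by (simp add: u_def)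
      then have "a powr (p - 2) * (p/2 * (a\<^sup>2 * u)) = a powr (p - 2) * (p/2 * (2 * (x \<bullet> y) + c\<^sup>2))" by simp
      then show ?thesis by (simp add: pa algebra_simps power_divide)
    qed
    also have "\<dots> \<le> a powr p + p * a powr (p - 2) * (x \<bullet> y) + p/2 * (a powr (p - 2) * c\<^sup>2)
         + p\<^sup>2 * 2 powr p / 8 * (a powr (p - 2) * (7 * c\<^sup>2))"
      by (intro add_left_mono mult_left_mono usq) auto
    also have "\<dots> = a powr p + p * a powr (p - 2) * (x \<bullet> y)
         + (p/2 + p\<^sup>2 * 2 powr p * 7 / 8) * (a powr (p - 2) * c\<^sup>2)"
      by (simp add: algebra_simps)
    also have "\<dots> \<le> a powr p + p * a powr (p - 2) * (x \<bullet> y)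
        + taylor_const p * (a powr (p - 2) * c\<^sup>2 + c powr p)"
    proof -
      have "0 \<le> p\<^sup>2 * 2 powr p" "0 \<le> p * 2 powr p" using p by auto
      then have "p/2 + p\<^sup>2 * 2 powr p * 7 / 8 \<le> taylor_const p"
        unfolding taylor_const_def using p powr_ge_zero[of 3 p] by linarith
      then have "(p/2 + p\<^sup>2 * 2 powr p * 7 / 8) * (a powr (p - 2) * c\<^sup>2)
           \<le> taylor_const p * (a powr (p - 2) * c\<^sup>2 + c powr p)"
        using p by (intro mult_mono) (auto simp: taylor_const_def)
      then show ?thesis by simp
    qed
    finally show ?thesis unfolding a_def c_def .
  qed
next
  case False
  then have xy: "norm x \<le> 2 * norm y" by simp
  have "norm (x + y) powr p \<le> (3 * norm y) powr p"
    using p xy norm_triangle_ineq[of x y] by (intro powr_mono2) auto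
  also have "\<dots> = 3 powr p * norm y powr p" by (simp add: powr_mult)
  finally have 1: "norm (x + y) powr p \<le> 3 powr p * norm y powr p" .
  \<comment> \<open>The linear term may be negative, so it needs a lower bound of order
    \<open>norm y powr p\<close>.\<close>
  have "- (p * norm x powr (p - 2) * (x \<bullet> y)) \<le> p * norm x powr (p - 2) * \<bar>x \<bullet> y\<bar>"
    using p mult_left_mono[of "- (x \<bullet> y)" "\<bar>x \<bullet> y\<bar>" "p * norm x powr (p - 2)"] by simp
  also have "\<dots> \<le> p * norm x powr (p - 2) * (norm x * norm y)"
    using p by (intro mult_left_mono Cauchy_Schwarz_ineq2) auto
  also have "\<dots> = p * (norm x powr (p - 1) * norm y)"
    by (cases "norm x = 0") (auto simp: powr_diff field_simps power2_eq_square)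
  also have "\<dots> \<le> p * ((2 * norm y) powr (p - 1) * norm y)"
    using p xy by (intro mult_left_mono mult_right_mono powr_mono2) auto
  also have "\<dots> = p * 2 powr (p - 1) * norm y powr p"
    by (cases "norm y = 0") (auto simp: powr_diff powr_mult field_simps)
  also have "\<dots> \<le> p * 2 powr p * norm y powr p"
    using p by (intro mult_right_mono mult_left_mono powr_mono) auto
  finally have 2: "- (p * norm x powr (p - 2) * (x \<bullet> y)) \<le> p * 2 powr p * norm y powr p" .
  have "(3 powr p + p * 2 powr p) * norm y powr p
     \<le> taylor_const p * (norm x powr (p - 2) * (norm y)\<^sup>2 + norm y powr p)"
    using p by (intro mult_mono) (auto simp: taylor_const_def)
  then have "3 powr p * norm y powr p + p * 2 powr p * norm y powr p
     \<le> taylor_const p * (norm x powr (p - 2) * (norm y)\<^sup>2 + norm y powr p)"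
    by (simp only: distrib_right)
  with 1 2 show ?thesis using powr_ge_zero[of "norm x" p] by linarith
qed

section \<open>Brownian increments\<close>

text \<open>The shift by 1 allows a Euclidean norm to be bounded by a product over the coordinates,
  so that a moment in dimension \<open>q\<close> becomes the \<open>q\<close>-th power of this
  number.\<close>

definition gauss_moment :: "real \<Rightarrow> real" where
  "gauss_moment r = (LINT z|lborel. (1 + \<bar>z\<bar>) powr r * std_normal_density z)"

lemma one_plus_power_le: "(1 + a) ^ k \<le> 2 ^ k * (1 + a ^ k)" if "a \<ge> 0" for a :: real
proof -
  have "(1 + a) ^ k \<le> (2 * max 1 a) ^ k" using that by (intro power_mono) auto
  also have "\<dots> = 2 ^ k * (max 1 a) ^ k" by (simp add: power_mult_distrib)
  also have "(max 1 a) ^ k \<le> 1 + a ^ k" using that by (auto simp: max_def)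
  finally show ?thesis by simp
qed

lemma integrable_gauss_moment:
  "integrable lborel (\<lambda>z. (1 + \<bar>z\<bar>) powr r * std_normal_density z)"
proof (rule Bochner_Integration.integrable_bound)
  \<comment> \<open>An integer exponent not below \<open>r\<close>, since the absolute normal
    moments are at hand for integer exponents.\<close>
  define k where "k = nat \<lceil>r\<rceil>"
  show "integrable lborel (\<lambda>z. 2 ^ k * (std_normal_density z * \<bar>z\<bar>^0 + std_normal_density z * \<bar>z\<bar>^k))"
    by (intro integrable_mult_right Bochner_Integration.integrable_add integrable_std_normal_moment_abs)
  show "AE z in lborel. norm ((1 + \<bar>z\<bar>) powr r * std_normal_density z)
     \<le> norm (2 ^ k * (std_normal_density z * \<bar>z\<bar>^0 + std_normal_density z * \<bar>z\<bar>^k))"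
  proof (rule AE_I2)
    fix z :: real
    have "(1 + \<bar>z\<bar>) powr r \<le> (1 + \<bar>z\<bar>) powr real k"
      unfolding k_def by (intro powr_mono real_nat_ceiling_ge) auto
    also have "\<dots> = (1 + \<bar>z\<bar>) ^ k" by (subst powr_realpow) auto
    also have "\<dots> \<le> 2 ^ k * (1 + \<bar>z\<bar> ^ k)" by (intro one_plus_power_le) auto
    finally have "(1 + \<bar>z\<bar>) powr r * std_normal_density z \<le> 2 ^ k * (1 + \<bar>z\<bar> ^ k) * std_normal_density z"
      by (intro mult_right_mono) auto
    also have "\<dots> = 2 ^ k * (std_normal_density z * \<bar>z\<bar>^0 + std_normal_density z * \<bar>z\<bar>^k)"
      by (simp add: algebra_simps)
    finally show "norm ((1 + \<bar>z\<bar>) powr r * std_normal_density z)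
     \<le> norm (2 ^ k * (std_normal_density z * \<bar>z\<bar>^0 + std_normal_density z * \<bar>z\<bar>^k))"
      by (simp add: abs_mult)
  qed
qed simp

lemma gauss_moment_nonneg: "0 \<le> gauss_moment r"
  unfolding gauss_moment_def by (intro integral_nonneg_AE) auto

lemma nn_integral_gauss_moment:
  assumes s: "s > 0"
  shows "(\<integral>\<^sup>+x. ennreal ((1 + \<bar>x / s\<bar>) powr r * normal_density 0 s x) \<partial>lborel) = ennreal (gauss_moment r)"
proof -
  have "(\<integral>\<^sup>+x. ennreal ((1 + \<bar>x / s\<bar>) powr r * normal_density 0 s x) \<partial>lborel)
     = ennreal \<bar>s\<bar> * (\<integral>\<^sup>+z. ennreal ((1 + \<bar>(0 + s * z) / s\<bar>) powr r * normal_density 0 s (0 + s * z)) \<partial>lborel)"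
    using s by (intro nn_integral_real_affine) auto
  also have "\<dots> = (\<integral>\<^sup>+z. ennreal \<bar>s\<bar> * ennreal ((1 + \<bar>(0 + s * z) / s\<bar>) powr r * normal_density 0 s (0 + s * z)) \<partial>lborel)"
    by (rule nn_integral_cmult[symmetric]) simp
  also have "\<dots> = (\<integral>\<^sup>+z. ennreal ((1 + \<bar>z\<bar>) powr r * std_normal_density z) \<partial>lborel)"
  proof (intro nn_integral_cong)
    fix z :: real
    have "s * normal_density 0 s (s * z) = std_normal_density z"
      using s by (simp add: normal_density_def real_sqrt_mult power_mult_distrib)
    then show "ennreal \<bar>s\<bar> * ennreal ((1 + \<bar>(0 + s * z) / s\<bar>) powr r * normal_density 0 s (0 + s * z)) = ennreal ((1 + \<bar>z\<bar>) powr r * std_normal_density z)"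
      using s by (simp add: ennreal_mult'[symmetric] mult_ac)
  qed
  also have "\<dots> = ennreal (gauss_moment r)"
    unfolding gauss_moment_def by (intro nn_integral_eq_integral integrable_gauss_moment) auto
  finally show ?thesis .
qed

lemma borel_measurable_vec_nth [measurable (raw)]:
  fixes f :: "'a \<Rightarrow> real ^ 'q"
  shows "f \<in> borel_measurable M \<Longrightarrow> (\<lambda>x. f x $ i) \<in> borel_measurable M"
  by (simp add: cart_eq_inner_axis)

lemma prod_Basis_vec:
  "(\<Prod>b\<in>(Basis :: (real ^ 'q) set). f b) = (\<Prod>i\<in>UNIV. f (axis i (1::real)))"
proof -
  have "(Basis :: (real ^ 'q) set) = range (\<lambda>i. axis i 1)"
    by (auto simp: Basis_vec_def)
  moreover have "inj (\<lambda>i :: 'q. axis i (1::real))" by (auto simp: inj_def axis_eq_axis)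
  ultimately show ?thesis by (subst \<open>Basis = _\<close>, subst prod.reindex) auto
qed

lemma one_plus_sum_le_prod: "finite I \<Longrightarrow> (\<And>i. i \<in> I \<Longrightarrow> 0 \<le> a i) \<Longrightarrow> 1 + sum a I \<le> (\<Prod>i\<in>I. 1 + a i)"
  for a :: "'i \<Rightarrow> real"
proof (induction I rule: finite_induct)
  case (insert x F)
  then have "1 + sum a F \<le> (\<Prod>i\<in>F. 1 + a i)" by auto
  then have "(1 + a x) * (1 + sum a F) \<le> (1 + a x) * (\<Prod>i\<in>F. 1 + a i)"
    using insert by (intro mult_left_mono) auto
  moreover have "0 \<le> a x * sum a F" using insert by (intro mult_nonneg_nonneg sum_nonneg) auto
  ultimately show ?case using insert by (simp add: algebra_simps)
qed simp

abbreviation gauss_density :: "real \<Rightarrow> real ^ 'q \<Rightarrow> real" where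
  "gauss_density s x \<equiv> (\<Prod>i\<in>UNIV. normal_density 0 s (x $ i))"

text \<open>The norm of \<open>x / s\<close> is at most one plus the sum of the
  \<open>\<bar>x $ i / s\<bar>\<close>, hence at most the product of the
  \<open>1 + \<bar>x $ i / s\<bar>\<close>. The integrand is then dominated by a product, and the
  integral factorizes into one-dimensional ones.\<close>

lemma nn_integral_gauss_moment_vec:
  assumes s: "s > 0" and r: "r \<ge> 0"
  shows "(\<integral>\<^sup>+x. ennreal (gauss_density s x) * ennreal (norm (x :: real ^ 'q) powr r) \<partial>lborel)
    \<le> ennreal (s powr r * gauss_moment r ^ CARD('q))"
proof -
  have "(\<integral>\<^sup>+x. ennreal (gauss_density s x) * ennreal (norm (x :: real ^ 'q) powr r) \<partial>lborel)
     \<le> (\<integral>\<^sup>+x. ennreal (s powr r) * (\<Prod>b\<in>(Basis :: (real ^ 'q) set). ennreal ((1 + \<bar>(x \<bullet> b) / s\<bar>) powr r * normal_density 0 s (x \<bullet> b))) \<partial>lborel)"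
  proof (intro nn_integral_mono)
    fix x :: "real ^ 'q"
    have "norm x / s \<le> (\<Sum>i\<in>UNIV. \<bar>x $ i\<bar>) / s" using s norm_le_l1_cart[of x] by (simp add: divide_right_mono)
    also have "\<dots> \<le> 1 + (\<Sum>i\<in>UNIV. \<bar>x $ i / s\<bar>)" using s by (simp add: sum_divide_distrib abs_divide)
    also have "\<dots> \<le> (\<Prod>i\<in>UNIV. 1 + \<bar>x $ i / s\<bar>)" by (intro one_plus_sum_le_prod) auto
    finally have "(norm x / s) powr r \<le> (\<Prod>i\<in>UNIV. 1 + \<bar>x $ i / s\<bar>) powr r"
      using s r by (intro powr_mono2) auto
    also have "\<dots> = (\<Prod>i\<in>UNIV. (1 + \<bar>x $ i / s\<bar>) powr r)" by (rule prod_powr_distrib)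
    finally have "norm x powr r \<le> s powr r * (\<Prod>i\<in>UNIV. (1 + \<bar>x $ i / s\<bar>) powr r)"
      using s by (simp add: powr_divide divide_le_eq mult_ac)
    then have "gauss_density s x * norm x powr r
       \<le> gauss_density s x * (s powr r * (\<Prod>i\<in>UNIV. (1 + \<bar>x $ i / s\<bar>) powr r))"
      by (intro mult_left_mono prod_nonneg) auto
    also have "\<dots> = s powr r * (\<Prod>i\<in>UNIV. (1 + \<bar>x $ i / s\<bar>) powr r * normal_density 0 s (x $ i))"
      by (simp add: prod.distrib mult_ac)
    finally show "ennreal (gauss_density s x) * ennreal (norm x powr r) \<le>
      ennreal (s powr r) * (\<Prod>b\<in>(Basis :: (real ^ 'q) set). ennreal ((1 + \<bar>(x \<bullet> b) / s\<bar>) powr r * normal_density 0 s (x \<bullet> b)))"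
      by (simp add: prod_Basis_vec prod_ennreal inner_axis prod_nonneg flip: ennreal_mult' ennreal_mult)
  qed
  also have "\<dots> = ennreal (s powr r) * (\<integral>\<^sup>+x. (\<Prod>b\<in>(Basis :: (real ^ 'q) set). ennreal ((1 + \<bar>(x \<bullet> b) / s\<bar>) powr r * normal_density 0 s (x \<bullet> b))) \<partial>lborel)"
    by (rule nn_integral_cmult) measurable
  also have "(\<integral>\<^sup>+x. (\<Prod>b\<in>(Basis :: (real ^ 'q) set). ennreal ((1 + \<bar>(x \<bullet> b) / s\<bar>) powr r * normal_density 0 s (x \<bullet> b))) \<partial>lborel)
     = (\<Prod>b\<in>(Basis :: (real ^ 'q) set). (\<integral>\<^sup>+x. ennreal ((1 + \<bar>x / s\<bar>) powr r * normal_density 0 s x) \<partial>lborel))"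
    by (rule nn_integral_lborel_prod) auto
  also have "\<dots> = ennreal (gauss_moment r) ^ CARD('q)"
    by (simp only: nn_integral_gauss_moment[OF s] prod_constant) simp
  also have "ennreal (s powr r) * ennreal (gauss_moment r) ^ CARD('q) = ennreal (s powr r * gauss_moment r ^ CARD('q))"
    by (simp add: ennreal_mult ennreal_power gauss_moment_nonneg)
  finally show ?thesis .
qed

locale filtered_bm =
  fixes M :: "'a measure" and F :: "real \<Rightarrow> 'a measure" and B :: "real \<Rightarrow> 'a \<Rightarrow> real ^ 'q"
  assumes usual: "usual_filtration M F" and bm: "brownian_motion M F B"
begin

sublocale prob_space M
  using usual by (simp add: usual_filtration_def)

lemma subalg: "0 \<le> t \<Longrightarrow> subalgebra M (F t)"
  using usual by (simp add: usual_filtration_def)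

lemma space_F: "0 \<le> t \<Longrightarrow> space (F t) = space M"
  using subalg by (auto simp: subalgebra_def)

lemma F_mono: "0 \<le> s \<Longrightarrow> s \<le> t \<Longrightarrow> subalgebra (F t) (F s)"
  using usual by (auto simp: usual_filtration_def subalgebra_def)

lemma measurable_F_mono: "f \<in> measurable (F s) N \<Longrightarrow> 0 \<le> s \<Longrightarrow> s \<le> t \<Longrightarrow> f \<in> measurable (F t) N"
  using F_mono measurable_from_subalg by blast

lemma measurable_F_M: "f \<in> measurable (F s) N \<Longrightarrow> 0 \<le> s \<Longrightarrow> f \<in> measurable M N"
  using subalg measurable_from_subalg by blast

lemma B_meas: "0 \<le> s \<Longrightarrow> s \<le> t \<Longrightarrow> B s \<in> borel_measurable (F t)"
  using bm measurable_F_mono[of "B s" s] by (auto simp: brownian_motion_def)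

lemma B_meas_M: "0 \<le> s \<Longrightarrow> B s \<in> borel_measurable M"
  using B_meas[of s s] measurable_F_M by auto

lemma B_indep: "0 \<le> s \<Longrightarrow> s < t \<Longrightarrow> indep_set (sets (F s))
          (sets (vimage_algebra (space M) (\<lambda>\<omega>. B t \<omega> - B s \<omega>) borel))"
  using bm by (auto simp: brownian_motion_def)

lemma B_dist: "0 \<le> s \<Longrightarrow> s < t \<Longrightarrow> distributed M lborel (\<lambda>\<omega>. B t \<omega> - B s \<omega>)
          (\<lambda>x. ennreal (gauss_density (sqrt (t - s)) x))"
  using bm by (auto simp: brownian_motion_def)

lemma B_cont: "AE \<omega> in M. continuous_on {0..} (\<lambda>t. B t \<omega>)"
  using bm by (auto simp: brownian_motion_def)

lemma B_incr_moment:
  assumes s: "0 \<le> s" "s \<le> t" and r: "r > 0"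
  shows "integrable M (\<lambda>\<omega>. norm (B t \<omega> - B s \<omega>) powr r)"
    and "(LINT \<omega>|M. norm (B t \<omega> - B s \<omega>) powr r) \<le> (t - s) powr (r / 2) * gauss_moment r ^ CARD('q)"
proof -
  have [measurable]: "B t \<in> borel_measurable M" "B s \<in> borel_measurable M"
    using s by (auto intro: B_meas_M)
  have *: "(\<integral>\<^sup>+\<omega>. ennreal (norm (B t \<omega> - B s \<omega>) powr r) \<partial>M) \<le> ennreal ((t - s) powr (r / 2) * gauss_moment r ^ CARD('q))"
  \<comment> \<open>The definition of Brownian motion provides a density only for
    \<open>s < t\<close>; for equal times the increment vanishes.\<close>
  proof (cases "s = t")
    case False
    with s have st: "s < t" by simp
    have "(\<integral>\<^sup>+\<omega>. ennreal (norm (B t \<omega> - B s \<omega>) powr r) \<partial>M)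
      = (\<integral>\<^sup>+x. ennreal (gauss_density (sqrt (t - s)) x) * ennreal (norm (x :: real ^ 'q) powr r) \<partial>lborel)"
      by (rule distributed_nn_integral[OF B_dist[OF s(1) st], of "\<lambda>x. ennreal (norm x powr r)", symmetric]) simp
    also have "\<dots> \<le> ennreal (sqrt (t - s) powr r * gauss_moment r ^ CARD('q))"
      using st r by (intro nn_integral_gauss_moment_vec) auto
    also have "sqrt (t - s) powr r = (t - s) powr (r / 2)"
      using st by (simp add: powr_half_sqrt[symmetric] powr_powr)
    finally show ?thesis .
  qed (simp)
  show "integrable M (\<lambda>\<omega>. norm (B t \<omega> - B s \<omega>) powr r)"
    using * by (intro integrableI_nonneg) (auto simp: less_top[symmetric] top_unique)
  show "(LINT \<omega>|M. norm (B t \<omega> - B s \<omega>) powr r) \<le> (t - s) powr (r / 2) * gauss_moment r ^ CARD('q)"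
    using * by (intro integral_real_bounded) (auto simp: gauss_moment_nonneg)
qed

lemma B_incr_indep:
  fixes Y :: "'a \<Rightarrow> real" and g :: "real ^ 'q \<Rightarrow> real"
  assumes s: "0 \<le> s" "s \<le> t" and Y: "Y \<in> borel_measurable (F s)" "integrable M Y"
    and g: "g \<in> borel_measurable borel" "integrable M (\<lambda>\<omega>. g (B t \<omega> - B s \<omega>))"
  shows "integrable M (\<lambda>\<omega>. Y \<omega> * g (B t \<omega> - B s \<omega>))"
    and "(LINT \<omega>|M. Y \<omega> * g (B t \<omega> - B s \<omega>)) = (LINT \<omega>|M. Y \<omega>) * (LINT \<omega>|M. g (B t \<omega> - B s \<omega>))"
proof -
  have "integrable M (\<lambda>\<omega>. Y \<omega> * g (B t \<omega> - B s \<omega>)) \<and>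
    (LINT \<omega>|M. Y \<omega> * g (B t \<omega> - B s \<omega>)) = (LINT \<omega>|M. Y \<omega>) * (LINT \<omega>|M. g (B t \<omega> - B s \<omega>))"
  proof (cases "s = t")
    case True
    then show ?thesis using Y by (simp add: prob_space)
  next
    case False
    with s have st: "s < t" by simp
    let ?D = "\<lambda>\<omega>. B t \<omega> - B s \<omega>"
    have D[measurable]: "?D \<in> borel_measurable M"
      using s by (intro borel_measurable_diff B_meas_M) auto
    have "indep_var borel Y borel (\<lambda>\<omega>. g (?D \<omega>))"
      unfolding indep_var_eq
    proof (intro conjI)
      show "random_variable borel Y" using Y by simp
      show "random_variable borel (\<lambda>\<omega>. g (?D \<omega>))" using g(1) D by measurable
      have ind: "indep_set (sets (F s)) (sets (vimage_algebra (space M) ?D borel))"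
        using B_indep s st by simp
      have 1: "sigma_sets (space M) {Y -` A \<inter> space M |A. A \<in> sets borel} \<subseteq> sets (F s)"
      proof -
        have "{Y -` A \<inter> space M |A. A \<in> sets borel} \<subseteq> sets (F s)"
          using measurable_sets[OF Y(1)] space_F[of s] s by auto
        then show ?thesis
          using sets.sigma_sets_subset[of _ "F s"] space_F[of s] s by simp
      qed
      have 2: "sigma_sets (space M) {(\<lambda>\<omega>. g (?D \<omega>)) -` A \<inter> space M |A. A \<in> sets borel} \<subseteq> sets (vimage_algebra (space M) ?D borel)"
      proof -
        have "{(\<lambda>\<omega>. g (?D \<omega>)) -` A \<inter> space M |A. A \<in> sets borel} \<subseteq> sets (vimage_algebra (space M) ?D borel)"
        proof safe
          fix A :: "real set" assume "A \<in> sets borel"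
          then have "g -` A \<in> sets borel" using measurable_sets[OF g(1)] by simp
          then have "?D -` (g -` A) \<inter> space M \<in> sets (vimage_algebra (space M) ?D borel)"
            by (auto intro!: in_vimage_algebra)
          then show "(\<lambda>\<omega>. g (?D \<omega>)) -` A \<inter> space M \<in> sets (vimage_algebra (space M) ?D borel)"
            by (simp add: vimage_def)
        qed
        then show ?thesis
          using sets.sigma_sets_subset[of _ "vimage_algebra (space M) ?D borel"] by simp
      qed
      show "indep_set (sigma_sets (space M) {Y -` A \<inter> space M |A. A \<in> sets borel})
          (sigma_sets (space M) {(\<lambda>\<omega>. g (?D \<omega>)) -` A \<inter> space M |A. A \<in> sets borel})"
        using ind 1 2 unfolding indep_sets2_eq by blast
    qed
    from indep_var_integrable[OF this Y(2) g(2)] indep_var_lebesgue_integral[OF this Y(2) g(2)]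
    show ?thesis by simp
  qed
  then show "integrable M (\<lambda>\<omega>. Y \<omega> * g (B t \<omega> - B s \<omega>))"
    and "(LINT \<omega>|M. Y \<omega> * g (B t \<omega> - B s \<omega>)) = (LINT \<omega>|M. Y \<omega>) * (LINT \<omega>|M. g (B t \<omega> - B s \<omega>))"
    by auto
qed

lemma B_incr_mean:
  assumes s: "0 \<le> s" "s \<le> t"
  shows "integrable M (\<lambda>\<omega>. (B t \<omega> - B s \<omega>) $ i)" and "(LINT \<omega>|M. (B t \<omega> - B s \<omega>) $ i) = 0"
proof -
  have [measurable]: "B t \<in> borel_measurable M" "B s \<in> borel_measurable M"
    using s by (auto intro: B_meas_M)
  have "integrable M (\<lambda>\<omega>. norm (B t \<omega> - B s \<omega>))"
    using B_incr_moment(1)[OF s, of 1] by simp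
  then show "integrable M (\<lambda>\<omega>. (B t \<omega> - B s \<omega>) $ i)"
    by (rule Bochner_Integration.integrable_bound) (auto simp: component_le_norm_cart simp del: vector_minus_component)
  show "(LINT \<omega>|M. (B t \<omega> - B s \<omega>) $ i) = 0"
  proof (cases "s = t")
    case False
    with s have st: "s < t" by simp
    let ?f = "gauss_density (sqrt (t - s)) :: real ^ 'q \<Rightarrow> real"
    have [measurable]: "?f \<in> borel_measurable borel" by measurable
    have eq: "(LINT \<omega>|M. (B t \<omega> - B s \<omega>) $ i) = (LINT x|lborel. ?f x * x $ i)"
      by (rule distributed_integral[OF B_dist[OF s(1) st], of "\<lambda>x. x $ i", symmetric])
        (auto intro: prod_nonneg)
    \<comment> \<open>The reflection at the origin preserves Lebesgue measure and the Gaussian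
      density, and it changes the sign of the coordinate.\<close>
    have "(LINT x|lborel. ?f x * x $ i) = - (LINT x|lborel. ?f x * x $ i)"
    proof -
      have "lborel = distr lborel borel (\<lambda>x :: real ^ 'q. - x)"
        using lborel_affine[of "-1" "0 :: real ^ 'q"] by (simp add: density_1 one_ennreal_def[symmetric])
      then have "(LINT x|lborel. ?f x * x $ i) = (LINT x|distr lborel borel (\<lambda>x :: real ^ 'q. - x). ?f x * x $ i)"
        by simp
      also have "\<dots> = (LINT x|lborel. ?f (- x) * (- x) $ i)"
        by (subst integral_distr) auto
      also have "\<dots> = - (LINT x|lborel. ?f x * x $ i)"
        by (simp add: normal_density_def)
      finally show ?thesis .
    qed
    then show ?thesis unfolding eq by simp
  qed simp
qed

end

section \<open>Moments of discrete stochastic integrals\<close>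

lemma powr_add_le:
  fixes a b p :: real
  assumes "0 \<le> a" "0 \<le> b" "0 \<le> p"
  shows "(a + b) powr p \<le> 2 powr p * (a powr p + b powr p)"
proof -
  have "(a + b) powr p \<le> (2 * max a b) powr p" using assms by (intro powr_mono2) auto
  also have "\<dots> = 2 powr p * (max a b) powr p" using assms by (subst powr_mult) auto
  also have "(max a b) powr p \<le> a powr p + b powr p" by (auto simp: max_def)
  finally show ?thesis by simp
qed

lemma powr_add3_le:
  fixes a b c p :: real
  assumes "0 \<le> a" "0 \<le> b" "0 \<le> c" "0 \<le> p"
  shows "(a + b + c) powr p \<le> 3 powr p * (a powr p + b powr p + c powr p)"
proof -
  have "(a + b + c) powr p \<le> (3 * max a (max b c)) powr p" using assms by (intro powr_mono2) auto
  also have "\<dots> = 3 powr p * (max a (max b c)) powr p" using assms by (subst powr_mult) auto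
  also have "(max a (max b c)) powr p \<le> a powr p + b powr p + c powr p"
    by (auto simp: max_def add_increasing add_increasing2)
  finally show ?thesis by simp
qed

text \<open>A crude form of Young's inequality: replacing the smaller of the two bases by the larger
  one leaves a pure \<open>p\<close>-th power.\<close>

lemma powr_mult_powr_le:
  fixes a b p k :: real
  assumes "0 \<le> a" "0 \<le> b" "0 \<le> k" "k \<le> p"
  shows "a powr (p - k) * b powr k \<le> a powr p + b powr p"
proof (cases "a \<le> b")
  case True
  then have "a powr (p - k) * b powr k \<le> b powr (p - k) * b powr k"
    using assms by (intro mult_right_mono powr_mono2) auto
  also have "\<dots> = b powr p" by (simp flip: powr_add)
  finally show ?thesis using powr_ge_zero[of a p] by linarith
next
  case False
  then have "a powr (p - k) * b powr k \<le> a powr (p - k) * a powr k"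
    using assms by (intro mult_left_mono powr_mono2) auto
  also have "\<dots> = a powr p" by (simp flip: powr_add)
  finally show ?thesis using powr_ge_zero[of b p] by linarith
qed

text \<open>The preceding inequality for \<open>a\<close> and \<open>sqrt h * z\<close>, divided by
  \<open>h\<close>. The weight \<open>1 / h\<close> on \<open>a powr p\<close> keeps the Gronwall
  exponent bounded over an interval of length \<open>h\<close>.\<close>

lemma powr_Young_scaled:
  fixes a z h p :: real
  assumes "0 \<le> a" "0 \<le> z" "0 < h" "2 \<le> p"
  shows "a powr (p - 2) * z\<^sup>2 \<le> a powr p / h + h powr (p / 2 - 1) * z powr p"
proof -
  define w where "w = sqrt h * z"
  have w: "0 \<le> w" using assms by (simp add: w_def)
  have "a powr (p - 2) * w powr 2 \<le> a powr p + w powr p"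
    using assms w by (intro powr_mult_powr_le) auto
  moreover have "w powr 2 = h * z\<^sup>2" using assms by (simp add: w_def power_mult_distrib)
  moreover have "w powr p = h * (h powr (p / 2 - 1) * z powr p)"
    using assms by (simp add: w_def powr_mult powr_half_sqrt[symmetric] powr_powr powr_diff)
  ultimately have "h * (a powr (p - 2) * z\<^sup>2) \<le> h * (a powr p / h + h powr (p / 2 - 1) * z powr p)"
    using assms by (simp add: algebra_simps)
  then show ?thesis using assms by (simp add: mult_le_cancel_left_pos)
qed

text \<open>The coefficient \<open>1/4\<close> is small enough to be absorbed by the
  \<open>1/2\<close> that the pathwise Doob inequality leaves in front of the maximum.\<close>

lemma powr_Young_quarter:
  fixes m y p :: real
  assumes "0 \<le> m" "0 \<le> y" "1 \<le> p"
  shows "m powr (p - 1) * y \<le> m powr p / 4 + 4 powr (p - 1) * y powr p"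
proof (cases "4 * y \<le> m")
  case True
  then have "m powr (p - 1) * y \<le> m powr (p - 1) * (m / 4)" by (intro mult_left_mono) auto
  also have "\<dots> = m powr p / 4" using assms by (cases "m = 0") (auto simp: powr_diff)
  finally show ?thesis by (simp add: add_increasing2)
next
  case False
  then have "m powr (p - 1) * y \<le> (4 * y) powr (p - 1) * y"
    using assms by (intro mult_right_mono powr_mono2) auto
  also have "\<dots> = 4 powr (p - 1) * y powr p"
    using assms by (cases "y = 0") (auto simp: powr_diff powr_mult)
  finally show ?thesis using assms by (simp add: add_increasing)
qed

section \<open>Matrix-vector products and random variables with finite moments\<close>

lemma norm_matrix_vector_mult_le:
  fixes A :: "real ^ 'q ^ 'd"
  shows "norm (A *v x) \<le> norm A * norm x"
proof -
  have "norm (A *v x) = L2_set (\<lambda>i. norm ((A *v x) $ i)) UNIV" by (simp add: norm_vec_def)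
  also have "\<dots> \<le> L2_set (\<lambda>i. norm (A $ i) * norm x) UNIV"
    by (intro L2_set_mono) (auto simp: matrix_vector_mul_component Cauchy_Schwarz_ineq2)
  also have "\<dots> = norm A * norm x"
    by (simp add: L2_set_left_distrib norm_vec_def)
  finally show ?thesis .
qed

lemma bounded_bilinear_matrix_vector_mult:
  "bounded_bilinear ((*v) :: real ^ 'q ^ 'd \<Rightarrow> real ^ 'q \<Rightarrow> real ^ 'd)"
proof
  show "\<exists>K. \<forall>(a :: real ^ 'q ^ 'd) b. norm (a *v b) \<le> norm a * norm b * K"
    by (rule exI[of _ 1]) (simp add: norm_matrix_vector_mult_le)
qed (auto simp: matrix_vector_right_distrib matrix_vector_mult_add_rdistrib
        matrix_vector_mult_scaleR scaleR_matrix_vector_assoc)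

lemma borel_measurable_matrix_vector_mult [measurable (raw)]:
  fixes f :: "'a \<Rightarrow> real ^ 'q ^ 'd"
  assumes "f \<in> borel_measurable M" "g \<in> borel_measurable M"
  shows "(\<lambda>x. f x *v g x) \<in> borel_measurable M"
  using assms
  by (rule borel_measurable_continuous_Pair)
    (intro bounded_bilinear.continuous_on[OF bounded_bilinear_matrix_vector_mult] continuous_intros)

definition in_Lp :: "'a measure \<Rightarrow> real \<Rightarrow> ('a \<Rightarrow> 'b::euclidean_space) \<Rightarrow> bool" where
  "in_Lp M p f \<longleftrightarrow> f \<in> borel_measurable M \<and> integrable M (\<lambda>\<omega>. norm (f \<omega>) powr p)"

lemma in_Lp_measurable: "in_Lp M p f \<Longrightarrow> f \<in> borel_measurable M"
  and in_Lp_integrable: "in_Lp M p f \<Longrightarrow> integrable M (\<lambda>\<omega>. norm (f \<omega>) powr p)"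
  by (auto simp: in_Lp_def)

lemma in_LpI_bound:
  assumes "f \<in> borel_measurable M" "integrable M g" "AE \<omega> in M. norm (f \<omega>) powr p \<le> g \<omega>"
  shows "in_Lp M p f"
  unfolding in_Lp_def using assms
  by (auto intro!: Bochner_Integration.integrable_bound[OF assms(2)])

lemma in_Lp_add:
  assumes "in_Lp M p f" "in_Lp M p g" "p \<ge> 0"
  shows "in_Lp M p (\<lambda>\<omega>. f \<omega> + g \<omega>)"
proof (rule in_LpI_bound)
  show "AE \<omega> in M. norm (f \<omega> + g \<omega>) powr p \<le> 2 powr p * (norm (f \<omega>) powr p + norm (g \<omega>) powr p)"
  proof (rule AE_I2)
    fix \<omega>
    have "norm (f \<omega> + g \<omega>) powr p \<le> (norm (f \<omega>) + norm (g \<omega>)) powr p"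
      using assms by (intro powr_mono2 norm_triangle_ineq) auto
    also have "\<dots> \<le> 2 powr p * (norm (f \<omega>) powr p + norm (g \<omega>) powr p)"
      using assms by (intro powr_add_le) auto
    finally show "norm (f \<omega> + g \<omega>) powr p \<le> 2 powr p * (norm (f \<omega>) powr p + norm (g \<omega>) powr p)" .
  qed
qed (use assms in \<open>auto simp: in_Lp_def\<close>)

lemma in_Lp_scaleR: "in_Lp M p f \<Longrightarrow> in_Lp M p (\<lambda>\<omega>. c *\<^sub>R f \<omega>)"
  by (auto simp: in_Lp_def powr_mult)

lemma in_Lp_diff:
  assumes "in_Lp M p f" "in_Lp M p g" "p \<ge> 0"
  shows "in_Lp M p (\<lambda>\<omega>. f \<omega> - g \<omega>)"
  using in_Lp_add[OF assms(1) in_Lp_scaleR[OF assms(2), of "-1"] assms(3)] by simp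

lemma in_Lp_zero: "in_Lp M p (\<lambda>\<omega>. 0)"
  by (simp add: in_Lp_def)

lemma in_Lp_sum: "finite I \<Longrightarrow> (\<And>i. i \<in> I \<Longrightarrow> in_Lp M p (f i)) \<Longrightarrow> p \<ge> 0 \<Longrightarrow> in_Lp M p (\<lambda>\<omega>. \<Sum>i\<in>I. f i \<omega>)"
  by (induction I rule: finite_induct) (auto simp: in_Lp_zero intro!: in_Lp_add)

section \<open>Running maxima and Doob's inequality\<close>

primrec runmax :: "(nat \<Rightarrow> real) \<Rightarrow> nat \<Rightarrow> real" where
  "runmax y 0 = y 0"
| "runmax y (Suc i) = max (runmax y i) (y (Suc i))"

lemma le_runmax: "j \<le> i \<Longrightarrow> y j \<le> runmax y i"
  by (induction i) (auto simp: le_Suc_eq max_def)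

lemma runmax_le: "(\<And>j. j \<le> i \<Longrightarrow> y j \<le> c) \<Longrightarrow> runmax y i \<le> c"
  by (induction i) auto

lemma runmax_in: "\<exists>j\<le>i. runmax y i = y j"
  by (induction i) (auto simp: max_def intro: le_SucI)

lemma runmax_powr_le:
  assumes "\<And>j. 0 \<le> y j"
  shows "runmax y i powr p \<le> (\<Sum>j\<le>i. y j powr p)"
proof -
  obtain j where "j \<le> i" "runmax y i = y j" using runmax_in by blast
  then show ?thesis using member_le_sum[of j "{..i}" "\<lambda>j. y j powr p"] by auto
qed

text \<open>For a submartingale \<open>y\<close> the sum on the left has nonnegative expectation, so this turns into
  Doob's \<open>L\<^sup>p\<close> inequality without stopping times.\<close>

lemma pathwise_doob:
  fixes y :: "nat \<Rightarrow> real"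
  assumes p: "p \<ge> 2" and y: "\<And>i. 0 \<le> y i" "y 0 = 0"
  shows "(\<Sum>j<i. runmax y j powr (p - 1) * (y (Suc j) - y j)) + runmax y i powr p / 2
     \<le> runmax y i powr (p - 1) * y i"
proof (induction i)
  case 0
  then show ?case using y by simp
next
  case (Suc i)
  let ?m = "runmax y i" and ?z = "y (Suc i)"
  have m: "0 \<le> ?m" using le_runmax[of 0 i y] y by simp
  show ?case
  proof (cases "?z \<le> ?m")
    case True
    then have "runmax y (Suc i) = ?m" by simp
    with Suc show ?thesis by (simp add: algebra_simps)
  next
    case False
    then have M: "runmax y (Suc i) = ?z" "?m < ?z" by auto
    \<comment> \<open>Young's inequality has the weights \<open>1 - 1/p\<close> and
      \<open>1/p\<close>. Since the new value exceeds the old maximum and \<open>p \<ge> 2\<close>,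
      the bound only grows when both weights become \<open>1/2\<close>.\<close>
    have "?m powr (p - 1) * ?z \<le> (1 - 1/p) * ?m powr p + 1/p * ?z powr p"
    proof (cases "?m = 0")
      case False
      have "(?m powr p) powr (1 - 1/p) * (?z powr p) powr (1/p) \<le> (1 - 1/p) * ?m powr p + 1/p * ?z powr p"
        using p m M False by (intro Youngs_inequality_0) auto
      moreover have "p * (1 - 1/p) = p - 1" using p by (simp add: field_simps)
      ultimately show ?thesis using p m M by (simp add: powr_powr)
    qed (use p in simp)
    moreover have "1/p * (?z powr p - ?m powr p) \<le> 1/2 * (?z powr p - ?m powr p)"
      using p m M by (intro mult_right_mono) (auto intro!: powr_mono2 simp: field_simps)
    ultimately have *: "?m powr (p - 1) * ?z \<le> ?m powr p / 2 + ?z powr p / 2"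
      by (simp add: algebra_simps)
    have "?z powr (p - 1) * ?z = ?z powr p" using p M m by (simp add: powr_diff)
    with Suc * show ?thesis unfolding M sum.lessThan_Suc by (simp add: algebra_simps)
  qed
qed

section \<open>Moment and maximal inequalities for sums of Brownian increments\<close>

definition bdg_rate :: "nat \<Rightarrow> real \<Rightarrow> real" where
  "bdg_rate q p = taylor_const p * (gauss_moment 2 ^ q + gauss_moment p ^ q)"

text \<open>The factor \<open>4 powr p\<close> stems from the pathwise Doob inequality, the
  exponential from the discrete Gronwall argument over an interval of relative length at most 1, and
  \<open>2 * bdg_rate q p\<close> from its source term.\<close>

definition bdg_const :: "nat \<Rightarrow> real \<Rightarrow> real" where
  "bdg_const q p = 4 powr p * (exp (bdg_rate q p) * (2 * bdg_rate q p))"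

lemma taylor_const_nonneg: "p \<ge> 0 \<Longrightarrow> 0 \<le> taylor_const p"
  by (simp add: taylor_const_def)

lemma bdg_rate_nonneg: "p \<ge> 0 \<Longrightarrow> 0 \<le> bdg_rate q p"
  by (simp add: bdg_rate_def taylor_const_nonneg gauss_moment_nonneg)

lemma bdg_const_nonneg: "p \<ge> 0 \<Longrightarrow> 0 \<le> bdg_const q p"
  by (simp add: bdg_const_def bdg_rate_nonneg)

text \<open>The steps are indexed by all natural numbers and the grid increases only weakly: finite
  sums are treated by continuing the integrands with zero, and a finite grid may be continued by a
  constant.\<close>

locale bm_steps = filtered_bm M F B
  for M :: "'a measure" and F and B :: "real \<Rightarrow> 'a \<Rightarrow> real ^ 'q" +
  fixes p :: real and s :: "nat \<Rightarrow> real" and \<zeta> :: "nat \<Rightarrow> 'a \<Rightarrow> real ^ 'q ^ 'd"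
  assumes p: "p \<ge> 2" and s0: "0 \<le> s 0" and s_mono: "incseq s"
    and \<zeta>_adapted: "\<And>i. \<zeta> i \<in> borel_measurable (F (s i))"
    and \<zeta>_Lp: "\<And>i. in_Lp M p (\<zeta> i)"
begin

abbreviation "D i \<omega> \<equiv> B (s (Suc i)) \<omega> - B (s i) \<omega>"
abbreviation "\<Delta> i \<equiv> s (Suc i) - s i"
abbreviation "J i \<omega> \<equiv> (\<Sum>j<i. \<zeta> j \<omega> *v D j \<omega>)"

lemma s_nonneg: "0 \<le> s i"
  using s0 s_mono by (meson incseqD le0 order_trans)

lemma s_Suc: "s i \<le> s (Suc i)"
  using s_mono by (simp add: incseq_SucD)

lemma \<zeta>_meas[measurable]: "\<zeta> i \<in> borel_measurable M"
  using \<zeta>_Lp by (rule in_Lp_measurable)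

lemma D_meas[measurable]: "D i \<in> borel_measurable M"
  by (intro borel_measurable_diff B_meas_M s_nonneg)

lemma J_adapted: "J i \<in> borel_measurable (F (s i))"
proof (intro borel_measurable_sum borel_measurable_matrix_vector_mult borel_measurable_diff)
  fix j assume j: "j \<in> {..<i}"
  then have le: "s j \<le> s i" "s (Suc j) \<le> s i" using s_mono by (auto simp: incseq_def)
  show "\<zeta> j \<in> borel_measurable (F (s i))"
    using \<zeta>_adapted s_nonneg le(1) by (rule measurable_F_mono)
  show "B (s (Suc j)) \<in> borel_measurable (F (s i))" "B (s j) \<in> borel_measurable (F (s i))"
    using le by (auto intro: B_meas s_nonneg)
qed

lemma J_meas[measurable]: "J i \<in> borel_measurable M"
  using J_adapted s_nonneg by (rule measurable_F_M)

lemma noise_moment: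
  fixes Y :: "'a \<Rightarrow> real"
  assumes r: "r > 0" and Y: "Y \<in> borel_measurable (F (s i))" "integrable M Y" "\<And>\<omega>. 0 \<le> Y \<omega>"
  shows "integrable M (\<lambda>\<omega>. Y \<omega> * norm (D i \<omega>) powr r)"
    and "(LINT \<omega>|M. Y \<omega> * norm (D i \<omega>) powr r) \<le> (LINT \<omega>|M. Y \<omega>) * (\<Delta> i powr (r / 2) * gauss_moment r ^ CARD('q))"
proof -
  note I = B_incr_moment[OF s_nonneg s_Suc r, of i]
  have g: "(\<lambda>x :: real ^ 'q. norm x powr r) \<in> borel_measurable borel" by measurable
  note N = B_incr_indep[OF s_nonneg s_Suc Y(1,2) g I(1)]
  show "integrable M (\<lambda>\<omega>. Y \<omega> * norm (D i \<omega>) powr r)" by (rule N)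
  show "(LINT \<omega>|M. Y \<omega> * norm (D i \<omega>) powr r) \<le> (LINT \<omega>|M. Y \<omega>) * (\<Delta> i powr (r / 2) * gauss_moment r ^ CARD('q))"
    unfolding N using I(2) Y by (intro mult_left_mono Bochner_Integration.integral_nonneg) auto
qed

lemma noise_norm_le: "norm (\<zeta> i \<omega> *v D i \<omega>) powr r \<le> norm (\<zeta> i \<omega>) powr r * norm (D i \<omega>) powr r" if "r \<ge> 0"
proof -
  have "norm (\<zeta> i \<omega> *v D i \<omega>) powr r \<le> (norm (\<zeta> i \<omega>) * norm (D i \<omega>)) powr r"
    using that by (intro powr_mono2 norm_matrix_vector_mult_le) auto
  then show ?thesis by (simp add: powr_mult)
qed

lemma \<zeta>_powr_adapted[measurable]: "(\<lambda>\<omega>. norm (\<zeta> i \<omega>) powr r) \<in> borel_measurable (F (s i))"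
  using \<zeta>_adapted[of i] by measurable

lemma J_powr_adapted[measurable]: "(\<lambda>\<omega>. norm (J i \<omega>) powr r) \<in> borel_measurable (F (s i))"
  using J_adapted[of i] by measurable

lemma noise_Lp: "in_Lp M p (\<lambda>\<omega>. \<zeta> i \<omega> *v D i \<omega>)"
  using p by (intro in_LpI_bound[OF _ noise_moment(1)[of p "\<lambda>\<omega>. norm (\<zeta> i \<omega>) powr p" i]])
    (auto simp: noise_norm_le in_Lp_integrable[OF \<zeta>_Lp])

lemma J_Lp: "in_Lp M p (J i)"
  using p by (intro in_Lp_sum noise_Lp) auto

text \<open>In coordinates of the noise, each summand is a factor known at time \<open>s i\<close>
  times a coordinate of the increment, which is independent of that factor and centred.\<close>

lemma noise_orthogonal:
  fixes V :: "'a \<Rightarrow> real ^ 'd"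
  assumes V: "V \<in> borel_measurable (F (s i))" and int: "integrable M (\<lambda>\<omega>. norm (V \<omega>) * norm (\<zeta> i \<omega>))"
  shows "integrable M (\<lambda>\<omega>. V \<omega> \<bullet> (\<zeta> i \<omega> *v D i \<omega>))"
    and "(LINT \<omega>|M. V \<omega> \<bullet> (\<zeta> i \<omega> *v D i \<omega>)) = 0"
proof -
  let ?Y = "\<lambda>k \<omega>. V \<omega> \<bullet> (\<zeta> i \<omega> *v axis k 1)"
  have Y: "?Y k \<in> borel_measurable (F (s i))" for k
    using V \<zeta>_adapted[of i] by measurable
  have iY: "integrable M (?Y k)" for k
  proof (rule Bochner_Integration.integrable_bound[OF int])
    show "?Y k \<in> borel_measurable M" using Y s_nonneg by (rule measurable_F_M)
    show "AE \<omega> in M. norm (?Y k \<omega>) \<le> norm (norm (V \<omega>) * norm (\<zeta> i \<omega>))"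
    proof (rule AE_I2)
      fix \<omega>
      have "\<bar>?Y k \<omega>\<bar> \<le> norm (V \<omega>) * norm (\<zeta> i \<omega> *v axis k 1)" by (rule Cauchy_Schwarz_ineq2)
      also have "\<dots> \<le> norm (V \<omega>) * (norm (\<zeta> i \<omega>) * norm (axis k 1 :: real ^ 'q))"
        by (intro mult_left_mono norm_matrix_vector_mult_le) auto
      finally show "norm (?Y k \<omega>) \<le> norm (norm (V \<omega>) * norm (\<zeta> i \<omega>))" by simp
    qed
  qed
  have eq: "V \<omega> \<bullet> (\<zeta> i \<omega> *v D i \<omega>) = (\<Sum>k\<in>UNIV. ?Y k \<omega> * D i \<omega> $ k)" for \<omega>
  proof -
    have "V \<omega> \<bullet> (\<zeta> i \<omega> *v D i \<omega>) = (V \<omega> v* \<zeta> i \<omega>) \<bullet> D i \<omega>" by (simp add: dot_lmul_matrix)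
    also have "\<dots> = (\<Sum>k\<in>UNIV. (V \<omega> v* \<zeta> i \<omega>) $ k * D i \<omega> $ k)" by (simp add: inner_vec_def)
    also have "\<dots> = (\<Sum>k\<in>UNIV. ?Y k \<omega> * D i \<omega> $ k)"
      by (simp only: dot_lmul_matrix[symmetric]) (simp add: inner_axis)
    finally show ?thesis .
  qed
  have g: "(\<lambda>x :: real ^ 'q. x $ k) \<in> borel_measurable borel" for k by measurable
  note N = B_incr_indep[OF s_nonneg s_Suc Y iY g B_incr_mean(1)[OF s_nonneg s_Suc]]
  show "integrable M (\<lambda>\<omega>. V \<omega> \<bullet> (\<zeta> i \<omega> *v D i \<omega>))"
    unfolding eq by (intro Bochner_Integration.integrable_sum N)
  show "(LINT \<omega>|M. V \<omega> \<bullet> (\<zeta> i \<omega> *v D i \<omega>)) = 0"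
    unfolding eq
    by (subst Bochner_Integration.integral_sum) (auto simp only: N B_incr_mean(2)[OF s_nonneg s_Suc] mult_zero_right sum.neutral_const)
qed

abbreviation "e i \<equiv> (LINT \<omega>|M. norm (J i \<omega>) powr p)"
abbreviation "a i \<equiv> (LINT \<omega>|M. norm (\<zeta> i \<omega>) powr p)"

lemma a_nonneg: "0 \<le> a i" and e_nonneg: "0 \<le> e i"
  by (auto intro: Bochner_Integration.integral_nonneg)

lemma integrable_J: "integrable M (\<lambda>\<omega>. norm (J i \<omega>) powr p)"
  and integrable_\<zeta>: "integrable M (\<lambda>\<omega>. norm (\<zeta> i \<omega>) powr p)"
  using J_Lp \<zeta>_Lp by (auto simp: in_Lp_def)

text \<open>The time scale \<open>h\<close> makes the Gronwall factor of the iteration independent of the length of the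
  time interval, which yields the factor \<open>h\<close> to the power \<open>p / 2 - 1\<close> needed for increments.\<close>

lemma moment_step:
  assumes h: "\<Delta> i \<le> h" "0 < h"
  shows "e (Suc i) \<le> e i + bdg_rate CARD('q) p * (\<Delta> i / h * e i + 2 * (h powr (p / 2 - 1) * (\<Delta> i * a i)))"
proof -
  let ?g2 = "gauss_moment 2 ^ CARD('q)" and ?gp = "gauss_moment p ^ CARD('q)"
  \<comment> \<open>Up to the factor \<open>p\<close>, the gradient of the \<open>p\<close>-th power
    of the norm at \<open>J i\<close>.\<close>
  let ?V = "\<lambda>\<omega>. norm (J i \<omega>) powr (p - 2) *\<^sub>R J i \<omega>"
  let ?Y = "\<lambda>\<omega>. norm (J i \<omega>) powr (p - 2) * norm (\<zeta> i \<omega>) powr 2"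
  have nV: "norm (?V \<omega>) = norm (J i \<omega>) powr (p - 1)" for \<omega>
    by (cases "J i \<omega> = 0") (auto simp: powr_diff power2_eq_square)
  have V: "?V \<in> borel_measurable (F (s i))" using J_adapted[of i] by measurable
  have int1: "integrable M (\<lambda>\<omega>. norm (?V \<omega>) * norm (\<zeta> i \<omega>))"
  proof (rule Bochner_Integration.integrable_bound[OF Bochner_Integration.integrable_add[OF integrable_J[of i] integrable_\<zeta>[of i]]])
    show "AE \<omega> in M. norm (norm (?V \<omega>) * norm (\<zeta> i \<omega>)) \<le> norm (norm (J i \<omega>) powr p + norm (\<zeta> i \<omega>) powr p)"
      unfolding nV using p powr_mult_powr_le[of _ _ 1 p] by (intro AE_I2) simp
  qed measurable
  note O = noise_orthogonal[OF V int1]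
  have Y: "?Y \<in> borel_measurable (F (s i))" by measurable
  have iY: "integrable M ?Y"
  proof (rule Bochner_Integration.integrable_bound[OF Bochner_Integration.integrable_add[OF integrable_J[of i] integrable_\<zeta>[of i]]])
    show "AE \<omega> in M. norm (?Y \<omega>) \<le> norm (norm (J i \<omega>) powr p + norm (\<zeta> i \<omega>) powr p)"
      using p powr_mult_powr_le[of _ _ 2 p] by (intro AE_I2) (simp del: powr_numeral)
  qed measurable
  note N2 = noise_moment[OF _ Y iY, of 2]
  note Np = noise_moment[OF _ \<zeta>_powr_adapted integrable_\<zeta>, of p]
  have pw: "norm (J (Suc i) \<omega>) powr p \<le> norm (J i \<omega>) powr p + p * (?V \<omega> \<bullet> (\<zeta> i \<omega> *v D i \<omega>))
     + taylor_const p * (?Y \<omega> * norm (D i \<omega>) powr 2 + norm (\<zeta> i \<omega>) powr p * norm (D i \<omega>) powr p)" for \<omega>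
  proof -
    have "norm (J (Suc i) \<omega>) powr p \<le> norm (J i \<omega>) powr p + p * (?V \<omega> \<bullet> (\<zeta> i \<omega> *v D i \<omega>))
       + taylor_const p * (norm (J i \<omega>) powr (p - 2) * (norm (\<zeta> i \<omega> *v D i \<omega>))\<^sup>2 + norm (\<zeta> i \<omega> *v D i \<omega>) powr p)"
      using norm_add_powr_le[OF p, of "J i \<omega>" "\<zeta> i \<omega> *v D i \<omega>"] by (simp add: mult.assoc)
    also have "\<dots> \<le> norm (J i \<omega>) powr p + p * (?V \<omega> \<bullet> (\<zeta> i \<omega> *v D i \<omega>))
       + taylor_const p * (norm (J i \<omega>) powr (p - 2) * (norm (\<zeta> i \<omega>) powr 2 * norm (D i \<omega>) powr 2) + norm (\<zeta> i \<omega>) powr p * norm (D i \<omega>) powr p)"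
      using p noise_norm_le[of 2 i \<omega>] noise_norm_le[of p i \<omega>]
      by (intro add_left_mono mult_left_mono add_mono taylor_const_nonneg) auto
    finally show ?thesis by (simp add: mult.assoc)
  qed
  have D0: "0 \<le> \<Delta> i" using s_Suc[of i] by simp
  have "e (Suc i) \<le> (LINT \<omega>|M. norm (J i \<omega>) powr p + p * (?V \<omega> \<bullet> (\<zeta> i \<omega> *v D i \<omega>))
     + taylor_const p * (?Y \<omega> * norm (D i \<omega>) powr 2 + norm (\<zeta> i \<omega>) powr p * norm (D i \<omega>) powr p))"
    using p by (intro integral_mono pw integrable_J Bochner_Integration.integrable_add integrable_mult_right O N2 Np) auto
  also have "\<dots> = e i + p * (LINT \<omega>|M. ?V \<omega> \<bullet> (\<zeta> i \<omega> *v D i \<omega>))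
     + taylor_const p * ((LINT \<omega>|M. ?Y \<omega> * norm (D i \<omega>) powr 2) + (LINT \<omega>|M. norm (\<zeta> i \<omega>) powr p * norm (D i \<omega>) powr p))"
  proof -
    have lin: "integrable M f \<Longrightarrow> integrable M g \<Longrightarrow> integrable M k \<Longrightarrow> integrable M l \<Longrightarrow>
      (LINT \<omega>|M. f \<omega> + p * g \<omega> + taylor_const p * (k \<omega> + l \<omega>))
        = integral\<^sup>L M f + p * integral\<^sup>L M g + taylor_const p * (integral\<^sup>L M k + integral\<^sup>L M l)"
      for f g k l :: "'a \<Rightarrow> real" by simp
    then show ?thesis using p by (intro integrable_J O N2 Np lin) auto
  qed
  also have "\<dots> = e i
     + taylor_const p * ((LINT \<omega>|M. ?Y \<omega> * norm (D i \<omega>) powr 2) + (LINT \<omega>|M. norm (\<zeta> i \<omega>) powr p * norm (D i \<omega>) powr p))"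
    unfolding O(2) by simp
  also have "\<dots> \<le> e i + taylor_const p * ((LINT \<omega>|M. ?Y \<omega>) * (\<Delta> i powr (2 / 2) * ?g2) + a i * (\<Delta> i powr (p / 2) * ?gp))"
    using p by (intro add_left_mono mult_left_mono add_mono N2(2) Np(2) taylor_const_nonneg) auto
  \<comment> \<open>Young's inequality with weight \<open>1 / h\<close> splits the mixed moment into
    \<open>e i\<close> and \<open>a i\<close>. The power \<open>\<Delta> i powr (p / 2)\<close>
    keeps one factor \<open>\<Delta> i\<close> and gives up the rest to \<open>h\<close>.\<close>
  also have "\<dots> \<le> e i + taylor_const p * ((e i / h + h powr (p / 2 - 1) * a i) * (\<Delta> i * ?g2) + a i * ((\<Delta> i * h powr (p / 2 - 1)) * ?gp))"
  proof (intro add_left_mono mult_left_mono add_mono mult_mono taylor_const_nonneg)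
    have "(LINT \<omega>|M. ?Y \<omega>) \<le> (LINT \<omega>|M. norm (J i \<omega>) powr p / h + h powr (p / 2 - 1) * norm (\<zeta> i \<omega>) powr p)"
      using p h powr_Young_scaled[of _ _ h p]
      by (intro integral_mono iY Bochner_Integration.integrable_add integrable_mult_right integrable_divide_zero integrable_J integrable_\<zeta>) auto
    also have "\<dots> = e i / h + h powr (p / 2 - 1) * a i"
      using integrable_J[of i] integrable_\<zeta>[of i] by (subst Bochner_Integration.integral_add) auto
    finally show "(LINT \<omega>|M. ?Y \<omega>) \<le> e i / h + h powr (p / 2 - 1) * a i" .
    show "\<Delta> i powr (2 / 2) \<le> \<Delta> i" using D0 by simp
    show "\<Delta> i powr (p / 2) \<le> \<Delta> i * h powr (p / 2 - 1)"
    proof -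
      have "\<Delta> i powr (p / 2) = \<Delta> i * \<Delta> i powr (p / 2 - 1)"
        using D0 by (cases "\<Delta> i = 0") (auto simp: powr_diff)
      also have "\<dots> \<le> \<Delta> i * h powr (p / 2 - 1)" using D0 h p by (intro mult_left_mono powr_mono2) auto
      finally show ?thesis .
    qed
  qed (use p h D0 a_nonneg[of i] e_nonneg[of i] gauss_moment_nonneg in auto)
  also have "\<dots> \<le> e i + taylor_const p * ((e i / h + h powr (p / 2 - 1) * a i) * (\<Delta> i * (?g2 + ?gp)) + a i * ((\<Delta> i * h powr (p / 2 - 1)) * (?g2 + ?gp)))"
    using p h D0 a_nonneg[of i] e_nonneg[of i] gauss_moment_nonneg[of 2] gauss_moment_nonneg[of p]
    by (intro add_left_mono mult_left_mono add_mono taylor_const_nonneg) auto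
  also have "\<dots> = e i + bdg_rate CARD('q) p * (\<Delta> i / h * e i + 2 * (h powr (p / 2 - 1) * (\<Delta> i * a i)))"
  proof -
    have "x + c * ((x / h + w * y) * (d * g) + y * ((d * w) * g)) = x + (c * g) * (d / h * x + 2 * (w * (d * y)))"
      for x y c d g w :: real by (simp add: algebra_simps)
    then show ?thesis unfolding bdg_rate_def .
  qed
  finally show ?thesis .
qed

text \<open>Discrete Gronwall: the factors \<open>1 + k * \<Delta> i / h\<close> multiply up to at
  most the exponential of \<open>k * (s i - s 0) / h\<close>, which is bounded by
  \<open>exp k\<close> because the whole interval has length at most \<open>h\<close>.\<close>

lemma moment_bound:
  assumes h: "s m - s 0 \<le> h" "0 < h" and "i \<le> m"
  shows "e i \<le> exp (bdg_rate CARD('q) p * ((s i - s 0) / h)) *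
     (2 * bdg_rate CARD('q) p * (h powr (p / 2 - 1) * (\<Sum>j<i. \<Delta> j * a j)))"
  using \<open>i \<le> m\<close>
proof (induction i)
  case 0
  then show ?case using p by simp
next
  case (Suc i)
  define k where "k = bdg_rate CARD('q) p"
  define R where "R = 2 * k * (h powr (p / 2 - 1) * (\<Sum>j<i. \<Delta> j * a j))"
  define S where "S = 2 * k * (h powr (p / 2 - 1) * (\<Delta> i * a i))"
  have k: "0 \<le> k" unfolding k_def using p by (intro bdg_rate_nonneg) auto
  have D0: "0 \<le> \<Delta> j" for j using s_Suc[of j] by simp
  have S: "0 \<le> S" unfolding S_def using D0 a_nonneg k by auto
  have R: "0 \<le> R" unfolding R_def using D0 a_nonneg k by (auto intro!: mult_nonneg_nonneg sum_nonneg)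
  have "s (Suc i) \<le> s m" "s 0 \<le> s i" using s_mono Suc by (auto simp: incseq_def)
  then have Dh: "\<Delta> i \<le> h" using h by simp
  have IH: "e i \<le> exp (k * ((s i - s 0) / h)) * R"
    using Suc unfolding k_def R_def by simp
  have "e (Suc i) \<le> (1 + k * (\<Delta> i / h)) * e i + S"
    using moment_step[OF Dh h(2)] by (simp add: k_def S_def algebra_simps)
  also have "\<dots> \<le> exp (k * (\<Delta> i / h)) * (exp (k * ((s i - s 0) / h)) * R) + S"
    using IH e_nonneg[of i] by (intro add_right_mono mult_mono exp_ge_add_one_self) auto
  also have "\<dots> = exp (k * ((s (Suc i) - s 0) / h)) * R + S"
    by (simp add: mult.assoc[symmetric] exp_add[symmetric] distrib_left[symmetric] add_divide_distrib[symmetric])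
  also have "S \<le> exp (k * ((s (Suc i) - s 0) / h)) * S"
    using S k h \<open>s 0 \<le> s i\<close> D0[of i] mult_right_mono[of 1 "exp (k * ((s (Suc i) - s 0) / h))" S] by simp
  finally have "e (Suc i) \<le> exp (k * ((s (Suc i) - s 0) / h)) * (R + S)"
    by (simp add: distrib_left)
  also have "R + S = 2 * k * (h powr (p / 2 - 1) * (\<Sum>j<Suc i. \<Delta> j * a j))"
    unfolding R_def S_def by (simp add: algebra_simps)
  finally show ?case unfolding k_def .
qed

text \<open>The upper half of a Burkholder-Davis-Gundy inequality. The pathwise Doob inequality for
  the norms of the partial sums reduces the running maximum to the last sum, because the weighted
  increments it subtracts dominate terms of mean zero.\<close>

lemma bdg:
  assumes h: "s m - s 0 \<le> h" "0 < h"
  shows "integrable M (\<lambda>\<omega>. runmax (\<lambda>i. norm (J i \<omega>)) m powr p)"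
    and "(LINT \<omega>|M. runmax (\<lambda>i. norm (J i \<omega>)) m powr p)
      \<le> bdg_const CARD('q) p * (h powr (p / 2 - 1) * (\<Sum>j<m. \<Delta> j * a j))"
proof -
  define R where "R j \<omega> = runmax (\<lambda>i. norm (J i \<omega>)) j" for j \<omega>
  have R0: "0 \<le> R j \<omega>" for j \<omega> using le_runmax[of 0 j "\<lambda>i. norm (J i \<omega>)"] by (simp add: R_def)
  have Rad: "R j \<in> borel_measurable (F (s j))" for j
  proof (induction j)
    case 0
    then show ?case unfolding R_def by simp
  next
    case (Suc j)
    have "(\<lambda>\<omega>. max (R j \<omega>) (norm (J (Suc j) \<omega>))) \<in> borel_measurable (F (s (Suc j)))"
      using measurable_F_mono[OF Suc s_nonneg s_Suc] J_adapted[of "Suc j"] by measurable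
    then show ?case unfolding R_def by simp
  qed
  have Rm[measurable]: "R j \<in> borel_measurable M" for j using Rad s_nonneg by (rule measurable_F_M)
  have iR: "integrable M (\<lambda>\<omega>. R j \<omega> powr p)" for j
  proof (rule Bochner_Integration.integrable_bound)
    show "integrable M (\<lambda>\<omega>. \<Sum>i\<le>j. norm (J i \<omega>) powr p)"
      by (intro Bochner_Integration.integrable_sum integrable_J)
    show "AE \<omega> in M. norm (R j \<omega> powr p) \<le> norm (\<Sum>i\<le>j. norm (J i \<omega>) powr p)"
      unfolding R_def using runmax_powr_le[of "\<lambda>i. norm (J i _)"] by (intro AE_I2) (simp add: sum_nonneg)
  qed measurable
  then show "integrable M (\<lambda>\<omega>. runmax (\<lambda>i. norm (J i \<omega>)) m powr p)" by (simp add: R_def)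
  let ?V = "\<lambda>j \<omega>. R j \<omega> powr (p - 1) *\<^sub>R sgn (J j \<omega>)"
  have O: "integrable M (\<lambda>\<omega>. ?V j \<omega> \<bullet> (\<zeta> j \<omega> *v D j \<omega>))" "(LINT \<omega>|M. ?V j \<omega> \<bullet> (\<zeta> j \<omega> *v D j \<omega>)) = 0" for j
  proof -
    have V: "?V j \<in> borel_measurable (F (s j))"
      using Rad[of j] J_adapted[of j] by (simp add: sgn_div_norm)
    have "integrable M (\<lambda>\<omega>. norm (?V j \<omega>) * norm (\<zeta> j \<omega>))"
    proof (rule Bochner_Integration.integrable_bound[OF Bochner_Integration.integrable_add[OF iR[of j] integrable_\<zeta>[of j]]])
      show "AE \<omega> in M. norm (norm (?V j \<omega>) * norm (\<zeta> j \<omega>)) \<le> norm (R j \<omega> powr p + norm (\<zeta> j \<omega>) powr p)"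
        using p R0 powr_mult_powr_le[of "R j _" "norm (\<zeta> j _)" 1 p] by (intro AE_I2) (simp add: norm_sgn)
      show "(\<lambda>\<omega>. norm (?V j \<omega>) * norm (\<zeta> j \<omega>)) \<in> borel_measurable M"
        using measurable_F_M[OF V s_nonneg] by measurable
    qed
    from noise_orthogonal[OF V this]
    show "integrable M (\<lambda>\<omega>. ?V j \<omega> \<bullet> (\<zeta> j \<omega> *v D j \<omega>))" "(LINT \<omega>|M. ?V j \<omega> \<bullet> (\<zeta> j \<omega> *v D j \<omega>)) = 0" by auto
  qed
  have pw: "(\<Sum>j<m. ?V j \<omega> \<bullet> (\<zeta> j \<omega> *v D j \<omega>)) + R m \<omega> powr p / 4
     \<le> 4 powr (p - 1) * norm (J m \<omega>) powr p" for \<omega>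
  proof -
    \<comment> \<open>By convexity of the norm, its increment is at least the component of the noise
      in the direction of \<open>J j\<close>, and these components are centred.\<close>
    have "(\<Sum>j<m. ?V j \<omega> \<bullet> (\<zeta> j \<omega> *v D j \<omega>)) \<le> (\<Sum>j<m. R j \<omega> powr (p - 1) * (norm (J (Suc j) \<omega>) - norm (J j \<omega>)))"
    proof (rule sum_mono)
      fix j
      have "sgn (J j \<omega>) \<bullet> (\<zeta> j \<omega> *v D j \<omega>) = sgn (J j \<omega>) \<bullet> J (Suc j) \<omega> - sgn (J j \<omega>) \<bullet> J j \<omega>"
        by (simp add: inner_add_right)
      also have "sgn (J j \<omega>) \<bullet> J j \<omega> = norm (J j \<omega>)"
        by (cases "J j \<omega> = 0") (simp_all add: sgn_div_norm power2_norm_eq_inner[symmetric] power2_eq_square)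
      also have "sgn (J j \<omega>) \<bullet> J (Suc j) \<omega> \<le> norm (sgn (J j \<omega>)) * norm (J (Suc j) \<omega>)"
        by (rule norm_cauchy_schwarz)
      also have "\<dots> \<le> 1 * norm (J (Suc j) \<omega>)" by (intro mult_right_mono) (auto simp: norm_sgn)
      finally have "sgn (J j \<omega>) \<bullet> (\<zeta> j \<omega> *v D j \<omega>) \<le> norm (J (Suc j) \<omega>) - norm (J j \<omega>)" by simp
      then show "?V j \<omega> \<bullet> (\<zeta> j \<omega> *v D j \<omega>) \<le> R j \<omega> powr (p - 1) * (norm (J (Suc j) \<omega>) - norm (J j \<omega>))"
        unfolding inner_scaleR_left by (rule mult_left_mono) simp
    qed
    moreover have "(\<Sum>j<m. R j \<omega> powr (p - 1) * (norm (J (Suc j) \<omega>) - norm (J j \<omega>))) + R m \<omega> powr p / 2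
         \<le> R m \<omega> powr (p - 1) * norm (J m \<omega>)"
      unfolding R_def by (rule pathwise_doob[OF p]) auto
    moreover have "R m \<omega> powr (p - 1) * norm (J m \<omega>) \<le> R m \<omega> powr p / 4 + 4 powr (p - 1) * norm (J m \<omega>) powr p"
      using p R0 by (intro powr_Young_quarter) auto
    ultimately show ?thesis by linarith
  qed
  have "(LINT \<omega>|M. (\<Sum>j<m. ?V j \<omega> \<bullet> (\<zeta> j \<omega> *v D j \<omega>)) + R m \<omega> powr p / 4)
     \<le> (LINT \<omega>|M. 4 powr (p - 1) * norm (J m \<omega>) powr p)"
    by (intro integral_mono pw Bochner_Integration.integrable_add Bochner_Integration.integrable_sum O
        integrable_divide_zero iR integrable_mult_right integrable_J)
  also have "(LINT \<omega>|M. (\<Sum>j<m. ?V j \<omega> \<bullet> (\<zeta> j \<omega> *v D j \<omega>)) + R m \<omega> powr p / 4)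
     = (\<Sum>j<m. (LINT \<omega>|M. ?V j \<omega> \<bullet> (\<zeta> j \<omega> *v D j \<omega>))) + (LINT \<omega>|M. R m \<omega> powr p) / 4"
    by (subst Bochner_Integration.integral_add, intro Bochner_Integration.integrable_sum O,
        use iR in simp, subst Bochner_Integration.integral_sum, rule O, simp)
  also have "\<dots> = (LINT \<omega>|M. R m \<omega> powr p) / 4" unfolding O(2) by simp
  finally have "(LINT \<omega>|M. R m \<omega> powr p) \<le> 4 * (4 powr (p - 1) * e m)" by simp
  also have "\<dots> = 4 powr p * e m" by (simp add: powr_diff)
  also have "e m \<le> exp (bdg_rate CARD('q) p * ((s m - s 0) / h)) *
     (2 * bdg_rate CARD('q) p * (h powr (p / 2 - 1) * (\<Sum>j<m. \<Delta> j * a j)))"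
    using h by (intro moment_bound) auto
  also have "exp (bdg_rate CARD('q) p * ((s m - s 0) / h)) \<le> exp (bdg_rate CARD('q) p * 1)"
    using h p by (auto intro!: mult_left_mono bdg_rate_nonneg simp: divide_le_eq)
  finally show "(LINT \<omega>|M. runmax (\<lambda>i. norm (J i \<omega>)) m powr p)
      \<le> bdg_const CARD('q) p * (h powr (p / 2 - 1) * (\<Sum>j<m. \<Delta> j * a j))"
    unfolding bdg_const_def R_def using p a_nonneg s_Suc
    by (simp add: mult.assoc mult_left_mono mult_right_mono sum_nonneg bdg_rate_nonneg)
qed

end

section \<open>Coefficients and the Wasserstein distance\<close>

text \<open>Hoelder's inequality for a sum of weights at most \<open>h\<close>. It results from
  Young's inequality between each \<open>b j\<close> and the weighted mean \<open>c\<close>, summed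
  up with the weights.\<close>

lemma sum_weighted_powr_le:
  fixes w b :: "nat \<Rightarrow> real"
  assumes w: "\<And>j. 0 \<le> w j" and b: "\<And>j. 0 \<le> b j" and p: "p \<ge> 1" and h: "(\<Sum>j<m. w j) \<le> h" "h > 0"
  shows "(\<Sum>j<m. w j * b j) powr p \<le> h powr (p - 1) * (\<Sum>j<m. w j * b j powr p)"
proof (cases "(\<Sum>j<m. w j) = 0")
  case True
  then have "w j = 0" if "j < m" for j using w that by (subst (asm) sum_nonneg_eq_0_iff) auto
  then show ?thesis by simp
next
  case False
  define W where "W = (\<Sum>j<m. w j)"
  have W: "W > 0" using False w by (simp add: W_def sum_nonneg order.not_eq_order_implies_strict)
  define c where "c = (\<Sum>j<m. w j * b j) / W"
  have c: "0 \<le> c" using W w b by (simp add: c_def sum_nonneg)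
  have Y: "c powr (p - 1) * b j \<le> (1 - 1/p) * c powr p + 1/p * b j powr p" for j
  proof (cases "c = 0 \<or> b j = 0")
    case False
    have "(c powr p) powr (1 - 1/p) * (b j powr p) powr (1/p) \<le> (1 - 1/p) * c powr p + 1/p * b j powr p"
      using p c b False by (intro Youngs_inequality_0) auto
    moreover have "p * (1 - 1/p) = p - 1" using p by (simp add: field_simps)
    ultimately show ?thesis using p c b by (simp add: powr_powr)
  qed (use p in auto)
  have "(\<Sum>j<m. w j * (c powr (p - 1) * b j)) \<le> (\<Sum>j<m. w j * ((1 - 1/p) * c powr p + 1/p * b j powr p))"
    by (intro sum_mono mult_left_mono Y w)
  also have "\<dots> = (1 - 1/p) * (W * c powr p) + 1/p * (\<Sum>j<m. w j * b j powr p)"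
    by (simp add: W_def sum_distrib_left sum_distrib_right sum.distrib sum_subtractf algebra_simps)
  also have "(\<Sum>j<m. w j * (c powr (p - 1) * b j)) = c powr (p - 1) * (W * c)"
  proof -
    have "(\<Sum>j<m. w j * (c powr (p - 1) * b j)) = c powr (p - 1) * (\<Sum>j<m. w j * b j)"
      by (simp add: sum_distrib_left mult_ac)
    also have "(\<Sum>j<m. w j * b j) = W * c" using W by (simp add: c_def)
    finally show ?thesis .
  qed
  also have "\<dots> = W * c powr p" using c by (cases "c = 0") (auto simp: powr_diff)
  finally have "1/p * (W * c powr p) \<le> 1/p * (\<Sum>j<m. w j * b j powr p)" by (simp add: algebra_simps)
  then have *: "W * c powr p \<le> (\<Sum>j<m. w j * b j powr p)" using p by (simp add: divide_le_cancel)
  have "(\<Sum>j<m. w j * b j) powr p = (W * c) powr p" using W by (simp add: c_def)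
  also have "\<dots> = W powr (p - 1) * (W * c powr p)" using W by (simp add: powr_mult powr_diff)
  also have "\<dots> \<le> h powr (p - 1) * (\<Sum>j<m. w j * b j powr p)"
    using W c h p w b by (intro mult_mono * powr_mono2) (auto simp: W_def)
  finally show ?thesis .
qed

section \<open>Drift and noise together\<close>

context bm_steps
begin

text \<open>The drift gains \<open>h powr (p - 1)\<close> by Hoelder's inequality in time, the noise
  only \<open>h powr (p / 2 - 1)\<close> by the maximal inequality. The latter is what makes
  increments of order one half.\<close>

lemma ito_sum_bound:
  fixes \<beta> :: "nat \<Rightarrow> 'a \<Rightarrow> real ^ 'd"
  assumes h: "s m - s 0 \<le> h" "0 < h" and \<beta>: "\<And>i. in_Lp M p (\<beta> i)"
  defines "Z \<equiv> \<lambda>i \<omega>. (\<Sum>j<i. \<Delta> j *\<^sub>R \<beta> j \<omega> + \<zeta> j \<omega> *v D j \<omega>)"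
  shows "integrable M (\<lambda>\<omega>. runmax (\<lambda>i. norm (Z i \<omega>)) m powr p)" (is ?int)
    and "(LINT \<omega>|M. runmax (\<lambda>i. norm (Z i \<omega>)) m powr p)
      \<le> 2 powr p * (h powr (p - 1) * (\<Sum>j<m. \<Delta> j * (LINT \<omega>|M. norm (\<beta> j \<omega>) powr p))
          + bdg_const CARD('q) p * (h powr (p / 2 - 1) * (\<Sum>j<m. \<Delta> j * a j)))" (is ?bound)
proof -
  have [measurable]: "\<beta> i \<in> borel_measurable M" for i using \<beta> by (rule in_Lp_measurable)
  have D0: "0 \<le> \<Delta> j" for j using s_Suc[of j] by simp
  have RJ0: "0 \<le> runmax (\<lambda>i. norm (J i \<omega>)) m" for \<omega>
    using le_runmax[of 0 m "\<lambda>i. norm (J i \<omega>)"] by simp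
  have RZ0: "0 \<le> runmax (\<lambda>i. norm (Z i \<omega>)) m" for \<omega>
    using le_runmax[of 0 m "\<lambda>i. norm (Z i \<omega>)"] by (simp add: Z_def)
  let ?G = "\<lambda>\<omega>. 2 powr p * (h powr (p - 1) * (\<Sum>j<m. \<Delta> j * norm (\<beta> j \<omega>) powr p) + runmax (\<lambda>i. norm (J i \<omega>)) m powr p)"
  have le: "runmax (\<lambda>i. norm (Z i \<omega>)) m powr p \<le> ?G \<omega>" for \<omega>
  proof -
    let ?b = "(\<Sum>j<m. \<Delta> j * norm (\<beta> j \<omega>))"
    have b0: "0 \<le> ?b" using D0 by (intro sum_nonneg) auto
    have "runmax (\<lambda>i. norm (Z i \<omega>)) m \<le> ?b + runmax (\<lambda>i. norm (J i \<omega>)) m"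
    proof (rule runmax_le)
      fix i assume i: "i \<le> m"
      have "norm (Z i \<omega>) \<le> norm (\<Sum>j<i. \<Delta> j *\<^sub>R \<beta> j \<omega>) + norm (J i \<omega>)"
        unfolding Z_def by (simp add: sum.distrib norm_triangle_ineq)
      also have "norm (\<Sum>j<i. \<Delta> j *\<^sub>R \<beta> j \<omega>) \<le> (\<Sum>j<i. \<Delta> j * norm (\<beta> j \<omega>))"
        using D0 by (intro order.trans[OF norm_sum]) (simp)
      also have "\<dots> \<le> ?b" using i D0 by (intro sum_mono2) auto
      also have "norm (J i \<omega>) \<le> runmax (\<lambda>i. norm (J i \<omega>)) m" using i by (rule le_runmax)
      finally show "norm (Z i \<omega>) \<le> ?b + runmax (\<lambda>i. norm (J i \<omega>)) m" by simp
    qed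
    then have "runmax (\<lambda>i. norm (Z i \<omega>)) m powr p \<le> (?b + runmax (\<lambda>i. norm (J i \<omega>)) m) powr p"
      using p RZ0 by (intro powr_mono2) auto
    also have "\<dots> \<le> 2 powr p * (?b powr p + runmax (\<lambda>i. norm (J i \<omega>)) m powr p)"
      using p b0 RJ0 by (intro powr_add_le) auto
    also have "?b powr p \<le> h powr (p - 1) * (\<Sum>j<m. \<Delta> j * norm (\<beta> j \<omega>) powr p)"
      using p D0 h by (intro sum_weighted_powr_le) (auto simp: sum_lessThan_telescope)
    finally show ?thesis by (simp add: mult_left_mono)
  qed
  have i\<beta>: "integrable M (\<lambda>\<omega>. \<Sum>j<m. \<Delta> j * norm (\<beta> j \<omega>) powr p)"
    using in_Lp_integrable[OF \<beta>] by (intro Bochner_Integration.integrable_sum integrable_mult_right)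
  have iG: "integrable M ?G"
    by (intro integrable_mult_right Bochner_Integration.integrable_add i\<beta> bdg(1)[OF h])
  have rm: "(\<lambda>\<omega>. runmax (\<lambda>i. norm (Z i \<omega>)) m) \<in> borel_measurable M"
  proof (induction m)
    case (Suc k)
    have "Z (Suc k) \<in> borel_measurable M" unfolding Z_def by measurable
    with Suc show ?case by simp
  qed (simp add: Z_def)
  show i: ?int
    using rm le by (intro Bochner_Integration.integrable_bound[OF iG]) (auto intro!: AE_I2 order.trans[OF le abs_ge_self])
  have "(LINT \<omega>|M. runmax (\<lambda>i. norm (Z i \<omega>)) m powr p) \<le> (LINT \<omega>|M. ?G \<omega>)"
    by (intro integral_mono i iG le)
  also have "\<dots> = 2 powr p * (h powr (p - 1) * (\<Sum>j<m. \<Delta> j * (LINT \<omega>|M. norm (\<beta> j \<omega>) powr p))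
      + (LINT \<omega>|M. runmax (\<lambda>i. norm (J i \<omega>)) m powr p))"
    using i\<beta> bdg(1)[OF h] in_Lp_integrable[OF \<beta>]
    by (simp add: Bochner_Integration.integral_sum)
  also have "\<dots> \<le> 2 powr p * (h powr (p - 1) * (\<Sum>j<m. \<Delta> j * (LINT \<omega>|M. norm (\<beta> j \<omega>) powr p))
          + bdg_const CARD('q) p * (h powr (p / 2 - 1) * (\<Sum>j<m. \<Delta> j * a j)))"
    using bdg(2)[OF h] by (intro mult_left_mono add_left_mono) auto
  finally show ?bound .
qed

end

section \<open>Operator norm and Frobenius norm\<close>

lemma op_norm_component_le: "\<bar>A $ i $ j\<bar> \<le> op_norm A" for A :: "real ^ 'q ^ 'd"
proof -
  have "\<bar>A $ i $ j\<bar> = \<bar>(A *v axis j 1) $ i\<bar>" by (simp add: matrix_vector_mul_component inner_axis)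
  also have "\<dots> \<le> norm (A *v axis j 1)" by (rule component_le_norm_cart)
  also have "\<dots> \<le> onorm ((*v) A) * norm (axis j (1::real))"
    by (intro onorm bounded_bilinear.bounded_linear_right[OF bounded_bilinear_matrix_vector_mult])
  finally show ?thesis by (simp add: op_norm_def)
qed

text \<open>A crude comparison by summing the entries; the loss affects constants only.\<close>

lemma norm_le_op_norm: "norm A \<le> real (CARD('d) * CARD('q)) * op_norm A" for A :: "real ^ 'q ^ 'd"
proof -
  have "norm A \<le> (\<Sum>i\<in>UNIV. norm (A $ i))" by (simp add: norm_vec_def L2_set_le_sum)
  also have "\<dots> \<le> (\<Sum>i\<in>(UNIV::'d set). \<Sum>j\<in>(UNIV::'q set). \<bar>A $ i $ j\<bar>)"
    by (intro sum_mono norm_le_l1_cart)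
  also have "\<dots> \<le> (\<Sum>i\<in>(UNIV::'d set). \<Sum>j\<in>(UNIV::'q set). op_norm A)"
    by (intro sum_mono op_norm_component_le)
  finally show ?thesis by simp
qed

text \<open>The slack in \<open>K\<close> and \<open>K'\<close> lets the drift (with
  \<open>c = 1\<close>) and the diffusion coefficient (with \<open>c\<close> the number of entries)
  share one pair of constants.\<close>

lemma hoelder_lipschitz_norm:
  fixes f :: "real \<Rightarrow> 'b::euclidean_space \<Rightarrow> 'b measure \<Rightarrow> 'c::real_normed_vector"
  assumes "hoelder_lipschitz T p \<rho> L L' nrm f" and "\<And>x. norm x \<le> c * nrm x" and c: "c \<ge> 0"
    and "c * L \<le> K" "c * L' \<le> K'"
  shows "hoelder_lipschitz T p \<rho> K K' norm f"
  unfolding hoelder_lipschitz_def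
proof (intro allI impI ballI)
  fix s t x y and \<mu> \<nu> :: "'b measure"
  assume st: "0 \<le> s \<and> s \<le> t \<and> t \<le> T" and mn: "\<mu> \<in> finite_moment_measures p" "\<nu> \<in> finite_moment_measures p"
  have W: "0 \<le> wasserstein p \<mu> (return borel 0)" "0 \<le> wasserstein p \<mu> \<nu>" by (auto simp: wasserstein_def)
  have 1: "nrm (f t x \<mu> - f s x \<mu>) \<le> L' * ((1 + norm x + wasserstein p \<mu> (return borel 0)) * (t - s) powr \<rho>)"
    and 2: "nrm (f t x \<mu> - f t y \<nu>) \<le> L * (norm (x - y) + wasserstein p \<mu> \<nu>)"
    using assms(1) st mn unfolding hoelder_lipschitz_def by (auto simp: mult.assoc)
  have "norm (f t x \<mu> - f s x \<mu>) \<le> c * nrm (f t x \<mu> - f s x \<mu>)" by (rule assms)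
  also have "\<dots> \<le> c * (L' * ((1 + norm x + wasserstein p \<mu> (return borel 0)) * (t - s) powr \<rho>))"
    using c 1 by (rule mult_left_mono[rotated])
  also have "\<dots> = (c * L') * ((1 + norm x + wasserstein p \<mu> (return borel 0)) * (t - s) powr \<rho>)" by simp
  also have "\<dots> \<le> K' * ((1 + norm x + wasserstein p \<mu> (return borel 0)) * (t - s) powr \<rho>)"
    using assms(5) W by (intro mult_right_mono) auto
  finally have "norm (f t x \<mu> - f s x \<mu>) \<le> K' * (1 + norm x + wasserstein p \<mu> (return borel 0)) * (t - s) powr \<rho>"
    by (simp add: mult.assoc)
  moreover have "norm (f t x \<mu> - f t y \<nu>) \<le> c * nrm (f t x \<mu> - f t y \<nu>)" by (rule assms)
  then have "norm (f t x \<mu> - f t y \<nu>) \<le> c * (L * (norm (x - y) + wasserstein p \<mu> \<nu>))"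
    using mult_left_mono[OF 2 c] by linarith
  then have "norm (f t x \<mu> - f t y \<nu>) \<le> (c * L) * (norm (x - y) + wasserstein p \<mu> \<nu>)" by (simp add: mult.assoc)
  then have "norm (f t x \<mu> - f t y \<nu>) \<le> K * (norm (x - y) + wasserstein p \<mu> \<nu>)"
    using mult_right_mono[OF assms(4), of "norm (x - y) + wasserstein p \<mu> \<nu>"] W by simp
  ultimately show "norm (f t x \<mu> - f s x \<mu>) \<le> K' * (1 + norm x + wasserstein p \<mu> (return borel 0)) * (t - s) powr \<rho> \<and>
    norm (f t x \<mu> - f t y \<nu>) \<le> K * (norm (x - y) + wasserstein p \<mu> \<nu>)" by blast
qed

section \<open>Coefficients evaluated at random variables and their laws\<close>

context prob_space
begin

lemma nn_integral_in_Lp: "in_Lp M p U \<Longrightarrow> (\<integral>\<^sup>+\<omega>. ennreal (norm (U \<omega>) powr p) \<partial>M) = ennreal (expectation (\<lambda>\<omega>. norm (U \<omega>) powr p))"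
  by (intro nn_integral_eq_integral) (auto simp: in_Lp_def)

lemma law_finite_moment:
  assumes "in_Lp M p (U :: 'a \<Rightarrow> 'b::euclidean_space)"
  shows "law M U \<in> finite_moment_measures p"
proof -
  have [measurable]: "U \<in> borel_measurable M" using assms by (rule in_Lp_measurable)
  have "(\<integral>\<^sup>+x. ennreal (norm x powr p) \<partial>law M U) = (\<integral>\<^sup>+\<omega>. ennreal (norm (U \<omega>) powr p) \<partial>M)"
    unfolding law_def by (subst nn_integral_distr) auto
  then show ?thesis unfolding finite_moment_measures_def
    using nn_integral_in_Lp[OF assms] by (auto simp: law_def intro: prob_space_distr)
qed

text \<open>With the Dirac mass written as a law, the estimates for two random variables also yield
  the growth bounds.\<close>

lemma law_zero: "law M (\<lambda>_. 0 :: 'b::euclidean_space) = return borel 0"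
  unfolding law_def by (rule distr_const) simp

text \<open>The joint law of \<open>U\<close> and \<open>V\<close> is one of the couplings over
  which the infimum is taken.\<close>

lemma wasserstein_law_le:
  fixes U V :: "'a \<Rightarrow> 'b::euclidean_space"
  assumes U: "in_Lp M p U" and V: "in_Lp M p V" and p: "p \<ge> 1"
  shows "wasserstein p (law M U) (law M V) powr p \<le> expectation (\<lambda>\<omega>. norm (U \<omega> - V \<omega>) powr p)"
proof -
  have [measurable]: "U \<in> borel_measurable M" "V \<in> borel_measurable M" using U V by (auto intro: in_Lp_measurable)
  let ?\<pi> = "distr M (borel \<Otimes>\<^sub>M borel) (\<lambda>\<omega>. (U \<omega>, V \<omega>))"
  have c: "?\<pi> \<in> couplings (law M U) (law M V)"
    unfolding couplings_def law_def
    by (auto simp: distr_distr comp_def intro!: prob_space_distr)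
  have "(INF \<pi>\<in>couplings (law M U) (law M V). \<integral>\<^sup>+ z. ennreal (norm (fst z - snd z) powr p) \<partial>\<pi>)
    \<le> (\<integral>\<^sup>+ z. ennreal (norm (fst z - snd z) powr p) \<partial>?\<pi>)"
    using c by (rule INF_lower)
  also have "\<dots> = (\<integral>\<^sup>+ \<omega>. ennreal (norm (U \<omega> - V \<omega>) powr p) \<partial>M)"
    by (subst nn_integral_distr) auto
  also have "\<dots> = ennreal (expectation (\<lambda>\<omega>. norm (U \<omega> - V \<omega>) powr p))"
    using p by (intro nn_integral_in_Lp in_Lp_diff U V) auto
  finally have "enn2real (INF \<pi>\<in>couplings (law M U) (law M V). \<integral>\<^sup>+ z. ennreal (norm (fst z - snd z) powr p) \<partial>\<pi>)
    \<le> expectation (\<lambda>\<omega>. norm (U \<omega> - V \<omega>) powr p)"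
    by (intro enn2real_leI Bochner_Integration.integral_nonneg) auto
  then show ?thesis unfolding wasserstein_def using p by (simp add: powr_powr)
qed

lemma wasserstein_law_zero_le:
  assumes "in_Lp M p U" "p \<ge> 1"
  shows "wasserstein p (law M U) (return borel 0) powr p \<le> expectation (\<lambda>\<omega>. norm (U \<omega>) powr p)"
  using wasserstein_law_le[OF assms(1) in_Lp_zero assms(2), unfolded law_zero] by simp

lemma wasserstein_law_self:
  assumes "in_Lp M p U" "p \<ge> 1"
  shows "wasserstein p (law M U) (law M U) = 0"
  using wasserstein_law_le[OF assms(1) assms(1) assms(2)] assms(2) powr_ge_zero[of "wasserstein p (law M U) (law M U)" p]
  by (simp)

lemma coeff_continuous:
  fixes f :: "real \<Rightarrow> 'b::euclidean_space \<Rightarrow> 'b measure \<Rightarrow> 'c::euclidean_space"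
  assumes f: "hoelder_lipschitz T p \<rho> L L' norm f" and t: "0 \<le> t" "t \<le> T" and U: "in_Lp M p U" and p: "p \<ge> 1"
  shows "continuous_on UNIV (\<lambda>x. f t x (law M U))"
proof -
  have "norm (f t x (law M U) - f t y (law M U)) \<le> L * norm (x - y)" for x y
    using f t law_finite_moment[OF U] wasserstein_law_self[OF U p] unfolding hoelder_lipschitz_def by fastforce
  then have "norm (f t x (law M U) - f t y (law M U)) \<le> \<bar>L\<bar> * norm (x - y)" for x y
    by (meson abs_ge_self mult_right_mono norm_ge_zero order_trans)
  then have "\<bar>L\<bar>-lipschitz_on UNIV (\<lambda>x. f t x (law M U))" by (auto intro!: lipschitz_onI simp: dist_norm)
  then show ?thesis by (rule lipschitz_on_continuous_on)
qed

lemma coeff_measurable: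
  fixes f :: "real \<Rightarrow> 'b::euclidean_space \<Rightarrow> 'b measure \<Rightarrow> 'c::euclidean_space"
  assumes f: "hoelder_lipschitz T p \<rho> L L' norm f" and t: "0 \<le> t" "t \<le> T" and U: "in_Lp M p U" and p: "p \<ge> 1"
    and V: "V \<in> borel_measurable N"
  shows "(\<lambda>\<omega>. f t (V \<omega>) (law M U)) \<in> borel_measurable N"
  using borel_measurable_continuous_onI[OF coeff_continuous[OF f t U p]] V by measurable

text \<open>Time is changed first, with \<open>x\<close> and the law of \<open>U\<close> frozen, and
  space and measure afterwards at the earlier time. Thus the growth factor involves \<open>U\<close>
  only.\<close>

lemma coeff_diff_le:
  fixes f :: "real \<Rightarrow> 'b::euclidean_space \<Rightarrow> 'b measure \<Rightarrow> 'c::euclidean_space"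
  assumes f: "hoelder_lipschitz T p \<rho> L L' norm f" and t: "0 \<le> s" "s \<le> t" "t \<le> T"
    and U: "in_Lp M p U" and V: "in_Lp M p V"
  shows "norm (f t x (law M U) - f s y (law M V))
    \<le> L' * (1 + norm x + wasserstein p (law M U) (return borel 0)) * (t - s) powr \<rho>
      + L * (norm (x - y) + wasserstein p (law M U) (law M V))"
proof -
  have "norm (f t x (law M U) - f s y (law M V))
    \<le> norm (f t x (law M U) - f s x (law M U)) + norm (f s x (law M U) - f s y (law M V))"
    using norm_triangle_ineq[of "f t x (law M U) - f s x (law M U)" "f s x (law M U) - f s y (law M V)"] by simp
  moreover have "norm (f t x (law M U) - f s x (law M U)) \<le> L' * (1 + norm x + wasserstein p (law M U) (return borel 0)) * (t - s) powr \<rho>"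
    using f t law_finite_moment[OF U] unfolding hoelder_lipschitz_def by blast
  moreover have "norm (f s x (law M U) - f s y (law M V)) \<le> L * (norm (x - y) + wasserstein p (law M U) (law M V))"
    using f t law_finite_moment[OF U] law_finite_moment[OF V] unfolding hoelder_lipschitz_def
    by (meson order.refl order_trans)
  ultimately show ?thesis by linarith
qed

text \<open>The coefficient is compared with its value at the origin and the Dirac mass. The
  distance of the law to the Dirac mass costs a second copy of the moment of \<open>U\<close>,
  whence the factor 2.\<close>

lemma coeff_growth:
  fixes f :: "real \<Rightarrow> 'b::euclidean_space \<Rightarrow> 'b measure \<Rightarrow> 'c::euclidean_space"
  assumes f: "hoelder_lipschitz T p \<rho> L L' norm f" and t: "0 \<le> t" "t \<le> T" and U: "in_Lp M p U" and p: "p \<ge> 1"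
    and K: "norm (f t 0 (return borel 0)) \<le> K" and L: "L \<ge> 0"
  shows "in_Lp M p (\<lambda>\<omega>. f t (U \<omega>) (law M U))"
    and "expectation (\<lambda>\<omega>. norm (f t (U \<omega>) (law M U)) powr p)
      \<le> 3 powr p * (K powr p + 2 * L powr p * expectation (\<lambda>\<omega>. norm (U \<omega>) powr p))"
proof -
  let ?w = "wasserstein p (law M U) (return borel 0)"
  have w: "0 \<le> ?w" by (simp add: wasserstein_def)
  have K0: "0 \<le> K" using norm_ge_zero K by (rule order_trans)
  have pw: "norm (f t (U \<omega>) (law M U)) powr p \<le> 3 powr p * (K powr p + L powr p * norm (U \<omega>) powr p + L powr p * ?w powr p)" for \<omega>
  proof -
    have "norm (f t (U \<omega>) (law M U) - f t 0 (law M (\<lambda>_. 0))) \<le> L * (norm (U \<omega> - 0) + wasserstein p (law M U) (law M (\<lambda>_. 0)))"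
      using coeff_diff_le[OF f t(1) order.refl t(2) U in_Lp_zero, of "U \<omega>" 0] by simp
    then have "norm (f t (U \<omega>) (law M U)) \<le> K + L * norm (U \<omega>) + L * ?w"
      using K norm_triangle_ineq2[of "f t (U \<omega>) (law M U)" "f t 0 (law M (\<lambda>_. 0))"] by (simp add: law_zero distrib_left)
    then have "norm (f t (U \<omega>) (law M U)) powr p \<le> (K + L * norm (U \<omega>) + L * ?w) powr p"
      using p by (intro powr_mono2) auto
    also have "\<dots> \<le> 3 powr p * (K powr p + (L * norm (U \<omega>)) powr p + (L * ?w) powr p)"
      using K0 L w p by (intro powr_add3_le) auto
    finally show ?thesis using L w by (simp add: powr_mult)
  qed
  have i: "integrable M (\<lambda>\<omega>. 3 powr p * (K powr p + L powr p * norm (U \<omega>) powr p + L powr p * ?w powr p))"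
    using in_Lp_integrable[OF U] by auto
  show Lp: "in_Lp M p (\<lambda>\<omega>. f t (U \<omega>) (law M U))"
    by (rule in_LpI_bound[OF coeff_measurable[OF f t U p in_Lp_measurable[OF U]] i AE_I2]) (rule pw)
  have "expectation (\<lambda>\<omega>. norm (f t (U \<omega>) (law M U)) powr p)
    \<le> expectation (\<lambda>\<omega>. 3 powr p * (K powr p + L powr p * norm (U \<omega>) powr p + L powr p * ?w powr p))"
    using Lp by (intro integral_mono i pw) (auto simp: in_Lp_def)
  also have "\<dots> = 3 powr p * (K powr p + L powr p * expectation (\<lambda>\<omega>. norm (U \<omega>) powr p) + L powr p * ?w powr p)"
    using in_Lp_integrable[OF U] by (simp add: prob_space)
  also have "\<dots> \<le> 3 powr p * (K powr p + L powr p * expectation (\<lambda>\<omega>. norm (U \<omega>) powr p) + L powr p * expectation (\<lambda>\<omega>. norm (U \<omega>) powr p))"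
    using wasserstein_law_zero_le[OF U p] by (intro mult_left_mono add_left_mono) auto
  finally show "expectation (\<lambda>\<omega>. norm (f t (U \<omega>) (law M U)) powr p)
      \<le> 3 powr p * (K powr p + 2 * L powr p * expectation (\<lambda>\<omega>. norm (U \<omega>) powr p))"
    by (simp add: algebra_simps)
qed

text \<open>The bases 6 and 4 arise from splitting time change against Lipschitz part (2) and then
  the growth factor into three terms (3) or the Lipschitz term into two (2). Each Wasserstein term
  is replaced by the moment next to it, which doubles that moment.\<close>

lemma coeff_diff_moment:
  fixes f :: "real \<Rightarrow> 'b::euclidean_space \<Rightarrow> 'b measure \<Rightarrow> 'c::euclidean_space"
  assumes f: "hoelder_lipschitz T p \<rho> L L' norm f" and t: "0 \<le> s" "s \<le> t" "t \<le> T"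
    and U: "in_Lp M p U" and V: "in_Lp M p V" and p: "p \<ge> 1" and L: "L \<ge> 0" "L' \<ge> 0"
  shows "expectation (\<lambda>\<omega>. norm (f t (U \<omega>) (law M U) - f s (V \<omega>) (law M V)) powr p)
    \<le> 6 powr p * L' powr p * (1 + 2 * expectation (\<lambda>\<omega>. norm (U \<omega>) powr p)) * (t - s) powr (\<rho> * p)
      + 2 * 4 powr p * L powr p * expectation (\<lambda>\<omega>. norm (U \<omega> - V \<omega>) powr p)"
proof -
  let ?w = "wasserstein p (law M U) (return borel 0)" and ?v = "wasserstein p (law M U) (law M V)"
  define c where "c = L' * (t - s) powr \<rho>"
  have c: "0 \<le> c" using L by (simp add: c_def)
  have w: "0 \<le> ?w" "0 \<le> ?v" by (auto simp: wasserstein_def)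
  let ?G = "\<lambda>\<omega>. 2 powr p * (c powr p * (3 powr p * (1 + norm (U \<omega>) powr p + ?w powr p))
      + L powr p * (2 powr p * (norm (U \<omega> - V \<omega>) powr p + ?v powr p)))"
  have pw: "norm (f t (U \<omega>) (law M U) - f s (V \<omega>) (law M V)) powr p \<le> ?G \<omega>" for \<omega>
  proof -
    have "norm (f t (U \<omega>) (law M U) - f s (V \<omega>) (law M V)) powr p
      \<le> (c * (1 + norm (U \<omega>) + ?w) + L * (norm (U \<omega> - V \<omega>) + ?v)) powr p"
      using coeff_diff_le[OF f t U V, of "U \<omega>" "V \<omega>"] p by (intro powr_mono2) (auto simp: c_def mult_ac)
    also have "\<dots> \<le> 2 powr p * ((c * (1 + norm (U \<omega>) + ?w)) powr p + (L * (norm (U \<omega> - V \<omega>) + ?v)) powr p)"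
      using c L w p by (intro powr_add_le) auto
    also have "\<dots> = 2 powr p * (c powr p * (1 + norm (U \<omega>) + ?w) powr p + L powr p * (norm (U \<omega> - V \<omega>) + ?v) powr p)"
      using c L w by (simp add: powr_mult)
    also have "\<dots> \<le> 2 powr p * (c powr p * (3 powr p * (1 powr p + norm (U \<omega>) powr p + ?w powr p))
      + L powr p * (2 powr p * (norm (U \<omega> - V \<omega>) powr p + ?v powr p)))"
      using w p by (intro mult_left_mono add_mono powr_add3_le powr_add_le) auto
    finally show ?thesis by simp
  qed
  have UV: "in_Lp M p (\<lambda>\<omega>. U \<omega> - V \<omega>)" using U V p by (intro in_Lp_diff) auto
  have i: "integrable M ?G" using in_Lp_integrable[OF U] in_Lp_integrable[OF UV] by auto
  have m: "(\<lambda>\<omega>. f t (U \<omega>) (law M U) - f s (V \<omega>) (law M V)) \<in> borel_measurable M"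
    using t by (intro borel_measurable_diff coeff_measurable[OF f _ _ U p] coeff_measurable[OF f _ _ V p] in_Lp_measurable[OF U] in_Lp_measurable[OF V]) auto
  have "in_Lp M p (\<lambda>\<omega>. f t (U \<omega>) (law M U) - f s (V \<omega>) (law M V))"
    by (rule in_LpI_bound[OF m i AE_I2]) (rule pw)
  then have "expectation (\<lambda>\<omega>. norm (f t (U \<omega>) (law M U) - f s (V \<omega>) (law M V)) powr p) \<le> expectation ?G"
    by (intro integral_mono i pw in_Lp_integrable)
  also have "\<dots> = 2 powr p * (c powr p * (3 powr p * (1 + expectation (\<lambda>\<omega>. norm (U \<omega>) powr p) + ?w powr p))
      + L powr p * (2 powr p * (expectation (\<lambda>\<omega>. norm (U \<omega> - V \<omega>) powr p) + ?v powr p)))"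
    using in_Lp_integrable[OF U] in_Lp_integrable[OF UV] by (simp add: prob_space)
  also have "\<dots> \<le> 2 powr p * (c powr p * (3 powr p * (1 + expectation (\<lambda>\<omega>. norm (U \<omega>) powr p) + expectation (\<lambda>\<omega>. norm (U \<omega>) powr p)))
      + L powr p * (2 powr p * (expectation (\<lambda>\<omega>. norm (U \<omega> - V \<omega>) powr p) + expectation (\<lambda>\<omega>. norm (U \<omega> - V \<omega>) powr p))))"
    using wasserstein_law_zero_le[OF U p] wasserstein_law_le[OF U V p] by (intro mult_left_mono add_mono order.refl) auto
  also have "\<dots> = (2 powr p * 3 powr p) * c powr p * (1 + 2 * expectation (\<lambda>\<omega>. norm (U \<omega>) powr p))
      + 2 * (2 powr p * 2 powr p) * L powr p * expectation (\<lambda>\<omega>. norm (U \<omega> - V \<omega>) powr p)"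
    by (simp add: algebra_simps)
  also have "2 powr p * 3 powr p = 6 powr p" by (simp flip: powr_mult)
  also have "2 powr p * 2 powr p = 4 powr p" by (simp flip: powr_mult)
  also have "c powr p = L' powr p * (t - s) powr (\<rho> * p)" using L by (simp add: c_def powr_mult powr_powr)
  finally show ?thesis by (simp add: mult_ac)
qed

end

section \<open>Limits of sums along refined grids\<close>

text \<open>Fatou's lemma in a form that admits a non-measurable \<open>v\<close>, such as the
  supremum of a path over a whole interval.\<close>

lemma nn_integral_limit_le:
  fixes u :: "nat \<Rightarrow> 'a \<Rightarrow> ennreal"
  assumes "\<And>n. u n \<in> borel_measurable M" and "AE x in M. v x \<le> liminf (\<lambda>n. u n x)"
    and "\<And>n. (\<integral>\<^sup>+x. u n x \<partial>M) \<le> C n" and "C \<longlonglongrightarrow> c"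
  shows "(\<integral>\<^sup>+x. v x \<partial>M) \<le> c"
proof -
  have "(\<integral>\<^sup>+x. v x \<partial>M) \<le> (\<integral>\<^sup>+x. liminf (\<lambda>n. u n x) \<partial>M)"
    using assms(2) by (rule nn_integral_mono_AE)
  also have "\<dots> \<le> liminf (\<lambda>n. \<integral>\<^sup>+x. u n x \<partial>M)" using assms(1) by (rule nn_integral_liminf)
  also have "\<dots> \<le> liminf C" using assms(3) by (intro Liminf_mono) auto
  also have "\<dots> = c" using assms(4) by (simp add: lim_imp_Liminf)
  finally show ?thesis .
qed

lemma le_liminf_of_tendsto: "f \<longlonglongrightarrow> a \<Longrightarrow> a \<le> liminf f" for a :: ennreal
  by (simp add: lim_imp_Liminf)

lemma tendsto_runmax: "(\<And>i. i \<le> m \<Longrightarrow> (\<lambda>k. y k i) \<longlonglongrightarrow> z i) \<Longrightarrow> (\<lambda>k. runmax (y k) m) \<longlonglongrightarrow> runmax z m"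
  by (induction m) (auto intro!: tendsto_max)

lemma runmax_measurable: "(\<And>i. i \<le> m \<Longrightarrow> (\<lambda>x. y x i) \<in> borel_measurable M) \<Longrightarrow> (\<lambda>x. runmax (y x) m) \<in> borel_measurable M"
  by (induction m) auto

lemma runmax_nonneg: "(\<And>i. 0 \<le> y i) \<Longrightarrow> 0 \<le> runmax y m"
  using le_runmax[of 0 m y] order_trans by blast

lemma ennreal_powr_SUP_le:
  fixes x :: "'i \<Rightarrow> real"
  assumes "\<And>u. u \<in> I \<Longrightarrow> 0 \<le> x u" and "\<And>u. u \<in> I \<Longrightarrow> ennreal (x u powr p) \<le> c" and p: "p > 0"
  shows "ennreal_powr (SUP u\<in>I. ennreal (x u)) p \<le> c"
proof (cases c)
  case (real c')
  have "x u \<le> c' powr (1/p)" if "u \<in> I" for u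
  proof -
    have "x u powr p \<le> c'" using assms(2)[OF that] real by simp
    then have "(x u powr p) powr (1/p) \<le> c' powr (1/p)" using p by (intro powr_mono2) auto
    then show ?thesis using p assms(1)[OF that] by (simp add: powr_powr)
  qed
  then have le: "(SUP u\<in>I. ennreal (x u)) \<le> ennreal (c' powr (1/p))"
    by (intro SUP_least ennreal_leI)
  then have fin: "(SUP u\<in>I. ennreal (x u)) \<noteq> \<top>"
    by (rule neq_top_trans[rotated]) simp
  have "enn2real (SUP u\<in>I. ennreal (x u)) powr p \<le> (c' powr (1/p)) powr p"
    using le p by (intro powr_mono2 enn2real_leI) auto
  also have "\<dots> = c'" using p real by (simp add: powr_powr)
  finally have "ennreal (enn2real (SUP u\<in>I. ennreal (x u)) powr p) \<le> c"
    unfolding real by (rule ennreal_leI)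
  then show ?thesis unfolding ennreal_powr_def if_not_P[OF fin] .
qed simp

text \<open>A left Riemann sum of an increasing function stays below the integral; in the induction
  this is \<open>1 + l * d \<le> exp (l * d)\<close>.\<close>

lemma sum_exp_le:
  fixes d l :: real
  assumes "0 \<le> d" "0 < l"
  shows "(\<Sum>k<m. d * exp (l * (real k * d))) \<le> exp (l * (real m * d)) / l"
proof (induction m)
  case (Suc m)
  let ?e = "exp (l * (real m * d))"
  have "(\<Sum>k<Suc m. d * exp (l * (real k * d))) \<le> ?e / l + d * ?e" using Suc by simp
  also have "\<dots> = (1 + l * d) * ?e / l" using assms by (simp add: field_simps)
  also have "\<dots> \<le> exp (l * d) * ?e / l" using assms by (intro divide_right_mono mult_right_mono exp_ge_add_one_self) auto
  also have "\<dots> = exp (l * (real (Suc m) * d)) / l" by (simp add: exp_add[symmetric] algebra_simps)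
  finally show ?case .
qed (use assms in simp)

text \<open>The power of \<open>T\<close> is the price for weakening the drift factor
  \<open>h powr (p - 1)\<close> to the factor \<open>h powr (p / 2 - 1)\<close> of the
  noise.\<close>

definition incr_const :: "nat \<Rightarrow> real \<Rightarrow> real \<Rightarrow> real" where
  "incr_const q p T = 2 powr p * (T powr (p / 2) + bdg_const q p)"

lemma incr_const_nonneg: "p \<ge> 0 \<Longrightarrow> 0 \<le> incr_const q p T"
  by (simp add: incr_const_def bdg_const_nonneg)

text \<open>The factor in the exponential next to \<open>T\<close> is the weight \<open>l\<close> of
  the closing argument, and \<open>c\<close> the growth constant of the coefficients. No step number
  and no probability space enters, so the bound is uniform in both.\<close>

definition sup_const :: "nat \<Rightarrow> real \<Rightarrow> real \<Rightarrow> real \<Rightarrow> real" where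
  "sup_const q p T c = (let A = incr_const q p T * T powr (p / 2 - 1) in
     2 powr p * (1 + A * T + A * T * c * (2 * 2 powr p * (1 + A * T)) * exp ((2 * 2 powr p * A * c + 1) * T)))"

section \<open>Dyadic refinements of the Euler grid\<close>

locale bm_grid = filtered_bm M F B
  for M :: "'a measure" and F and B :: "real \<Rightarrow> 'a \<Rightarrow> real ^ 'q" +
  fixes p T :: real and N :: nat
  assumes p: "p \<ge> 2" and T: "T > 0" and N: "N \<ge> 1"
begin

text \<open>Grid \<open>n\<close> refines the Euler grid, which is grid \<open>0\<close>, by a factor \<open>2 ^ n\<close>.\<close>

definition dt :: "nat \<Rightarrow> real" where "dt n = T / (real N * 2 ^ n)"
definition G :: "nat \<Rightarrow> nat \<Rightarrow> real" where "G n i = real i * dt n"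
definition NN :: "nat \<Rightarrow> nat" where "NN n = N * 2 ^ n"

definition gsum :: "(nat \<Rightarrow> nat \<Rightarrow> 'a \<Rightarrow> real ^ 'd) \<Rightarrow> (nat \<Rightarrow> nat \<Rightarrow> 'a \<Rightarrow> real ^ 'q ^ 'd) \<Rightarrow> nat \<Rightarrow> nat \<Rightarrow> 'a \<Rightarrow> real ^ 'd" where
  "gsum \<beta> \<zeta> n i \<omega> = (\<Sum>j<i. dt n *\<^sub>R \<beta> n j \<omega> + \<zeta> n j \<omega> *v (B (G n (Suc j)) \<omega> - B (G n j) \<omega>))"

lemma dt_pos: "dt n > 0" using T N by (simp add: dt_def)
lemma G_0 [simp]: "G n 0 = 0" by (simp add: G_def)
lemma G_nonneg: "0 \<le> G n i" using dt_pos[of n] by (simp add: G_def)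
lemma G_mono: "i \<le> j \<Longrightarrow> G n i \<le> G n j" using dt_pos[of n] by (simp add: G_def mult_right_mono)
lemma G_Suc: "G n (Suc i) = G n i + dt n" by (simp add: G_def algebra_simps)
lemma G_NN: "G n (NN n) = T" using N by (simp add: G_def NN_def dt_def)
lemma G_le_T: "i \<le> NN n \<Longrightarrow> G n i \<le> T" using G_mono[of i "NN n" n] by (simp add: G_NN)
lemma G_refine: "G (n + k) (i * 2 ^ k) = G n i" by (simp add: G_def dt_def power_add)
lemma NN_refine: "NN (n + k) = NN n * 2 ^ k" by (simp add: NN_def power_add)

lemma dt_tendsto: "dt \<longlonglongrightarrow> 0"
proof -
  have "(\<lambda>n. T / real N * (1/2) ^ n) \<longlonglongrightarrow> T / real N * 0"
    by (intro tendsto_mult tendsto_const LIMSEQ_power_zero) auto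
  then show ?thesis by (simp add: dt_def[abs_def] power_divide)
qed

text \<open>Index of the last grid point not after \<open>u\<close>; rounding down keeps the index
  of any time up to \<open>T\<close> within the grid.\<close>

definition fl :: "nat \<Rightarrow> real \<Rightarrow> nat" where "fl n u = nat \<lfloor>u / dt n\<rfloor>"

lemma fl_bounds:
  assumes "0 \<le> u"
  shows "G n (fl n u) \<le> u" "u \<le> G n (fl n u) + dt n"
proof -
  have "real (fl n u) = real_of_int \<lfloor>u / dt n\<rfloor>" using assms dt_pos[of n] by (simp add: fl_def)
  then have "real (fl n u) \<le> u / dt n" "u / dt n \<le> real (fl n u) + 1" by linarith+
  then show "G n (fl n u) \<le> u" "u \<le> G n (fl n u) + dt n" using dt_pos[of n]
    by (auto simp: G_def field_simps)
qed

lemma fl_le_NN: "u \<le> T \<Longrightarrow> fl n u \<le> NN n"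
proof -
  assume "u \<le> T"
  then have "u / dt n \<le> T / dt n" using dt_pos[of n] by (simp add: divide_right_mono)
  also have "\<dots> = real (NN n)" using T N by (simp add: dt_def NN_def)
  finally show ?thesis unfolding fl_def by linarith
qed

lemma fl_mono: "u \<le> v \<Longrightarrow> fl n u \<le> fl n v"
  using dt_pos[of n] by (auto simp: fl_def intro!: nat_mono floor_mono divide_right_mono)

lemma G_fl_tendsto: "0 \<le> u \<Longrightarrow> (\<lambda>n. G n (fl n u)) \<longlonglongrightarrow> u"
proof (rule tendsto_sandwich[of "\<lambda>n. u - dt n" _ _ "\<lambda>n. u"])
  assume u: "0 \<le> u"
  show "\<forall>\<^sub>F n in sequentially. u - dt n \<le> G n (fl n u)" "\<forall>\<^sub>F n in sequentially. G n (fl n u) \<le> u"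
    using fl_bounds[OF u] by (auto simp: algebra_simps)
  show "(\<lambda>n. u - dt n) \<longlonglongrightarrow> u" using tendsto_diff[OF tendsto_const dt_tendsto, of u] by simp
qed simp

text \<open>Only cells inside \<open>[0,T]\<close> are constrained, since the coefficients are under
  control only there.\<close>

definition adapted_Lp :: "(nat \<Rightarrow> nat \<Rightarrow> 'a \<Rightarrow> 'c::euclidean_space) \<Rightarrow> bool" where
  "adapted_Lp \<beta> \<longleftrightarrow> (\<forall>n i. i < NN n \<longrightarrow> \<beta> n i \<in> borel_measurable (F (G n i)) \<and> in_Lp M p (\<beta> n i))"

text \<open>The coefficients may vary with the level \<open>n\<close>. For a solution of the equation the convergence
  comes from \<open>L\<^sup>2\<close> and thus holds along a subsequence only.\<close>

definition ito_approx where
  "ito_approx \<beta> \<zeta> Y \<longleftrightarrow> adapted_Lp \<beta> \<and> adapted_Lp \<zeta> \<and>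
     (\<forall>n. \<exists>r. strict_mono r \<and> (AE \<omega> in M. \<forall>i\<le>NN n.
        (\<lambda>k. gsum \<beta> \<zeta> (n + r k) (i * 2 ^ r k) \<omega>) \<longlonglongrightarrow> Y (G n i) \<omega> - Y 0 \<omega>))"

abbreviation mom :: "('a \<Rightarrow> 'c::euclidean_space) \<Rightarrow> real" where
  "mom f \<equiv> expectation (\<lambda>\<omega>. norm (f \<omega>) powr p)"

lemma mom_nonneg: "0 \<le> mom f" by (auto intro: Bochner_Integration.integral_nonneg)

text \<open>The estimate for drift and noise, restricted to the cells between two grid points.
  Because \<open>h \<le> T\<close>, the better power of \<open>h\<close> from the drift is weakened
  to that of the noise, and one factor serves both.\<close>

lemma gsum_bound:
  fixes \<beta> :: "nat \<Rightarrow> nat \<Rightarrow> 'a \<Rightarrow> real ^ 'd"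
  assumes a: "adapted_Lp \<beta>" "adapted_Lp \<zeta>" and ij: "i \<le> j" "j \<le> NN n"
    and h: "G n j - G n i \<le> h" "0 < h" "h \<le> T"
    and S: "(\<Sum>l\<in>{i..<j}. dt n * (mom (\<beta> n l) + mom (\<zeta> n l))) \<le> S"
  shows "integrable M (\<lambda>\<omega>. runmax (\<lambda>l. norm (gsum \<beta> \<zeta> n (i + l) \<omega> - gsum \<beta> \<zeta> n i \<omega>)) (j - i) powr p)"
    and "expectation (\<lambda>\<omega>. runmax (\<lambda>l. norm (gsum \<beta> \<zeta> n (i + l) \<omega> - gsum \<beta> \<zeta> n i \<omega>)) (j - i) powr p)
       \<le> incr_const CARD('q) p T * (h powr (p / 2 - 1) * S)"
proof -
  let ?s = "\<lambda>l. G n (i + l)"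
  \<comment> \<open>The integrands are set to zero from \<open>j\<close> on, as nothing is known
    about them past the last cell.\<close>
  let ?z = "\<lambda>l. if i + l < j then \<zeta> n (i + l) else (\<lambda>_. 0)"
  let ?b = "\<lambda>l. if i + l < j then \<beta> n (i + l) else (\<lambda>_. 0)"
  interpret S: bm_steps M F B p ?s ?z
  proof
    show "incseq ?s" by (auto simp: incseq_def intro: G_mono)
    show "?z l \<in> borel_measurable (F (?s l))" "in_Lp M p (?z l)" for l
      using a(2) ij by (auto simp: adapted_Lp_def in_Lp_zero)
  qed (use p G_nonneg in auto)
  have b: "in_Lp M p (?b l)" for l using a(1) ij by (auto simp: adapted_Lp_def in_Lp_zero)
  have h': "?s (j - i) - ?s 0 \<le> h" using h ij by simp
  note B = S.ito_sum_bound[OF h' h(2), where \<beta> = ?b, OF b]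
  have eq: "(\<Sum>k<l. S.\<Delta> k *\<^sub>R ?b k \<omega> + ?z k \<omega> *v S.D k \<omega>) = gsum \<beta> \<zeta> n (i + l) \<omega> - gsum \<beta> \<zeta> n i \<omega>"
    if "l \<le> j - i" for l \<omega> using that
  proof (induction l)
    case (Suc l)
    then have "i + l < j" by simp
    with Suc show ?case by (simp add: gsum_def G_Suc)
  qed simp
  have rm: "runmax (\<lambda>l. norm (\<Sum>k<l. S.\<Delta> k *\<^sub>R ?b k \<omega> + ?z k \<omega> *v S.D k \<omega>)) l
      = runmax (\<lambda>l. norm (gsum \<beta> \<zeta> n (i + l) \<omega> - gsum \<beta> \<zeta> n i \<omega>)) l" if "l \<le> j - i" for l \<omega>
    using that
  proof (induction l)
    case (Suc l)
    then show ?case by (simp only: runmax.simps eq[OF Suc.prems] Suc.IH[OF Suc_leD[OF Suc.prems]])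
  qed (simp only: runmax.simps eq[OF le0])
  show "integrable M (\<lambda>\<omega>. runmax (\<lambda>l. norm (gsum \<beta> \<zeta> n (i + l) \<omega> - gsum \<beta> \<zeta> n i \<omega>)) (j - i) powr p)"
    using B(1) by (simp only: rm order.refl)
  define Sb where "Sb = (\<Sum>l<j - i. S.\<Delta> l * mom (?b l))"
  define Sz where "Sz = (\<Sum>l<j - i. S.\<Delta> l * mom (?z l))"
  have "Sb + Sz = (\<Sum>l<j - i. dt n * (mom (\<beta> n (i + l)) + mom (\<zeta> n (i + l))))"
    unfolding Sb_def Sz_def sum.distrib[symmetric]
    by (intro sum.cong) (auto simp: G_Suc distrib_left)
  also have "\<dots> = (\<Sum>l\<in>{i..<j}. dt n * (mom (\<beta> n l) + mom (\<zeta> n l)))"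
    using sum.shift_bounds_nat_ivl[of "\<lambda>l. dt n * (mom (\<beta> n l) + mom (\<zeta> n l))" 0 i "j - i"] ij
    by (simp add: atLeast0LessThan add.commute)
  finally have SS: "Sb + Sz \<le> S" using S by simp
  have S0: "0 \<le> Sb" "0 \<le> Sz" unfolding Sb_def Sz_def using dt_pos[of n]
    by (auto intro!: sum_nonneg mult_nonneg_nonneg mom_nonneg simp: G_Suc)
  have "expectation (\<lambda>\<omega>. runmax (\<lambda>l. norm (gsum \<beta> \<zeta> n (i + l) \<omega> - gsum \<beta> \<zeta> n i \<omega>)) (j - i) powr p)
    \<le> 2 powr p * (h powr (p - 1) * Sb + bdg_const CARD('q) p * (h powr (p / 2 - 1) * Sz))"
    using B(2) unfolding Sb_def Sz_def by (simp only: rm order.refl)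
  also have "\<dots> \<le> 2 powr p * ((T powr (p / 2) * h powr (p / 2 - 1)) * S + bdg_const CARD('q) p * (h powr (p / 2 - 1) * S))"
  proof (intro mult_left_mono add_mono mult_mono)
    have "h powr (p - 1) = h powr (p / 2) * h powr (p / 2 - 1)" by (simp flip: powr_add)
    also have "\<dots> \<le> T powr (p / 2) * h powr (p / 2 - 1)" using h p by (intro mult_right_mono powr_mono2) auto
    finally show "h powr (p - 1) \<le> T powr (p / 2) * h powr (p / 2 - 1)" .
  qed (use S0 SS p in \<open>auto intro: bdg_const_nonneg\<close>)
  also have "\<dots> = incr_const CARD('q) p T * (h powr (p / 2 - 1) * S)"
    by (simp add: incr_const_def algebra_simps)
  finally show "expectation (\<lambda>\<omega>. runmax (\<lambda>l. norm (gsum \<beta> \<zeta> n (i + l) \<omega> - gsum \<beta> \<zeta> n i \<omega>)) (j - i) powr p)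
       \<le> incr_const CARD('q) p T * (h powr (p / 2 - 1) * S)" .
qed

lemma gsum_measurable:
  assumes "adapted_Lp \<beta>" "adapted_Lp \<zeta>" "i \<le> NN n"
  shows "gsum \<beta> \<zeta> n i \<in> borel_measurable M"
  unfolding gsum_def[abs_def]
proof (intro borel_measurable_sum borel_measurable_add borel_measurable_scaleR borel_measurable_const
    borel_measurable_matrix_vector_mult borel_measurable_diff B_meas_M G_nonneg)
  fix j assume "j \<in> {..<i}"
  then have "j < NN n" using assms by simp
  then show "\<beta> n j \<in> borel_measurable M" "\<zeta> n j \<in> borel_measurable M"
    using assms by (auto simp: adapted_Lp_def in_Lp_def)
qed

text \<open>The sums on the finer grids \<open>n + k\<close> obey a bound uniform in
  \<open>k\<close>, and Fatou's lemma along the subsequence carries it to \<open>Y\<close>. The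
  maximum runs over points of grid \<open>n\<close> only, because the convergence is available
  exactly there.\<close>

lemma approx_incr_bound:
  fixes Y :: "real \<Rightarrow> 'a \<Rightarrow> real ^ 'd"
  assumes Y: "ito_approx \<beta> \<zeta> Y" and ij: "i \<le> j" "j \<le> NN n"
    and h: "G n j - G n i \<le> h" "0 < h" "h \<le> T"
    and S: "\<And>k. (\<Sum>l\<in>{i * 2^k..<j * 2^k}. dt (n + k) * (mom (\<beta> (n + k) l) + mom (\<zeta> (n + k) l))) \<le> S"
  shows "(\<integral>\<^sup>+\<omega>. ennreal (runmax (\<lambda>l. norm (Y (G n (i + l)) \<omega> - Y (G n i) \<omega>)) (j - i) powr p) \<partial>M)
     \<le> ennreal (incr_const CARD('q) p T * (h powr (p / 2 - 1) * S))"
proof -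
  have a: "adapted_Lp \<beta>" "adapted_Lp \<zeta>" using Y by (auto simp: ito_approx_def)
  obtain r where r: "strict_mono r" and lim: "AE \<omega> in M. \<forall>i\<le>NN n.
        (\<lambda>k. gsum \<beta> \<zeta> (n + r k) (i * 2 ^ r k) \<omega>) \<longlonglongrightarrow> Y (G n i) \<omega> - Y 0 \<omega>"
    using Y unfolding ito_approx_def by blast
  let ?y = "\<lambda>k \<omega> l. norm (gsum \<beta> \<zeta> (n + k) ((i + l) * 2 ^ k) \<omega> - gsum \<beta> \<zeta> (n + k) (i * 2 ^ k) \<omega>)"
  have ym: "(\<lambda>\<omega>. runmax (?y k \<omega>) (j - i)) \<in> borel_measurable M" for k
  proof (rule runmax_measurable)
    fix l assume l: "l \<le> j - i"
    have "(i + l) * 2 ^ k \<le> NN (n + k)" "i * 2 ^ k \<le> NN (n + k)" using l ij by (auto simp: NN_refine)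
    from gsum_measurable[OF a this(1)] gsum_measurable[OF a this(2)]
    show "(\<lambda>\<omega>. ?y k \<omega> l) \<in> borel_measurable M" by measurable
  qed
  have bound: "(\<integral>\<^sup>+\<omega>. ennreal (runmax (?y k \<omega>) (j - i) powr p) \<partial>M) \<le> ennreal (incr_const CARD('q) p T * (h powr (p / 2 - 1) * S))" for k
  proof -
    let ?x = "\<lambda>\<omega> l. norm (gsum \<beta> \<zeta> (n + k) (i * 2 ^ k + l) \<omega> - gsum \<beta> \<zeta> (n + k) (i * 2 ^ k) \<omega>)"
    have "G (n + k) (j * 2 ^ k) - G (n + k) (i * 2 ^ k) \<le> h" using h by (simp add: G_refine)
    note g = gsum_bound[OF a _ _ this h(2,3) S]
    have k: "i * 2 ^ k \<le> j * 2 ^ k" "j * 2 ^ k \<le> NN (n + k)" using ij by (auto simp: NN_refine)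
    have "(\<integral>\<^sup>+\<omega>. ennreal (runmax (?y k \<omega>) (j - i) powr p) \<partial>M) \<le> (\<integral>\<^sup>+\<omega>. ennreal (runmax (?x \<omega>) (j * 2 ^ k - i * 2 ^ k) powr p) \<partial>M)"
    proof (intro nn_integral_mono ennreal_leI powr_mono2)
      fix \<omega>
      show "runmax (?y k \<omega>) (j - i) \<le> runmax (?x \<omega>) (j * 2 ^ k - i * 2 ^ k)"
      proof (rule runmax_le)
        fix l assume "l \<le> j - i"
        then have "l * 2 ^ k \<le> j * 2 ^ k - i * 2 ^ k" by (simp flip: diff_mult_distrib)
        from le_runmax[OF this, of "?x \<omega>"] show "?y k \<omega> l \<le> runmax (?x \<omega>) (j * 2 ^ k - i * 2 ^ k)"
          by (simp add: distrib_right)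
      qed
    qed (use p in \<open>auto intro!: runmax_nonneg\<close>)
    also have "\<dots> = ennreal (expectation (\<lambda>\<omega>. runmax (?x \<omega>) (j * 2 ^ k - i * 2 ^ k) powr p))"
      using g(1)[OF k] by (intro nn_integral_eq_integral) auto
    also have "\<dots> \<le> ennreal (incr_const CARD('q) p T * (h powr (p / 2 - 1) * S))"
      using g(2)[OF k] by (intro ennreal_leI)
    finally show ?thesis .
  qed
  show ?thesis
  proof (rule nn_integral_limit_le[where u = "\<lambda>k \<omega>. ennreal (runmax (?y (r k) \<omega>) (j - i) powr p)"
        and C = "\<lambda>_. ennreal (incr_const CARD('q) p T * (h powr (p / 2 - 1) * S))"])
    show "(\<lambda>\<omega>. ennreal (runmax (?y (r k) \<omega>) (j - i) powr p)) \<in> borel_measurable M" for k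
      using ym[of "r k"] by measurable
    show "AE \<omega> in M. ennreal (runmax (\<lambda>l. norm (Y (G n (i + l)) \<omega> - Y (G n i) \<omega>)) (j - i) powr p)
      \<le> liminf (\<lambda>k. ennreal (runmax (?y (r k) \<omega>) (j - i) powr p))"
      using lim
    proof eventually_elim
      case (elim \<omega>)
      have "(\<lambda>k. runmax (?y (r k) \<omega>) (j - i)) \<longlonglongrightarrow> runmax (\<lambda>l. norm (Y (G n (i + l)) \<omega> - Y (G n i) \<omega>)) (j - i)"
      proof (rule tendsto_runmax)
        fix l assume l: "l \<le> j - i"
        have "(\<lambda>k. ?y (r k) \<omega> l) \<longlonglongrightarrow> norm ((Y (G n (i + l)) \<omega> - Y 0 \<omega>) - (Y (G n i) \<omega> - Y 0 \<omega>))"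
          using elim l ij by (intro tendsto_norm tendsto_diff) auto
        then show "(\<lambda>k. ?y (r k) \<omega> l) \<longlonglongrightarrow> norm (Y (G n (i + l)) \<omega> - Y (G n i) \<omega>)" by simp
      qed
      then have "(\<lambda>k. ennreal (runmax (?y (r k) \<omega>) (j - i) powr p)) \<longlonglongrightarrow>
        ennreal (runmax (\<lambda>l. norm (Y (G n (i + l)) \<omega> - Y (G n i) \<omega>)) (j - i) powr p)"
        using p by (intro tendsto_ennrealI tendsto_powr' tendsto_const) (auto intro!: always_eventually runmax_nonneg)
      then show ?case by (rule le_liminf_of_tendsto)
    qed
  qed (rule bound, rule tendsto_const)
qed

lemma mom_le_of_nn:
  assumes "(\<integral>\<^sup>+\<omega>. ennreal (norm (f \<omega>) powr p) \<partial>M) \<le> ennreal c" "0 \<le> c"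
  shows "mom f \<le> c"
  using assms(2,1) by (intro integral_real_bounded)

text \<open>In place of Gronwall's lemma: with \<open>K\<close> the supremum of \<open>exp (- l t)\<close> times the \<open>p\<close>-th moment at
  time \<open>t\<close>, the moment bound reads \<open>K \<le> R + K / 2\<close> once \<open>l\<close> is large.\<close>

lemma approx_sup_bound:
  fixes Y :: "real \<Rightarrow> 'a \<Rightarrow> real ^ 'd"
  assumes Y: "ito_approx \<beta> \<zeta> Y" and YLp: "\<And>n i. i \<le> NN n \<Longrightarrow> in_Lp M p (Y (G n i))"
    and fin: "\<And>n i. i \<le> NN n \<Longrightarrow> mom (Y (G n i)) \<le> H" and c: "0 \<le> c0" "0 \<le> c1"
    and cont: "AE \<omega> in M. continuous_on {0..T} (\<lambda>t. Y t \<omega>)"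
    and growth: "\<And>l K n i. 0 \<le> l \<Longrightarrow> 0 \<le> K \<Longrightarrow> (\<And>n i. i \<le> NN n \<Longrightarrow> mom (Y (G n i)) \<le> K * exp (l * G n i)) \<Longrightarrow>
      i < NN n \<Longrightarrow> mom (\<beta> n i) + mom (\<zeta> n i) \<le> c0 + c1 * (K * exp (l * G n i))"
  shows "(\<integral>\<^sup>+\<omega>. ennreal_powr (sup_norm {0..T} Y \<omega>) p \<partial>M) \<le> ennreal (sup_const CARD('q) p T c1 * (mom (Y 0) + c0))"
proof -
  define A where "A = incr_const CARD('q) p T * T powr (p / 2 - 1)"
  have A: "0 \<le> A" using p by (simp add: A_def incr_const_nonneg)
  define y0 where "y0 = mom (Y 0)"
  have y0: "0 \<le> y0" by (simp add: y0_def mom_nonneg)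
  have Y0: "in_Lp M p (Y 0)" using YLp[of 0 0] by simp
  \<comment> \<open>Twice the constant in front of \<open>K / l\<close> below, so that
    \<open>K\<close> comes back with a factor of at most \<open>1/2\<close>; the added 1 keeps
    \<open>l\<close> positive.\<close>
  define l where "l = 2 * 2 powr p * A * c1 + 1"
  have l: "l \<ge> 1" using A c by (simp add: l_def)
  define g where "g = (\<lambda>(n, i). exp (- (l * G n i)) * mom (Y (G n i)))"
  define I where "I = {(n, i). i \<le> NN n}"
  have gH: "g x \<le> H" if "x \<in> I" for x
  proof -
    obtain n i where x: "x = (n, i)" by (cases x)
    then have i: "i \<le> NN n" using that by (simp add: I_def)
    have "exp (- (l * G n i)) * mom (Y (G n i)) \<le> 1 * mom (Y (G n i))"
      using l G_nonneg by (intro mult_right_mono mom_nonneg) auto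
    then show ?thesis using fin[OF i] by (simp add: g_def x)
  qed
  \<comment> \<open>The a priori bound \<open>H\<close> makes the supremum finite, which permits the
    later subtraction of \<open>K / 2\<close>; its size does not enter the result.\<close>
  have bdd: "bdd_above (g ` I)" using gH by (rule bdd_aboveI2)
  have I0: "(0, 0) \<in> I" by (simp add: I_def)
  define K where "K = (SUP x\<in>I. g x)"
  have "g (0, 0) \<le> K" unfolding K_def by (rule cSUP_upper[OF I0 bdd])
  then have "mom (Y 0) \<le> K" by (simp add: g_def)
  then have K: "0 \<le> K" by (rule order_trans[OF mom_nonneg])
  have YK: "mom (Y (G n i)) \<le> K * exp (l * G n i)" if "i \<le> NN n" for n i
  proof -
    have "exp (- (l * G n i)) * mom (Y (G n i)) \<le> K"
      using cSUP_upper[OF _ bdd, of "(n, i)"] that unfolding K_def g_def I_def by simp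
    then show ?thesis by (simp add: exp_minus field_simps)
  qed
  have coef: "mom (\<beta> n i) + mom (\<zeta> n i) \<le> c0 + c1 * (K * exp (l * G n i))" if "i < NN n" for n i
    using growth[of l K] l K YK that by simp
  \<comment> \<open>The exponential weight sums up to its final value divided by \<open>l\<close>.
    This factor \<open>1 / l\<close> is the gain that makes absorption possible.\<close>
  have Ssum: "(\<Sum>m\<in>{0 * 2^k..<i * 2^k}. dt (n + k) * (mom (\<beta> (n + k) m) + mom (\<zeta> (n + k) m)))
     \<le> c0 * T + c1 * (K * (exp (l * G n i) / l))" if i: "i \<le> NN n" for n i k
  proof -
    have "(\<Sum>m<i * 2^k. dt (n + k) * (mom (\<beta> (n + k) m) + mom (\<zeta> (n + k) m)))
      \<le> (\<Sum>m<i * 2^k. dt (n + k) * (c0 + c1 * (K * exp (l * G (n + k) m))))"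
    proof (intro sum_mono mult_left_mono coef)
      fix m assume "m \<in> {..<i * 2 ^ k}"
      then show "m < NN (n + k)" using i by (simp add: NN_refine) (meson mult_le_mono1 order_less_le_trans)
    qed (use dt_pos less_imp_le in auto)
    also have "\<dots> = c0 * G (n + k) (i * 2^k) + c1 * (K * (\<Sum>m<i * 2^k. dt (n + k) * exp (l * (real m * dt (n + k)))))"
      by (simp add: sum_distrib_left sum.distrib distrib_left G_def mult_ac)
    also have "\<dots> \<le> c0 * T + c1 * (K * (exp (l * (real (i * 2^k) * dt (n + k))) / l))"
      using G_le_T[OF i] c K l dt_pos[of "n + k"] by (intro add_mono mult_left_mono sum_exp_le) (auto simp: G_refine)
    also have "real (i * 2^k) * dt (n + k) = G n i" by (simp add: G_refine[of n k, symmetric]) (simp add: G_def)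
    finally show ?thesis by (simp add: atLeast0LessThan)
  qed
  have incr: "(\<integral>\<^sup>+\<omega>. ennreal (runmax (\<lambda>m. norm (Y (G n m) \<omega> - Y 0 \<omega>)) i powr p) \<partial>M)
     \<le> ennreal (A * (c0 * T + c1 * (K * (exp (l * G n i) / l))))" if i: "i \<le> NN n" for n i
    using approx_incr_bound[OF Y _ i, of 0 T, OF _ _ T order.refl Ssum[OF i]] G_le_T[OF i]
    by (simp add: A_def mult.assoc)
  define R where "R = 2 powr p * (y0 + A * (c0 * T))"
  have R: "0 \<le> R" using A y0 c T by (simp add: R_def)
  have split: "ennreal (norm (Y (G n i) \<omega>) powr p) \<le> ennreal (2 powr p) * (ennreal (norm (Y 0 \<omega>) powr p) + ennreal (norm (Y (G n i) \<omega> - Y 0 \<omega>) powr p))" for n i \<omega>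
  proof -
    have "norm (Y (G n i) \<omega>) powr p \<le> (norm (Y 0 \<omega>) + norm (Y (G n i) \<omega> - Y 0 \<omega>)) powr p"
      using p norm_triangle_ineq[of "Y 0 \<omega>" "Y (G n i) \<omega> - Y 0 \<omega>"] by (intro powr_mono2) auto
    also have "\<dots> \<le> 2 powr p * (norm (Y 0 \<omega>) powr p + norm (Y (G n i) \<omega> - Y 0 \<omega>) powr p)"
      using p by (intro powr_add_le) auto
    finally show ?thesis by (simp flip: ennreal_plus ennreal_mult)
  qed
  have Ym [measurable]: "Y 0 \<in> borel_measurable M" using Y0 by (rule in_Lp_measurable)
  have Ymeas: "Y (G n i) \<in> borel_measurable M" if "i \<le> NN n" for n i
    using YLp[OF that] by (rule in_Lp_measurable)
  have gK: "exp (- (l * G n i)) * mom (Y (G n i)) \<le> R + K / 2" if i: "i \<le> NN n" for n i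
  proof -
    have Yi[measurable]: "Y (G n i) \<in> borel_measurable M" using YLp[OF i] by (rule in_Lp_measurable)
    have "(\<integral>\<^sup>+\<omega>. ennreal (norm (Y (G n i) \<omega>) powr p) \<partial>M)
      \<le> (\<integral>\<^sup>+\<omega>. ennreal (2 powr p) * (ennreal (norm (Y 0 \<omega>) powr p) + ennreal (norm (Y (G n i) \<omega> - Y 0 \<omega>) powr p)) \<partial>M)"
      by (intro nn_integral_mono split)
    also have "\<dots> = ennreal (2 powr p) * ((\<integral>\<^sup>+\<omega>. ennreal (norm (Y 0 \<omega>) powr p) \<partial>M) + (\<integral>\<^sup>+\<omega>. ennreal (norm (Y (G n i) \<omega> - Y 0 \<omega>) powr p) \<partial>M))"
      by (subst nn_integral_cmult, measurable) (subst nn_integral_add, auto)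
    also have "\<dots> \<le> ennreal (2 powr p) * (ennreal y0 + ennreal (A * (c0 * T + c1 * (K * (exp (l * G n i) / l)))))"
    proof (intro mult_left_mono add_mono)
      show "(\<integral>\<^sup>+\<omega>. ennreal (norm (Y 0 \<omega>) powr p) \<partial>M) \<le> ennreal y0"
        using nn_integral_in_Lp[OF Y0] by (simp add: y0_def)
      have "(\<integral>\<^sup>+\<omega>. ennreal (norm (Y (G n i) \<omega> - Y 0 \<omega>) powr p) \<partial>M)
        \<le> (\<integral>\<^sup>+\<omega>. ennreal (runmax (\<lambda>m. norm (Y (G n m) \<omega> - Y 0 \<omega>)) i powr p) \<partial>M)"
        using p le_runmax[of i i] by (intro nn_integral_mono ennreal_leI powr_mono2) auto
      also note incr[OF i]
      finally show "(\<integral>\<^sup>+\<omega>. ennreal (norm (Y (G n i) \<omega> - Y 0 \<omega>) powr p) \<partial>M) \<le> ennreal (A * (c0 * T + c1 * (K * (exp (l * G n i) / l))))" .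
    qed auto
    also have "\<dots> = ennreal (2 powr p * (y0 + A * (c0 * T + c1 * (K * (exp (l * G n i) / l)))))"
      using y0 A c T K l by (simp flip: ennreal_plus ennreal_mult)
    finally have "mom (Y (G n i)) \<le> 2 powr p * (y0 + A * (c0 * T + c1 * (K * (exp (l * G n i) / l))))"
      using y0 A c T K l by (intro mom_le_of_nn) auto
    also have "\<dots> = R + (2 powr p * A * c1 / l) * (K * exp (l * G n i))"
      by (simp add: R_def algebra_simps)
    also have "\<dots> \<le> R * exp (l * G n i) + (1/2) * (K * exp (l * G n i))"
    proof (intro add_mono mult_right_mono)
      show "R \<le> R * exp (l * G n i)" using R l G_nonneg mult_left_mono[of 1 "exp (l * G n i)" R] by simp
      have "2 powr p * A * c1 \<le> l / 2" by (simp add: l_def)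
      then show "2 powr p * A * c1 / l \<le> 1/2" using l by (simp add: divide_le_eq)
    qed (use K in auto)
    finally show ?thesis by (simp add: exp_minus field_simps)
  qed
  have "K \<le> R + K / 2" unfolding K_def
    using I0 gK by (intro cSUP_least) (auto simp: I_def g_def K_def)
  then have K2: "K \<le> 2 * R" by simp
  \<comment> \<open>Second pass: with \<open>K\<close> now bounded by \<open>2 * R\<close>, the
    moments of the coefficients are bounded outright, and the increment bound can be used for the
    running maximum over the whole grid.\<close>
  define Q where "Q = A * (c0 * T + c1 * (2 * R * exp (l * T) * T))"
  have Q: "0 \<le> Q" unfolding Q_def using A c T R by auto
  have Ssum': "(\<Sum>m\<in>{0 * 2^k..<NN n * 2^k}. dt (n + k) * (mom (\<beta> (n + k) m) + mom (\<zeta> (n + k) m)))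
     \<le> c0 * T + c1 * (2 * R * exp (l * T) * T)" for n k
  proof -
    have "(\<Sum>m<NN n * 2^k. dt (n + k) * (mom (\<beta> (n + k) m) + mom (\<zeta> (n + k) m)))
      \<le> (\<Sum>m<NN n * 2^k. dt (n + k) * (c0 + c1 * (2 * R * exp (l * T))))"
    proof (intro sum_mono mult_left_mono)
      fix m assume "m \<in> {..<NN n * 2 ^ k}"
      then have m: "m < NN (n + k)" by (simp add: NN_refine)
      have "K * exp (l * G (n + k) m) \<le> 2 * R * exp (l * T)"
        using K K2 l m G_le_T[of m "n + k"] by (intro mult_mono) auto
      then show "mom (\<beta> (n + k) m) + mom (\<zeta> (n + k) m) \<le> c0 + c1 * (2 * R * exp (l * T))"
        using coef[OF m] c mult_left_mono[of "K * exp (l * G (n + k) m)" "2 * R * exp (l * T)" c1] by linarith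
    qed (use dt_pos less_imp_le in auto)
    also have "\<dots> = G (n + k) (NN (n + k)) * (c0 + c1 * (2 * R * exp (l * T)))"
      by (simp add: G_def NN_refine)
    finally show ?thesis by (simp add: G_NN atLeast0LessThan algebra_simps)
  qed
  have incr': "(\<integral>\<^sup>+\<omega>. ennreal (runmax (\<lambda>m. norm (Y (G n m) \<omega> - Y 0 \<omega>)) (NN n) powr p) \<partial>M) \<le> ennreal Q" for n
    using approx_incr_bound[OF Y _ order.refl, of 0 n T, OF _ _ T order.refl Ssum']
    by (simp add: A_def Q_def mult.assoc G_NN)
  have main: "(\<integral>\<^sup>+\<omega>. ennreal (runmax (\<lambda>m. norm (Y (G n m) \<omega>)) (NN n) powr p) \<partial>M) \<le> ennreal (2 powr p * (y0 + Q))" for n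
  proof -
    have [measurable]: "(\<lambda>\<omega>. runmax (\<lambda>m. norm (Y (G n m) \<omega> - Y 0 \<omega>)) (NN n)) \<in> borel_measurable M"
    proof (rule runmax_measurable)
      fix i assume "i \<le> NN n"
      note Ymeas[OF this]
      from borel_measurable_diff[OF this Ym]
      show "(\<lambda>\<omega>. norm (Y (G n i) \<omega> - Y 0 \<omega>)) \<in> borel_measurable M" by measurable
    qed
    have "(\<integral>\<^sup>+\<omega>. ennreal (runmax (\<lambda>m. norm (Y (G n m) \<omega>)) (NN n) powr p) \<partial>M)
      \<le> (\<integral>\<^sup>+\<omega>. ennreal (2 powr p) * (ennreal (norm (Y 0 \<omega>) powr p) + ennreal (runmax (\<lambda>m. norm (Y (G n m) \<omega> - Y 0 \<omega>)) (NN n) powr p)) \<partial>M)"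
    proof (rule nn_integral_mono)
      fix \<omega>
      let ?d = "runmax (\<lambda>m. norm (Y (G n m) \<omega> - Y 0 \<omega>)) (NN n)"
      have d: "0 \<le> ?d" by (rule runmax_nonneg) simp
      have "runmax (\<lambda>m. norm (Y (G n m) \<omega>)) (NN n) \<le> norm (Y 0 \<omega>) + ?d"
      proof (rule runmax_le)
        fix m assume "m \<le> NN n"
        from le_runmax[OF this, of "\<lambda>m. norm (Y (G n m) \<omega> - Y 0 \<omega>)"]
        show "norm (Y (G n m) \<omega>) \<le> norm (Y 0 \<omega>) + ?d"
          using norm_triangle_ineq[of "Y 0 \<omega>" "Y (G n m) \<omega> - Y 0 \<omega>"] by simp
      qed
      then have "runmax (\<lambda>m. norm (Y (G n m) \<omega>)) (NN n) powr p \<le> (norm (Y 0 \<omega>) + ?d) powr p"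
        using p by (intro powr_mono2) (auto intro!: runmax_nonneg)
      also have "\<dots> \<le> 2 powr p * (norm (Y 0 \<omega>) powr p + ?d powr p)" using p d by (intro powr_add_le) auto
      finally show "ennreal (runmax (\<lambda>m. norm (Y (G n m) \<omega>)) (NN n) powr p) \<le> ennreal (2 powr p) * (ennreal (norm (Y 0 \<omega>) powr p) + ennreal (?d powr p))"
        by (simp flip: ennreal_plus ennreal_mult)
    qed
    also have "\<dots> = ennreal (2 powr p) * ((\<integral>\<^sup>+\<omega>. ennreal (norm (Y 0 \<omega>) powr p) \<partial>M) + (\<integral>\<^sup>+\<omega>. ennreal (runmax (\<lambda>m. norm (Y (G n m) \<omega> - Y 0 \<omega>)) (NN n) powr p) \<partial>M))"
      by (subst nn_integral_cmult, measurable) (subst nn_integral_add, auto)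
    also have "\<dots> \<le> ennreal (2 powr p) * (ennreal y0 + ennreal Q)"
      using incr' nn_integral_in_Lp[OF Y0] by (intro mult_left_mono add_mono) (auto simp: y0_def)
    also have "\<dots> = ennreal (2 powr p * (y0 + Q))"
      using y0 Q by (simp flip: ennreal_plus ennreal_mult)
    finally show ?thesis .
  qed
  have "(\<integral>\<^sup>+\<omega>. ennreal_powr (sup_norm {0..T} Y \<omega>) p \<partial>M) \<le> ennreal (2 powr p * (y0 + Q))"
  proof (rule nn_integral_limit_le[where u = "\<lambda>n \<omega>. ennreal (runmax (\<lambda>m. norm (Y (G n m) \<omega>)) (NN n) powr p)"
        and C = "\<lambda>_. ennreal (2 powr p * (y0 + Q))"])
    show "(\<lambda>\<omega>. ennreal (runmax (\<lambda>m. norm (Y (G n m) \<omega>)) (NN n) powr p)) \<in> borel_measurable M" for n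
    proof -
      have [measurable]: "(\<lambda>\<omega>. runmax (\<lambda>m. norm (Y (G n m) \<omega>)) (NN n)) \<in> borel_measurable M"
        by (rule runmax_measurable, drule Ymeas, measurable)
      show ?thesis by measurable
    qed
    show "AE \<omega> in M. ennreal_powr (sup_norm {0..T} Y \<omega>) p \<le> liminf (\<lambda>n. ennreal (runmax (\<lambda>m. norm (Y (G n m) \<omega>)) (NN n) powr p))"
      using cont
    proof eventually_elim
      case (elim \<omega>)
      show ?case unfolding sup_norm_def
      proof (rule ennreal_powr_SUP_le)
        \<comment> \<open>The value at \<open>u\<close> is the limit of values at grid points not
          after \<open>u\<close>, each of which is dominated by the running maximum on its own
          grid.\<close>
        fix u assume u: "u \<in> {0..T}"
        have "(\<lambda>n. Y (G n (fl n u)) \<omega>) \<longlonglongrightarrow> Y u \<omega>"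
          using elim u G_nonneg G_le_T[OF fl_le_NN, of u] G_fl_tendsto[of u]
          unfolding continuous_on_sequentially by (auto simp: comp_def)
        then have "(\<lambda>n. ennreal (norm (Y (G n (fl n u)) \<omega>) powr p)) \<longlonglongrightarrow> ennreal (norm (Y u \<omega>) powr p)"
          using p by (intro tendsto_ennrealI tendsto_powr' tendsto_const tendsto_norm) auto
        then have "ennreal (norm (Y u \<omega>) powr p) \<le> liminf (\<lambda>n. ennreal (norm (Y (G n (fl n u)) \<omega>) powr p))"
          by (rule le_liminf_of_tendsto)
        also have "\<dots> \<le> liminf (\<lambda>n. ennreal (runmax (\<lambda>m. norm (Y (G n m) \<omega>)) (NN n) powr p))"
          using p u by (intro Liminf_mono always_eventually allI ennreal_leI powr_mono2)
            (auto intro!: le_runmax[of "fl _ u" _ "\<lambda>m. norm (Y (G _ m) \<omega>)"] fl_le_NN)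
        finally show "ennreal (norm (Y u \<omega>) powr p) \<le> liminf (\<lambda>n. ennreal (runmax (\<lambda>m. norm (Y (G n m) \<omega>)) (NN n) powr p))" .
      qed (use p in auto)
    qed
  qed (rule main, rule tendsto_const)
  also have "ennreal (2 powr p * (y0 + Q)) \<le> ennreal (sup_const CARD('q) p T c1 * (y0 + c0))"
  proof (rule ennreal_leI)
    \<comment> \<open>The bound is linear in \<open>y0\<close> and \<open>c0\<close>, so a single
      multiple of their sum dominates it.\<close>
    define E where "E = exp (l * T)"
    have E: "0 \<le> E" by (simp add: E_def)
    define k where "k = A * T"
    have k: "0 \<le> k" using A T by (simp add: k_def)
    have "Q = k * c0 + k * c1 * (2 * 2 powr p * (y0 + k * c0)) * E"
      by (simp add: Q_def R_def E_def k_def algebra_simps)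
    moreover have "k * c0 \<le> k * (y0 + c0)" using k y0 by (intro mult_left_mono) auto
    moreover have "y0 + k * c0 \<le> (1 + k) * (y0 + c0)"
      using k y0 c by (simp add: algebra_simps)
    then have "k * c1 * (2 * 2 powr p * (y0 + k * c0)) * E \<le> k * c1 * (2 * 2 powr p * ((1 + k) * (y0 + c0))) * E"
      using k c E by (intro mult_right_mono mult_left_mono) auto
    ultimately have "y0 + Q \<le> (1 + k + k * c1 * (2 * 2 powr p * (1 + k)) * E) * (y0 + c0)"
      using c by (simp add: algebra_simps)
    then have "2 powr p * (y0 + Q) \<le> 2 powr p * ((1 + k + k * c1 * (2 * 2 powr p * (1 + k)) * E) * (y0 + c0))"
      by (intro mult_left_mono) auto
    then show "2 powr p * (y0 + Q) \<le> sup_const CARD('q) p T c1 * (y0 + c0)"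
      unfolding sup_const_def Let_def A_def[symmetric] k_def E_def l_def by (simp add: mult.assoc)
  qed
  finally show ?thesis unfolding y0_def .
qed

text \<open>Between grid points at distance \<open>h\<close> the coefficients contribute at most
  \<open>h * c\<close>, which together with \<open>h powr (p / 2 - 1)\<close> gives
  \<open>h powr (p / 2)\<close>. General times are reached by rounding down on ever finer grids,
  with continuity of the paths and Fatou's lemma.\<close>

lemma approx_increment:
  fixes Y :: "real \<Rightarrow> 'a \<Rightarrow> real ^ 'd"
  assumes Y: "ito_approx \<beta> \<zeta> Y" and YLp: "\<And>n i. i \<le> NN n \<Longrightarrow> in_Lp M p (Y (G n i))"
    and cont: "AE \<omega> in M. continuous_on {0..T} (\<lambda>t. Y t \<omega>)"
    and coef: "\<And>n i. i < NN n \<Longrightarrow> mom (\<beta> n i) + mom (\<zeta> n i) \<le> c" and st: "0 \<le> s" "s \<le> t" "t \<le> T"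
  shows "(\<integral>\<^sup>+\<omega>. ennreal (norm (Y t \<omega> - Y s \<omega>) powr p) \<partial>M) \<le> ennreal (incr_const CARD('q) p T * c * (t - s) powr (p / 2))"
proof (rule nn_integral_limit_le[where u = "\<lambda>n \<omega>. ennreal (norm (Y (G n (fl n t)) \<omega> - Y (G n (fl n s)) \<omega>) powr p)"
      and C = "\<lambda>n. ennreal (incr_const CARD('q) p T * c * (G n (fl n t) - G n (fl n s)) powr (p / 2))"])
  show "(\<lambda>\<omega>. ennreal (norm (Y (G n (fl n t)) \<omega> - Y (G n (fl n s)) \<omega>) powr p)) \<in> borel_measurable M" for n
  proof -
    have [measurable]: "Y (G n (fl n t)) \<in> borel_measurable M" "Y (G n (fl n s)) \<in> borel_measurable M"
      using YLp fl_le_NN st by (auto intro!: in_Lp_measurable[of M p])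
    show ?thesis by measurable
  qed
  show "AE \<omega> in M. ennreal (norm (Y t \<omega> - Y s \<omega>) powr p) \<le> liminf (\<lambda>n. ennreal (norm (Y (G n (fl n t)) \<omega> - Y (G n (fl n s)) \<omega>) powr p))"
    using cont
  proof eventually_elim
    case (elim \<omega>)
    have "(\<lambda>n. Y (G n (fl n u)) \<omega>) \<longlonglongrightarrow> Y u \<omega>" if "0 \<le> u" "u \<le> T" for u
      using elim that G_nonneg G_le_T[OF fl_le_NN, of u] G_fl_tendsto[of u]
      unfolding continuous_on_sequentially by (auto simp: comp_def)
    then have "(\<lambda>n. ennreal (norm (Y (G n (fl n t)) \<omega> - Y (G n (fl n s)) \<omega>) powr p)) \<longlonglongrightarrow> ennreal (norm (Y t \<omega> - Y s \<omega>) powr p)"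
      using p st by (intro tendsto_ennrealI tendsto_powr' tendsto_const tendsto_norm tendsto_diff) auto
    then show ?case by (rule le_liminf_of_tendsto)
  qed
  show "(\<integral>\<^sup>+\<omega>. ennreal (norm (Y (G n (fl n t)) \<omega> - Y (G n (fl n s)) \<omega>) powr p) \<partial>M)
     \<le> ennreal (incr_const CARD('q) p T * c * (G n (fl n t) - G n (fl n s)) powr (p / 2))" for n
  proof (cases "fl n s = fl n t")
    case False
    define i where "i = fl n s"
    define j where "j = fl n t"
    have ij: "i < j" "j \<le> NN n" using False fl_mono[OF st(2), of n] fl_le_NN[OF st(3)] by (auto simp: i_def j_def)
    define h where "h = G n j - G n i"
    have "h \<le> T" using G_le_T[OF ij(2)] G_nonneg[of n i] by (simp add: h_def)
    moreover have "0 < h" using ij dt_pos[of n] by (simp add: h_def G_def)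
    ultimately have h: "0 < h" "h \<le> T" by auto
    have S: "(\<Sum>l\<in>{i * 2^k..<j * 2^k}. dt (n + k) * (mom (\<beta> (n + k) l) + mom (\<zeta> (n + k) l))) \<le> h * c" for k
    proof -
      have "(\<Sum>l\<in>{i * 2^k..<j * 2^k}. dt (n + k) * (mom (\<beta> (n + k) l) + mom (\<zeta> (n + k) l)))
        \<le> (\<Sum>l\<in>{i * 2^k..<j * 2^k}. dt (n + k) * c)"
      proof (intro sum_mono mult_left_mono coef)
        fix l assume "l \<in> {i * 2^k..<j * 2^k}"
        then show "l < NN (n + k)" using ij by (simp add: NN_refine) (meson mult_le_mono1 order_less_le_trans)
      qed (use dt_pos less_imp_le in auto)
      also have "\<dots> = (G (n + k) (j * 2^k) - G (n + k) (i * 2^k)) * c"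
        using ij by (simp add: G_def of_nat_diff algebra_simps)
      finally show ?thesis by (simp add: G_refine h_def)
    qed
    have "(\<integral>\<^sup>+\<omega>. ennreal (norm (Y (G n j) \<omega> - Y (G n i) \<omega>) powr p) \<partial>M)
      \<le> (\<integral>\<^sup>+\<omega>. ennreal (runmax (\<lambda>l. norm (Y (G n (i + l)) \<omega> - Y (G n i) \<omega>)) (j - i) powr p) \<partial>M)"
    proof (intro nn_integral_mono ennreal_leI powr_mono2)
      show "norm (Y (G n j) \<omega> - Y (G n i) \<omega>) \<le> runmax (\<lambda>l. norm (Y (G n (i + l)) \<omega> - Y (G n i) \<omega>)) (j - i)" for \<omega>
        using le_runmax[of "j - i" "j - i" "\<lambda>l. norm (Y (G n (i + l)) \<omega> - Y (G n i) \<omega>)"] ij by simp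
    qed (use p in auto)
    also have "\<dots> \<le> ennreal (incr_const CARD('q) p T * (h powr (p / 2 - 1) * (h * c)))"
      using ij h by (intro approx_incr_bound[OF Y _ ij(2) _ h S]) (auto simp: h_def)
    also have "incr_const CARD('q) p T * (h powr (p / 2 - 1) * (h * c)) = incr_const CARD('q) p T * c * h powr (p / 2)"
      using h by (simp add: powr_diff)
    finally show ?thesis unfolding h_def i_def j_def .
  qed (use p in simp)
  show "(\<lambda>n. ennreal (incr_const CARD('q) p T * c * (G n (fl n t) - G n (fl n s)) powr (p / 2)))
    \<longlonglongrightarrow> ennreal (incr_const CARD('q) p T * c * (t - s) powr (p / 2))"
    using p st by (intro tendsto_ennrealI tendsto_mult tendsto_const tendsto_powr' tendsto_diff G_fl_tendsto)
      (auto intro!: always_eventually G_mono fl_mono)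
qed

end

section \<open>Simple processes on a common refinement\<close>

text \<open>The condition compares points rather than indices, because it has to match the indicator
  of an interval between partition points of a simple process.\<close>

lemma telescope_subinterval:
  fixes g :: "real \<Rightarrow> 'b::ab_group_add"
  assumes s: "incseq s" and ab: "a \<le> b" "b \<le> m"
  shows "g (s b) - g (s a) = (\<Sum>j<m. if s a < s (Suc j) \<and> s (Suc j) \<le> s b then g (s (Suc j)) - g (s j) else 0)"
proof -
  \<comment> \<open>\<open>g\<close> with its argument clamped to the subinterval: its increments
    agree with those of \<open>g\<close> inside and vanish outside.\<close>
  define \<phi> where "\<phi> x = g (max (s a) (min x (s b)))" for x
  have sab: "s a \<le> s b" using s ab by (simp add: incseqD)
  have "(if s a < s (Suc j) \<and> s (Suc j) \<le> s b then g (s (Suc j)) - g (s j) else 0) = \<phi> (s (Suc j)) - \<phi> (s j)" for j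
  proof -
    have mono: "s j \<le> s (Suc j)" using s by (simp add: incseq_SucD)
    have 1: "s a \<le> s j" if "s a < s (Suc j)"
    proof -
      have "a \<le> j" using that s by (meson incseqD not_less not_less_eq_eq)
      then show ?thesis using s by (simp add: incseqD)
    qed
    have 2: "s b \<le> s j" if "s b < s (Suc j)"
    proof -
      have "b \<le> j" using that s by (meson incseqD not_less not_less_eq_eq)
      then show ?thesis using s by (simp add: incseqD)
    qed
    show ?thesis
    proof (cases "s a < s (Suc j)")
      case True
      show ?thesis
      proof (cases "s (Suc j) \<le> s b")
        case le: True
        then show ?thesis using True 1 mono by (simp add: \<phi>_def max_absorb2 min_absorb1)
      next
        case False
        then show ?thesis using 2 mono sab by (simp add: \<phi>_def max_absorb2 min_absorb2)
      qed
    next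
      case False
      then show ?thesis using mono sab by (simp add: \<phi>_def max_absorb1 min_absorb1)
    qed
  qed
  then have "(\<Sum>j<m. if s a < s (Suc j) \<and> s (Suc j) \<le> s b then g (s (Suc j)) - g (s j) else 0) = \<phi> (s m) - \<phi> (s 0)"
    using sum_lessThan_telescope[of "\<lambda>j. \<phi> (s j)" m] by simp
  also have "s 0 \<le> s a" "s b \<le> s m" using s ab by (auto simp: incseqD)
  then have "\<phi> (s m) - \<phi> (s 0) = g (s b) - g (s a)" using sab
    by (simp add: \<phi>_def max_absorb2 max_absorb1 min_absorb1 min_absorb2)
  finally show ?thesis by simp
qed

text \<open>Partition points are truncated at \<open>t\<close>, as in
  \<open>simple_integral\<close>, so that the integral up to \<open>t\<close> becomes a sum over all
  \<open>m\<close> cells of \<open>s\<close>.\<close>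

definition refines :: "(nat \<Rightarrow> real) \<Rightarrow> nat \<Rightarrow> real \<Rightarrow> nat \<Rightarrow> (nat \<Rightarrow> real) \<Rightarrow> bool" where
  "refines s m t n \<tau> \<longleftrightarrow> incseq s \<and> s 0 = 0 \<and> s m = t \<and> (\<forall>i<n. \<tau> i \<le> \<tau> (Suc i)) \<and>
     (\<forall>i\<le>n. \<exists>a\<le>m. min (\<tau> i) t = s a)"

lemma refines_le:
  assumes "refines s m t n \<tau>" "i \<le> n" "j < m" "\<tau> i < s (Suc j)"
  shows "\<tau> i \<le> s j"
proof -
  obtain a where a: "min (\<tau> i) t = s a" using assms by (auto simp: refines_def)
  have s: "incseq s" using assms by (simp add: refines_def)
  have "s (Suc j) \<le> t" using assms s by (metis Suc_leI incseqD refines_def)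
  then have *: "\<tau> i = s a" using assms a by (simp add: min_def split: if_splits)
  then have "a \<le> j" using assms s by (metis incseqD not_less not_less_eq_eq)
  then show ?thesis using * s by (simp add: incseqD)
qed

text \<open>A simple process lives on intervals that are open on the left, so its constant value on
  a cell is the one at the right endpoint. It is nevertheless known at the left endpoint.\<close>

lemma simple_integral_refine:
  assumes R: "refines s m t n \<tau>"
  shows "simple_integral B n \<tau> \<xi> t \<omega> = (\<Sum>j<m. simple_process n \<tau> \<xi> (s (Suc j)) \<omega> *v (B (s (Suc j)) \<omega> - B (s j) \<omega>))"
proof -
  have s: "incseq s" using R by (simp add: refines_def)
  let ?d = "\<lambda>j. B (s (Suc j)) \<omega> - B (s j) \<omega>"
  have "simple_integral B n \<tau> \<xi> t \<omega> = (\<Sum>i<n. \<Sum>j<m. (indicator {\<tau> i<..\<tau> (Suc i)} (s (Suc j)) *\<^sub>R \<xi> i \<omega>) *v ?d j)"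
    unfolding simple_integral_def
  proof (rule sum.cong)
    fix i assume i: "i \<in> {..<n}"
    obtain a b where a: "min (\<tau> i) t = s a" "a \<le> m" and b: "min (\<tau> (Suc i)) t = s b" "b \<le> m"
      using R i unfolding refines_def by (metis Suc_leI lessThan_iff less_imp_le_nat)
    have "\<tau> i \<le> \<tau> (Suc i)" using R i by (auto simp: refines_def)
    then have sab: "s a \<le> s b" using a b by (metis min.mono order.refl)
    have key: "B (s b) \<omega> - B (s a) \<omega> = (\<Sum>j<m. if s a < s (Suc j) \<and> s (Suc j) \<le> s b then ?d j else 0)"
    proof (cases "a \<le> b")
      case True
      then show ?thesis using telescope_subinterval[OF s _ b(2), of a "\<lambda>x. B x \<omega>"] by simp
    next
      \<comment> \<open>The indices \<open>a\<close> and \<open>b\<close> are obtained separately;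
        if they come in the wrong order, monotonicity forces the two points to coincide.\<close>
      case False
      then have "s b = s a" using sab s by (metis incseqD nat_le_linear order_antisym)
      then show ?thesis by (auto intro!: sum.neutral)
    qed
    have "\<xi> i \<omega> *v (B (min (\<tau> (Suc i)) t) \<omega> - B (min (\<tau> i) t) \<omega>)
       = (\<Sum>j<m. \<xi> i \<omega> *v (if s a < s (Suc j) \<and> s (Suc j) \<le> s b then ?d j else 0))"
      unfolding a b key by (rule linear_sum[OF bounded_linear.linear[OF bounded_bilinear.bounded_linear_right[OF bounded_bilinear_matrix_vector_mult]]])
    also have "\<dots> = (\<Sum>j<m. (indicator {\<tau> i<..\<tau> (Suc i)} (s (Suc j)) *\<^sub>R \<xi> i \<omega>) *v ?d j)"
    proof (rule sum.cong)
      fix j assume j: "j \<in> {..<m}"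
      have "s (Suc j) \<le> t" using R j s by (metis Suc_leI incseqD lessThan_iff refines_def)
      then have "s a < s (Suc j) \<and> s (Suc j) \<le> s b \<longleftrightarrow> s (Suc j) \<in> {\<tau> i<..\<tau> (Suc i)}"
        unfolding a(1)[symmetric] b(1)[symmetric] by auto
      then show "\<xi> i \<omega> *v (if s a < s (Suc j) \<and> s (Suc j) \<le> s b then ?d j else 0) = (indicator {\<tau> i<..\<tau> (Suc i)} (s (Suc j)) *\<^sub>R \<xi> i \<omega>) *v ?d j"
        by (simp add: indicator_def scaleR_matrix_vector_assoc[symmetric])
    qed simp
    finally show "\<xi> i \<omega> *v (B (min (\<tau> (Suc i)) t) \<omega> - B (min (\<tau> i) t) \<omega>)
       = (\<Sum>j<m. (indicator {\<tau> i<..\<tau> (Suc i)} (s (Suc j)) *\<^sub>R \<xi> i \<omega>) *v ?d j)" .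
  qed simp
  also have "\<dots> = (\<Sum>j<m. \<Sum>i<n. (indicator {\<tau> i<..\<tau> (Suc i)} (s (Suc j)) *\<^sub>R \<xi> i \<omega>) *v ?d j)"
    by (rule sum.swap)
  also have "\<dots> = (\<Sum>j<m. simple_process n \<tau> \<xi> (s (Suc j)) \<omega> *v ?d j)"
    unfolding simple_process_def
    by (intro sum.cong refl linear_sum[OF bounded_linear.linear[OF bounded_bilinear.bounded_linear_left[OF bounded_bilinear_matrix_vector_mult]], symmetric])
  finally show ?thesis .
qed

lemma simple_process_const_on_refinement:
  assumes R: "refines s m t n \<tau>" and j: "j < m" and x: "s j < x" "x \<le> s (Suc j)"
  shows "simple_process n \<tau> \<xi> x \<omega> = simple_process n \<tau> \<xi> (s (Suc j)) \<omega>"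
  unfolding simple_process_def
proof (rule sum.cong)
  fix i assume i: "i \<in> {..<n}"
  have "\<tau> i < x \<longleftrightarrow> \<tau> i < s (Suc j)" using refines_le[OF R _ j, of i] x i by fastforce
  moreover have "x \<le> \<tau> (Suc i) \<longleftrightarrow> s (Suc j) \<le> \<tau> (Suc i)" using refines_le[OF R _ j, of "Suc i"] x i by fastforce
  ultimately show "indicator {\<tau> i<..\<tau> (Suc i)} x *\<^sub>R \<xi> i \<omega> = indicator {\<tau> i<..\<tau> (Suc i)} (s (Suc j)) *\<^sub>R \<xi> i \<omega>"
    by (simp add: indicator_def)
qed simp

text \<open>At most one cell contains \<open>x\<close>. The count telescopes through the truth
  values of \<open>s j < x\<close>, which also covers cells of length zero.\<close>

lemma sum_disjoint_intervals_le:
  fixes c s :: "nat \<Rightarrow> real"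
  assumes s: "incseq s" and c: "\<And>j. j < m \<Longrightarrow> s j < x \<Longrightarrow> x \<le> s (Suc j) \<Longrightarrow> c j = V" and V: "0 \<le> V"
  shows "(\<Sum>j<m. indicator {s j<..s (Suc j)} x * c j) \<le> V"
proof -
  have "(\<Sum>j<m. indicator {s j<..s (Suc j)} x * c j) = (\<Sum>j<m. (of_bool (s j < x) - of_bool (s (Suc j) < x)) * V)"
  proof (rule sum.cong)
    fix j assume "j \<in> {..<m}"
    moreover have "s j \<le> s (Suc j)" using s by (simp add: incseq_SucD)
    ultimately show "indicator {s j<..s (Suc j)} x * c j = (of_bool (s j < x) - of_bool (s (Suc j) < x)) * V"
      using c[of j] by (cases "s j < x"; cases "x \<le> s (Suc j)") (auto simp: indicator_def)
  qed simp
  also have "\<dots> = (of_bool (s 0 < x) - of_bool (s m < x)) * V"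
    using sum_lessThan_telescope'[of "\<lambda>j. of_bool (s j < x) :: real" m] by (simp flip: sum_distrib_right)
  also have "\<dots> \<le> 1 * V" using V by (intro mult_right_mono) auto
  finally show ?thesis by simp
qed

lemma exists_refinement:
  fixes \<tau> \<tau>' :: "nat \<Rightarrow> real"
  assumes t: "0 \<le> t" and \<tau>: "0 \<le> \<tau> 0" "\<And>i. i < n \<Longrightarrow> \<tau> i \<le> \<tau> (Suc i)"
    and \<tau>': "0 \<le> \<tau>' 0" "\<And>i. i < n' \<Longrightarrow> \<tau>' i \<le> \<tau>' (Suc i)"
  shows "\<exists>s m. refines s m t n \<tau> \<and> refines s m t n' \<tau>'"
proof -
  define A where "A = insert 0 (insert t ((\<lambda>i. min (\<tau> i) t) ` {..n} \<union> (\<lambda>i. min (\<tau>' i) t) ` {..n'}))"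
  have fin: "finite A" by (simp add: A_def)
  have pos: "0 \<le> \<tau> i" if "i \<le> n" for i using that
    by (induction i) (use \<tau> in \<open>auto intro: order_trans\<close>)
  have pos': "0 \<le> \<tau>' i" if "i \<le> n'" for i using that
    by (induction i) (use \<tau>' in \<open>auto intro: order_trans\<close>)
  have A: "x \<in> A \<Longrightarrow> 0 \<le> x \<and> x \<le> t" for x using t pos pos' by (auto simp: A_def)
  define xs where "xs = sorted_list_of_set A"
  have xs: "set xs = A" "sorted xs" using fin by (auto simp: xs_def)
  have ne: "xs \<noteq> []" using xs by (auto simp: A_def)
  define m where "m = length xs - 1"
  \<comment> \<open>The sorted breakpoints, continued by the last one to keep the sequence
    increasing on all natural numbers.\<close>
  define s where "s j = xs ! min j m" for j
  have lt: "min j m < length xs" for j using ne by (simp add: m_def min_less_iff_disj)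
  have inc: "incseq s" unfolding incseq_def s_def
    using xs(2) lt by (auto intro!: sorted_nth_mono)
  have sA: "s j \<in> A" for j unfolding s_def using xs(1) lt by (metis nth_mem)
  have ex: "\<exists>a\<le>m. x = s a" if "x \<in> A" for x
  proof -
    have "x \<in> set xs" using that xs(1) by simp
    then obtain a where "a < length xs" "xs ! a = x" by (auto simp: in_set_conv_nth)
    then show ?thesis by (intro exI[of _ a]) (auto simp: s_def m_def min_absorb1)
  qed
  have "s 0 = 0"
  proof -
    obtain a where "0 = s a" using ex[of 0] by (auto simp: A_def)
    moreover have "s 0 \<le> s a" using inc by (simp add: incseqD)
    ultimately show ?thesis using A[OF sA, of 0] by simp
  qed
  moreover have "s m = t"
  proof -
    obtain a where "a \<le> m" "t = s a" using ex[of t] by (auto simp: A_def)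
    moreover from this have "s a \<le> s m" using inc by (simp add: incseqD)
    ultimately show ?thesis using A[OF sA, of m] by simp
  qed
  moreover have "\<forall>i\<le>n. \<exists>a\<le>m. min (\<tau> i) t = s a" "\<forall>i\<le>n'. \<exists>a\<le>m. min (\<tau>' i) t = s a"
    using ex by (auto simp: A_def)
  ultimately show ?thesis unfolding refines_def using inc \<tau>(2) \<tau>'(2) by blast
qed

text \<open>Square integrable instead of bounded values, so that the unbounded grid values of an
  integrand qualify alongside the simple processes of the integral's definition.\<close>

definition sq_simple :: "'a measure \<Rightarrow> (real \<Rightarrow> 'a measure) \<Rightarrow> real \<Rightarrow> nat \<Rightarrow> (nat \<Rightarrow> real) \<Rightarrow> (nat \<Rightarrow> 'a \<Rightarrow> real ^ 'q ^ 'd) \<Rightarrow> bool" where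
  "sq_simple M F T n \<tau> \<xi> \<longleftrightarrow> 0 \<le> \<tau> 0 \<and> (\<forall>i<n. \<tau> i \<le> \<tau> (Suc i)) \<and> \<tau> n \<le> T \<and>
     (\<forall>i<n. \<xi> i \<in> borel_measurable (F (\<tau> i)) \<and> in_Lp M 2 (\<xi> i))"

lemma sq_simple_nonneg: "sq_simple M F T n \<tau> \<xi> \<Longrightarrow> i \<le> n \<Longrightarrow> 0 \<le> \<tau> i"
  by (induction i) (auto simp: sq_simple_def intro: order_trans)

context filtered_bm
begin

lemma simple_integrand_sq_simple:
  assumes "simple_integrand F T n \<tau> \<xi>"
  shows "sq_simple M F T n \<tau> \<xi>"
  unfolding sq_simple_def
proof (intro conjI allI impI)
  have nn: "0 \<le> \<tau> i" if "i \<le> n" for i using that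
    by (induction i) (use assms in \<open>auto simp: simple_integrand_def intro: order_trans\<close>)
  fix i assume i: "i < n"
  then have m: "\<xi> i \<in> borel_measurable (F (\<tau> i))" using assms by (auto simp: simple_integrand_def)
  then have mM: "\<xi> i \<in> borel_measurable M" using nn i by (auto intro: measurable_F_M)
  obtain K where K: "\<forall>\<omega>\<in>space (F (\<tau> i)). norm (\<xi> i \<omega>) \<le> K" using assms i by (auto simp: simple_integrand_def)
  have "space (F (\<tau> i)) = space M" using nn i by (intro space_F) auto
  then have "norm (\<xi> i \<omega>) powr 2 \<le> K powr 2" if "\<omega> \<in> space M" for \<omega>
    using K that by (intro powr_mono2) auto
  then show "in_Lp M 2 (\<xi> i)" using mM
    by (intro in_LpI_bound[of _ _ "\<lambda>_. K powr 2"] AE_I2) auto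
  show "\<xi> i \<in> borel_measurable (F (\<tau> i))" by fact
qed (use assms in \<open>auto simp: simple_integrand_def\<close>)

text \<open>Although evaluated at the right endpoint, the process is known at the left one: a
  coefficient that is active there starts before the right endpoint, hence by refinement no later
  than the left one.\<close>

lemma simple_process_adapted:
  assumes S: "sq_simple M F T n \<tau> \<xi>" and R: "refines s m t n \<tau>" and j: "j < m"
  shows "simple_process n \<tau> \<xi> (s (Suc j)) \<in> borel_measurable (F (s j))"
    and "in_Lp M 2 (simple_process n \<tau> \<xi> (s (Suc j)))"
proof -
  have "(\<lambda>\<omega>. indicator {\<tau> i<..\<tau> (Suc i)} (s (Suc j)) *\<^sub>R \<xi> i \<omega>) \<in> borel_measurable (F (s j))" if i: "i < n" for i
  proof (cases "\<tau> i < s (Suc j)")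
    case True
    then have le: "\<tau> i \<le> s j" using refines_le[OF R _ j True] i by simp
    have nn: "0 \<le> \<tau> i" using sq_simple_nonneg[OF S, of i] i by simp
    have "\<xi> i \<in> borel_measurable (F (\<tau> i))" using S i by (simp add: sq_simple_def)
    note [measurable] = measurable_F_mono[OF this nn le]
    show ?thesis by measurable
  qed (simp add: indicator_def)
  then show "simple_process n \<tau> \<xi> (s (Suc j)) \<in> borel_measurable (F (s j))"
    unfolding simple_process_def[abs_def] by (intro borel_measurable_sum) auto
  show "in_Lp M 2 (simple_process n \<tau> \<xi> (s (Suc j)))"
    unfolding simple_process_def[abs_def] using S by (intro in_Lp_sum in_Lp_scaleR) (auto simp: sq_simple_def)
qed

text \<open>The upper half of the Ito isometry, up to a constant. On a common refinement the
  difference is a single sum of the kind bounded above with exponent 2, where the power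
  \<open>h powr (p / 2 - 1)\<close> is 1.\<close>

lemma simple_integral_L2_diff:
  fixes \<xi> \<xi>' :: "nat \<Rightarrow> 'a \<Rightarrow> real ^ 'q ^ 'd"
  assumes S: "sq_simple M F T n \<tau> \<xi>" and S': "sq_simple M F T n' \<tau>' \<xi>'" and t: "0 \<le> t" "t \<le> T" and T: "T > 0"
  shows "(\<integral>\<^sup>+\<omega>. ennreal ((norm (simple_integral B n \<tau> \<xi> t \<omega> - simple_integral B n' \<tau>' \<xi>' t \<omega>))\<^sup>2) \<partial>M)
    \<le> ennreal (bdg_const CARD('q) 2) * (\<integral>\<^sup>+\<omega>. (\<integral>\<^sup>+x\<in>{0..T}. ennreal ((norm (simple_process n \<tau> \<xi> x \<omega> - simple_process n' \<tau>' \<xi>' x \<omega>))\<^sup>2) \<partial>lborel) \<partial>M)"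
proof -
  obtain s m where R: "refines s m t n \<tau>" and R': "refines s m t n' \<tau>'"
    using exists_refinement[of t \<tau> n \<tau>' n'] S S' t unfolding sq_simple_def by blast
  define z where "z j = (if j < m then (\<lambda>\<omega>. simple_process n \<tau> \<xi> (s (Suc j)) \<omega> - simple_process n' \<tau>' \<xi>' (s (Suc j)) \<omega>) else (\<lambda>_. 0))" for j
  have s: "incseq s" "s 0 = 0" "s m = t" using R by (auto simp: refines_def)
  interpret bm_steps M F B 2 s z
  proof
    show "z j \<in> borel_measurable (F (s j))" "in_Lp M 2 (z j)" for j
      unfolding z_def using simple_process_adapted[OF S R, of j] simple_process_adapted[OF S' R', of j]
      by (auto intro!: in_Lp_diff in_Lp_zero)
  qed (use s in auto)
  have J: "simple_integral B n \<tau> \<xi> t \<omega> - simple_integral B n' \<tau>' \<xi>' t \<omega> = J m \<omega>" for \<omega>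
    unfolding simple_integral_refine[OF R] simple_integral_refine[OF R']
    by (simp add: sum_subtractf[symmetric] z_def matrix_vector_mult_diff_rdistrib)
  have "(\<integral>\<^sup>+\<omega>. ennreal ((norm (simple_integral B n \<tau> \<xi> t \<omega> - simple_integral B n' \<tau>' \<xi>' t \<omega>))\<^sup>2) \<partial>M)
     = (\<integral>\<^sup>+\<omega>. ennreal (norm (J m \<omega>) powr 2) \<partial>M)" unfolding J by simp
  also have "\<dots> = ennreal (expectation (\<lambda>\<omega>. norm (J m \<omega>) powr 2))"
    by (intro nn_integral_in_Lp J_Lp)
  also have "\<dots> \<le> ennreal (bdg_const CARD('q) 2 * (\<Sum>j<m. \<Delta> j * a j))"
  proof (rule ennreal_leI)
    have h: "s m - s 0 \<le> T" using s t by simp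
    have "expectation (\<lambda>\<omega>. norm (J m \<omega>) powr 2) \<le> expectation (\<lambda>\<omega>. runmax (\<lambda>i. norm (J i \<omega>)) m powr 2)"
      by (intro integral_mono in_Lp_integrable[OF J_Lp] bdg(1)[OF h T] powr_mono2 le_runmax) auto
    also have "\<dots> \<le> bdg_const CARD('q) 2 * (T powr (2 / 2 - 1) * (\<Sum>j<m. \<Delta> j * a j))"
      by (rule bdg(2)[OF h T])
    finally show "expectation (\<lambda>\<omega>. norm (J m \<omega>) powr 2) \<le> bdg_const CARD('q) 2 * (\<Sum>j<m. \<Delta> j * a j)"
      using T by simp
  qed
  also have "\<dots> = ennreal (bdg_const CARD('q) 2) * ennreal (\<Sum>j<m. \<Delta> j * a j)"
    by (intro ennreal_mult bdg_const_nonneg sum_nonneg mult_nonneg_nonneg a_nonneg) (use s_Suc in auto)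
  also have "ennreal (\<Sum>j<m. \<Delta> j * a j) = (\<integral>\<^sup>+\<omega>. ennreal (\<Sum>j<m. \<Delta> j * norm (z j \<omega>) powr 2) \<partial>M)"
  proof -
    have "(\<integral>\<^sup>+\<omega>. ennreal (\<Sum>j<m. \<Delta> j * norm (z j \<omega>) powr 2) \<partial>M) = ennreal (expectation (\<lambda>\<omega>. \<Sum>j<m. \<Delta> j * norm (z j \<omega>) powr 2))"
      using integrable_\<zeta> s_Suc by (intro nn_integral_eq_integral AE_I2 sum_nonneg Bochner_Integration.integrable_sum integrable_mult_right) auto
    also have "expectation (\<lambda>\<omega>. \<Sum>j<m. \<Delta> j * norm (z j \<omega>) powr 2) = (\<Sum>j<m. \<Delta> j * a j)"
      using integrable_\<zeta> by (subst Bochner_Integration.integral_sum) auto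
    finally show ?thesis by simp
  qed
  also have "\<dots> \<le> (\<integral>\<^sup>+\<omega>. (\<integral>\<^sup>+x\<in>{0..T}. ennreal ((norm (simple_process n \<tau> \<xi> x \<omega> - simple_process n' \<tau>' \<xi>' x \<omega>))\<^sup>2) \<partial>lborel) \<partial>M)"
  proof (rule nn_integral_mono)
    fix \<omega>
    let ?V = "\<lambda>x. (norm (simple_process n \<tau> \<xi> x \<omega> - simple_process n' \<tau>' \<xi>' x \<omega>))\<^sup>2"
    have "ennreal (\<Sum>j<m. \<Delta> j * norm (z j \<omega>) powr 2) = (\<Sum>j<m. ennreal (norm (z j \<omega>) powr 2) * emeasure lborel {s j<..s (Suc j)})"
    proof -
      have "ennreal (\<Delta> j * norm (z j \<omega>) powr 2) = ennreal (norm (z j \<omega>) powr 2) * emeasure lborel {s j<..s (Suc j)}" for j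
        using s_Suc[of j] by (subst mult.commute, subst ennreal_mult) auto
      moreover have "ennreal (\<Sum>j<m. \<Delta> j * norm (z j \<omega>) powr 2) = (\<Sum>j<m. ennreal (\<Delta> j * norm (z j \<omega>) powr 2))"
        using s_Suc by (intro sum_ennreal[symmetric]) auto
      ultimately show ?thesis by (simp only:)
    qed
    also have "\<dots> = (\<Sum>j<m. (\<integral>\<^sup>+x. ennreal (norm (z j \<omega>) powr 2) * indicator {s j<..s (Suc j)} x \<partial>lborel))"
      by (simp add: nn_integral_cmult_indicator del: powr_numeral)
    also have "\<dots> = (\<integral>\<^sup>+x. (\<Sum>j<m. ennreal (norm (z j \<omega>) powr 2) * indicator {s j<..s (Suc j)} x) \<partial>lborel)"
      by (subst nn_integral_sum) auto
    \<comment> \<open>An inequality only, since the refinement fills \<open>[0,t]\<close> while the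
      right-hand side integrates over \<open>[0,T]\<close>.\<close>
    also have "\<dots> \<le> (\<integral>\<^sup>+x\<in>{0..T}. ennreal (?V x) \<partial>lborel)"
    proof (rule nn_integral_mono)
      fix x
      have e: "ennreal (norm (z j \<omega>) powr 2) * indicator {s j<..s (Suc j)} x = ennreal (indicator {s j<..s (Suc j)} x * norm (z j \<omega>) powr 2)" for j
        by (auto simp: indicator_def)
      have "(\<Sum>j<m. ennreal (norm (z j \<omega>) powr 2) * indicator {s j<..s (Suc j)} x) = ennreal (\<Sum>j<m. indicator {s j<..s (Suc j)} x * norm (z j \<omega>) powr 2)"
        unfolding e by (intro sum_ennreal) auto
      also have "\<dots> \<le> ennreal (?V x) * indicator {0..T} x"
      proof (cases "x \<in> {0..T}")
        case True
        have "(\<Sum>j<m. indicator {s j<..s (Suc j)} x * norm (z j \<omega>) powr 2) \<le> ?V x"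
        proof (intro sum_disjoint_intervals_le s)
          fix j assume j: "j < m" "s j < x" "x \<le> s (Suc j)"
          show "norm (z j \<omega>) powr 2 = ?V x"
            using simple_process_const_on_refinement[OF R j, of \<xi> \<omega>]
              simple_process_const_on_refinement[OF R' j, of \<xi>' \<omega>] j by (simp add: z_def)
        qed simp
        with True show ?thesis by (simp add: ennreal_leI del: powr_numeral)
      next
        case False
        have "indicator {s j<..s (Suc j)} x = (0::real)" if "j < m" for j
        proof -
          have "s 0 \<le> s j" "s (Suc j) \<le> s m" using s(1) that by (auto simp: incseqD)
          then show ?thesis using False s t by (auto simp: indicator_def)
        qed
        then show ?thesis by simp
      qed
      finally show "(\<Sum>j<m. ennreal (norm (z j \<omega>) powr 2) * indicator {s j<..s (Suc j)} x) \<le> ennreal (?V x) * indicator {0..T} x" .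
    qed
    finally show "ennreal (\<Sum>j<m. \<Delta> j * norm (z j \<omega>) powr 2) \<le> (\<integral>\<^sup>+x\<in>{0..T}. ennreal (?V x) \<partial>lborel)" .
  qed
  finally show ?thesis by (simp add: mult_left_mono)
qed

end

section \<open>The Ito integral as a limit of sums along grids\<close>

context bm_grid
begin

section \<open>Step functions and Riemann sums on the grids\<close>

definition stepf :: "nat \<Rightarrow> nat \<Rightarrow> (real \<Rightarrow> 'c::real_normed_vector) \<Rightarrow> real \<Rightarrow> 'c" where
  "stepf n m g s = (\<Sum>j<m. indicator {G n j<..G n (Suc j)} s *\<^sub>R g (G n j))"

text \<open>Index of the cell that contains \<open>u\<close>. Cells are open on the left as for
  simple processes, so a positive grid point belongs to the cell that ends there; this is the
  difference to \<open>fl\<close>.\<close>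

definition cl :: "nat \<Rightarrow> real \<Rightarrow> nat" where "cl n u = nat (\<lceil>u / dt n\<rceil> - 1)"

lemma cl_bounds:
  assumes "0 < u"
  shows "G n (cl n u) < u" "u \<le> G n (Suc (cl n u))"
proof -
  have "0 < u / dt n" using assms dt_pos[of n] by simp
  then have "real (cl n u) = real_of_int (\<lceil>u / dt n\<rceil> - 1)" unfolding cl_def by (subst of_nat_nat) linarith+
  then have "real (cl n u) < u / dt n" "u / dt n \<le> real (Suc (cl n u))" by linarith+
  then show "G n (cl n u) < u" "u \<le> G n (Suc (cl n u))" using dt_pos[of n]
    by (auto simp: G_def field_simps)
qed

lemma cl_unique: "G n j < u \<Longrightarrow> u \<le> G n (Suc j) \<Longrightarrow> cl n u = j"
proof (rule ccontr)
  assume a: "G n j < u" "u \<le> G n (Suc j)" "cl n u \<noteq> j"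
  have u: "0 < u" using a(1) G_nonneg[of n j] by simp
  from a(3) consider "cl n u < j" | "j < cl n u" by linarith
  then show False
    by cases (use cl_bounds[OF u, of n] a G_mono[of "Suc (cl n u)" j n] G_mono[of "Suc j" "cl n u" n] in auto)
qed

lemma stepf_eq:
  assumes "0 < s" "s \<le> G n m"
  shows "stepf n m g s = g (G n (cl n s))" and "cl n s < m"
proof -
  show cm: "cl n s < m"
    using cl_bounds[OF assms(1), of n] assms(2) G_mono[of m "cl n s" n] by linarith
  have "stepf n m g s = (\<Sum>j<m. if j = cl n s then g (G n j) else 0)"
    unfolding stepf_def
  proof (rule sum.cong)
    fix j
    have "s \<in> {G n j<..G n (Suc j)} \<longleftrightarrow> j = cl n s"
      using cl_unique[of n j s] cl_bounds[OF assms(1), of n] by fastforce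
    then show "indicator {G n j<..G n (Suc j)} s *\<^sub>R g (G n j) = (if j = cl n s then g (G n j) else 0)"
      by (simp add: indicator_def)
  qed simp
  then show "stepf n m g s = g (G n (cl n s))" using cm by simp
qed

lemma stepf_zero:
  assumes "s \<le> 0 \<or> G n m < s"
  shows "stepf n m g s = 0"
proof -
  have "indicator {G n j<..G n (Suc j)} s = (0::real)" if "j < m" for j
    using assms G_nonneg[of n j] G_mono[of "Suc j" m n] that by (auto simp: indicator_def)
  then show ?thesis by (simp add: stepf_def)
qed

lemma G_cl_tendsto: "0 < u \<Longrightarrow> (\<lambda>n. G n (cl n u)) \<longlonglongrightarrow> u"
proof (rule tendsto_sandwich[of "\<lambda>n. u - dt n" _ _ "\<lambda>n. u"])
  assume u: "0 < u"
  show "\<forall>\<^sub>F n in sequentially. u - dt n \<le> G n (cl n u)" "\<forall>\<^sub>F n in sequentially. G n (cl n u) \<le> u"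
    using cl_bounds[OF u] by (auto simp: G_Suc algebra_simps less_imp_le)
  show "(\<lambda>n. u - dt n) \<longlonglongrightarrow> u" using tendsto_diff[OF tendsto_const dt_tendsto, of u] by simp
qed simp

lemma stepf_tendsto:
  assumes g: "continuous_on {0..T} g" and s: "0 < s" "s \<le> G n m" "G n m \<le> T"
  shows "(\<lambda>k. stepf (n + k) (m * 2 ^ k) g s) \<longlonglongrightarrow> g s"
proof -
  have "stepf (n + k) (m * 2 ^ k) g s = g (G (n + k) (cl (n + k) s))" for k
    using s by (intro stepf_eq) (auto simp: G_refine)
  moreover have "(\<lambda>k. g (G (k + n) (cl (k + n) s))) \<longlonglongrightarrow> g s"
  proof -
    have "(\<lambda>k. g (G k (cl k s))) \<longlonglongrightarrow> g s"
    proof (rule continuous_on_tendsto_compose[OF g G_cl_tendsto[OF s(1)]])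
      have "G k (cl k s) \<in> {0..T}" for k
        using s cl_bounds(1)[OF s(1), of k] G_nonneg[of k] by auto
      then show "\<forall>\<^sub>F k in sequentially. G k (cl k s) \<in> {0..T}" by simp
    qed (use s in auto)
    then show ?thesis by (rule LIMSEQ_ignore_initial_segment)
  qed
  ultimately show ?thesis by (simp add: add.commute)
qed

lemma stepf_measurable [measurable]:
  fixes g :: "real \<Rightarrow> 'c::euclidean_space"
  shows "stepf n m g \<in> borel_measurable borel"
  unfolding stepf_def[abs_def] by measurable

text \<open>Dominated convergence of the step functions, with the maximum of the continuous function
  as dominating constant.\<close>

lemma riemann_sum_tendsto:
  fixes g :: "real \<Rightarrow> 'c::euclidean_space"
  assumes g: "continuous_on {0..T} g" and i: "i \<le> NN n"
  shows "(\<lambda>k. \<Sum>j<i * 2 ^ k. dt (n + k) *\<^sub>R g (G (n + k) j)) \<longlonglongrightarrow> (LINT s:{0..G n i}|lborel. g s)"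
proof -
  have iT: "G n i \<le> T" using i by (rule G_le_T)
  have int: "(LINT s|lborel. stepf m l g s) = (\<Sum>j<l. dt m *\<^sub>R g (G m j))" for m l
  proof -
    have "(LINT s|lborel. stepf m l g s) = (\<Sum>j<l. (LINT s|lborel. indicator {G m j<..G m (Suc j)} s *\<^sub>R g (G m j)))"
      unfolding stepf_def by (rule Bochner_Integration.integral_sum)
        (auto intro!: integrable_scaleR_left integrable_real_indicator simp: emeasure_lborel_Ioc G_mono)
    also have "\<dots> = (\<Sum>j<l. dt m *\<^sub>R g (G m j))"
      using dt_pos[of m] by (intro sum.cong) (simp_all add: G_Suc)
    finally show ?thesis .
  qed
  obtain K where K: "\<And>s. s \<in> {0..T} \<Longrightarrow> norm (g s) \<le> K"
    using compact_continuous_image[OF g] compact_imp_bounded[THEN bounded_iff[THEN iffD1]] by fastforce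
  have K0: "0 \<le> K" using T by (intro order_trans[OF norm_ge_zero K[of 0]]) auto
  have "(\<lambda>k. LINT s|lborel. stepf (n + k) (i * 2 ^ k) g s) \<longlonglongrightarrow> (LINT s|lborel. indicator {0..G n i} s *\<^sub>R g s)"
  proof (rule integral_dominated_convergence[where w = "\<lambda>s. indicator {0..T} s * K"])
    have "continuous_on {0..G n i} g" using g by (rule continuous_on_subset) (use iT in auto)
    then show "(\<lambda>s. indicator {0..G n i} s *\<^sub>R g s) \<in> borel_measurable lborel"
      using borel_measurable_continuous_on_indicator[of "{0..G n i}" g] by simp
    show "integrable lborel (\<lambda>s. indicator {0..T} s * K)" using T by simp
    show "AE s in lborel. (\<lambda>k. stepf (n + k) (i * 2 ^ k) g s) \<longlonglongrightarrow> indicator {0..G n i} s *\<^sub>R g s"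
      \<comment> \<open>The step functions vanish at 0, while the indicator of the closed interval
        does not.\<close>
      using AE_lborel_singleton[of 0]
    proof eventually_elim
      case (elim s)
      show ?case
      proof (cases "0 < s \<and> s \<le> G n i")
        case True
        then show ?thesis using stepf_tendsto[OF g, of s n i] iT by simp
      next
        case False
        then have "stepf (n + k) (i * 2 ^ k) g s = 0" for k by (intro stepf_zero) (auto simp: G_refine)
        moreover have "indicator {0..G n i} s = (0::real)" using False elim by (auto simp: indicator_def)
        ultimately show ?thesis by simp
      qed
    qed
    show "AE s in lborel. norm (stepf (n + k) (i * 2 ^ k) g s) \<le> indicator {0..T} s * K" for k
    proof (rule AE_I2)
      fix s
      show "norm (stepf (n + k) (i * 2 ^ k) g s) \<le> indicator {0..T} s * K"
      proof (cases "0 < s \<and> s \<le> G n i")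
        case True
        then have "stepf (n + k) (i * 2 ^ k) g s = g (G (n + k) (cl (n + k) s))"
          by (intro stepf_eq) (auto simp: G_refine)
        moreover have "norm (g (G (n + k) (cl (n + k) s))) \<le> K"
          using True cl_bounds[of s "n + k"] iT G_nonneg by (intro K) auto
        ultimately show ?thesis using True iT by simp
      next
        case False
        then have "stepf (n + k) (i * 2 ^ k) g s = 0" by (intro stepf_zero) (auto simp: G_refine)
        then show ?thesis using K0 by simp
      qed
    qed
  qed simp
  then show ?thesis unfolding int set_lebesgue_integral_def .
qed

end

section \<open>Integrands with continuous and dominated paths\<close>

locale ito_integrand = bm_grid M F B p T N
  for M :: "'a measure" and F and B :: "real \<Rightarrow> 'a \<Rightarrow> real ^ 'q" and p T N +
  fixes H :: "real \<Rightarrow> 'a \<Rightarrow> real ^ 'q ^ 'd" and J :: "real \<Rightarrow> 'a \<Rightarrow> real ^ 'd" and R :: "'a \<Rightarrow> real"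
  assumes ito: "has_ito_integral M F B T H J"
    and H_cont: "\<And>\<omega>. \<omega> \<in> space M \<Longrightarrow> continuous_on {0..T} (\<lambda>s. H s \<omega>)"
    and H_adapted: "\<And>s. 0 \<le> s \<Longrightarrow> s \<le> T \<Longrightarrow> H s \<in> borel_measurable (F s)"
    and R_meas [measurable]: "R \<in> borel_measurable M" and R_sq: "integrable M (\<lambda>\<omega>. (R \<omega>)\<^sup>2)"
    and H_le: "\<And>\<omega> s. \<omega> \<in> space M \<Longrightarrow> 0 \<le> s \<Longrightarrow> s \<le> T \<Longrightarrow> norm (H s \<omega>) \<le> R \<omega>"
begin

abbreviation HG :: "nat \<Rightarrow> real \<Rightarrow> 'a \<Rightarrow> real ^ 'q ^ 'd" where
  "HG n \<equiv> simple_process (NN n) (G n) (\<lambda>j. H (G n j))"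

lemma HG_stepf: "HG n s \<omega> = stepf n (NN n) (\<lambda>u. H u \<omega>) s"
  by (simp add: simple_process_def stepf_def)

lemma R_nonneg: "\<omega> \<in> space M \<Longrightarrow> 0 \<le> R \<omega>"
  using H_le[of \<omega> 0] T norm_ge_zero[of "H 0 \<omega>"] by linarith

lemma H_meas: "0 \<le> s \<Longrightarrow> s \<le> T \<Longrightarrow> H s \<in> borel_measurable M"
  using H_adapted measurable_F_M by blast

lemma HG_le: "\<omega> \<in> space M \<Longrightarrow> norm (HG n s \<omega>) \<le> R \<omega>"
proof (cases "0 < s \<and> s \<le> T")
  case True
  assume \<omega>: "\<omega> \<in> space M"
  have "HG n s \<omega> = H (G n (cl n s)) \<omega>"
    unfolding HG_stepf using True by (intro stepf_eq) (auto simp: G_NN)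
  then show ?thesis using True cl_bounds[of s n] G_nonneg \<omega> by (auto intro!: H_le)
next
  case False
  assume \<omega>: "\<omega> \<in> space M"
  have "HG n s \<omega> = 0"
    unfolding HG_stepf using False by (intro stepf_zero) (auto simp: G_NN)
  then show ?thesis using R_nonneg[OF \<omega>] by simp
qed

lemma HG_tendsto: "\<omega> \<in> space M \<Longrightarrow> 0 < s \<Longrightarrow> s \<le> T \<Longrightarrow> (\<lambda>n. HG n s \<omega>) \<longlonglongrightarrow> H s \<omega>"
  using stepf_tendsto[OF H_cont, of \<omega> s 0 "NN 0"] by (simp add: HG_stepf G_NN NN_refine[of 0, simplified, symmetric])

lemma simple_process_joint_measurable:
  assumes "\<And>i. i < n \<Longrightarrow> \<xi> i \<in> borel_measurable M"
  shows "(\<lambda>(\<omega>, s). simple_process n \<tau> \<xi> s \<omega> :: real ^ 'q ^ 'd) \<in> borel_measurable (M \<Otimes>\<^sub>M lborel)"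
proof -
  have "(\<lambda>x. \<Sum>i<n. indicator {\<tau> i<..\<tau> (Suc i)} (snd x) *\<^sub>R \<xi> i (fst x)) \<in> borel_measurable (M \<Otimes>\<^sub>M lborel)"
  proof (rule borel_measurable_sum)
    fix i assume "i \<in> {..<n}"
    then have [measurable]: "\<xi> i \<in> borel_measurable M" using assms by simp
    show "(\<lambda>x. indicator {\<tau> i<..\<tau> (Suc i)} (snd x) *\<^sub>R \<xi> i (fst x)) \<in> borel_measurable (M \<Otimes>\<^sub>M lborel)"
      by measurable
  qed
  then show ?thesis by (simp add: simple_process_def case_prod_beta')
qed

lemma HG_joint [measurable]: "(\<lambda>(\<omega>, s). HG n s \<omega>) \<in> borel_measurable (M \<Otimes>\<^sub>M lborel)"
  by (rule simple_process_joint_measurable) (auto intro!: H_meas G_nonneg G_le_T)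

text \<open>Joint measurability comes from the pointwise limit of the grid approximations. They all
  vanish at time 0, hence the interval open on the left.\<close>

lemma H_joint: "(\<lambda>(\<omega>, s). indicator {0<..T} s *\<^sub>R H s \<omega>) \<in> borel_measurable (M \<Otimes>\<^sub>M lborel)"
proof (rule borel_measurable_LIMSEQ_metric)
  show "(\<lambda>(\<omega>, s). indicator {0<..T} s *\<^sub>R HG n s \<omega>) \<in> borel_measurable (M \<Otimes>\<^sub>M lborel)" for n
    using HG_joint[of n] unfolding case_prod_beta' by measurable
  show "(\<lambda>n. case x of (\<omega>, s) \<Rightarrow> indicator {0<..T} s *\<^sub>R HG n s \<omega>) \<longlonglongrightarrow> (case x of (\<omega>, s) \<Rightarrow> indicator {0<..T} s *\<^sub>R H s \<omega>)"
    if "x \<in> space (M \<Otimes>\<^sub>M lborel)" for x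
  proof (cases x)
    case (Pair \<omega> s)
    then have "\<omega> \<in> space M" using that by (simp add: space_pair_measure)
    then show ?thesis using HG_tendsto[of \<omega> s] by (cases "s \<in> {0<..T}") (auto simp: Pair)
  qed
qed

abbreviation dist_sq :: "(real \<Rightarrow> 'a \<Rightarrow> real ^ 'q ^ 'd) \<Rightarrow> 'a \<Rightarrow> ennreal" where
  "dist_sq P \<omega> \<equiv> (\<integral>\<^sup>+s\<in>{0..T}. ennreal ((norm (P s \<omega> - H s \<omega>))\<^sup>2) \<partial>lborel)"

lemma dist_sq_eq: "dist_sq P \<omega> = (\<integral>\<^sup>+s. ennreal ((norm (indicator {0<..T} s *\<^sub>R P s \<omega> - indicator {0<..T} s *\<^sub>R H s \<omega>))\<^sup>2) \<partial>lborel)"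
proof (rule nn_integral_cong_AE)
  show "AE s in lborel. ennreal ((norm (P s \<omega> - H s \<omega>))\<^sup>2) * indicator {0..T} s =
     ennreal ((norm (indicator {0<..T} s *\<^sub>R P s \<omega> - indicator {0<..T} s *\<^sub>R H s \<omega>))\<^sup>2)"
    using AE_lborel_singleton[of 0] by eventually_elim (auto simp: indicator_def)
qed

lemma dist_sq_measurable:
  assumes P: "(\<lambda>(\<omega>, s). P s \<omega>) \<in> borel_measurable (M \<Otimes>\<^sub>M lborel)"
  shows "dist_sq P \<in> borel_measurable M"
proof -
  have "(\<lambda>x. indicator {0<..T} (snd x) *\<^sub>R P (snd x) (fst x)) \<in> borel_measurable (M \<Otimes>\<^sub>M lborel)"
    using P unfolding case_prod_beta' by measurable
  from borel_measurable_diff[OF this H_joint[unfolded case_prod_beta']]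
  have "(\<lambda>x. ennreal ((norm (indicator {0<..T} (snd x) *\<^sub>R P (snd x) (fst x) - indicator {0<..T} (snd x) *\<^sub>R H (snd x) (fst x)))\<^sup>2)) \<in> borel_measurable (M \<Otimes>\<^sub>M lborel)"
    by measurable
  then have "(\<lambda>\<omega>. \<integral>\<^sup>+s. ennreal ((norm (indicator {0<..T} s *\<^sub>R P s \<omega> - indicator {0<..T} s *\<^sub>R H s \<omega>))\<^sup>2) \<partial>lborel) \<in> borel_measurable M"
    by (intro lborel.borel_measurable_nn_integral) (simp add: case_prod_beta')
  then show ?thesis by (subst dist_sq_eq)
qed

lemma H_section_measurable: "\<omega> \<in> space M \<Longrightarrow> (\<lambda>s. indicator {0<..T} s *\<^sub>R H s \<omega>) \<in> borel_measurable lborel"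
  using measurable_Pair2[OF H_joint, of \<omega>] by simp

lemma dist_sq_HG_le: "\<omega> \<in> space M \<Longrightarrow> dist_sq (HG n) \<omega> \<le> ennreal (4 * T * (R \<omega>)\<^sup>2)"
proof -
  assume \<omega>: "\<omega> \<in> space M"
  have "dist_sq (HG n) \<omega> \<le> (\<integral>\<^sup>+s. ennreal (4 * (R \<omega>)\<^sup>2) * indicator {0..T} s \<partial>lborel)"
  proof (rule nn_integral_mono)
    fix s
    show "ennreal ((norm (HG n s \<omega> - H s \<omega>))\<^sup>2) * indicator {0..T} s \<le> ennreal (4 * (R \<omega>)\<^sup>2) * indicator {0..T} s"
    proof (cases "s \<in> {0..T}")
      case True
      then have "norm (HG n s \<omega> - H s \<omega>) \<le> 2 * R \<omega>"
        using norm_triangle_ineq4[of "HG n s \<omega>" "H s \<omega>"] HG_le[OF \<omega>, of n s] H_le[OF \<omega>, of s] by simp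
      then have "(norm (HG n s \<omega> - H s \<omega>))\<^sup>2 \<le> (2 * R \<omega>)\<^sup>2" by (intro power_mono) auto
      then show ?thesis using True by (simp add: power_mult_distrib ennreal_leI)
    qed simp
  qed
  also have "\<dots> = ennreal (4 * T * (R \<omega>)\<^sup>2)"
    using T by (subst nn_integral_cmult_indicator) (auto simp: ennreal_mult'[symmetric] mult_ac)
  finally show ?thesis .
qed

lemma dist_sq_HG_tendsto_pointwise:
  assumes \<omega>: "\<omega> \<in> space M"
  shows "(\<lambda>n. dist_sq (HG n) \<omega>) \<longlonglongrightarrow> 0"
proof -
  have "(\<lambda>n. dist_sq (HG n) \<omega>) \<longlonglongrightarrow> (\<integral>\<^sup>+s. 0 \<partial>(lborel :: real measure))"
    unfolding dist_sq_eq
  proof (rule nn_integral_dominated_convergence[where w = "\<lambda>s. ennreal (4 * (R \<omega>)\<^sup>2) * indicator {0..T} s"])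
    show "(\<lambda>s. ennreal ((norm (indicator {0<..T} s *\<^sub>R HG n s \<omega> - indicator {0<..T} s *\<^sub>R H s \<omega>))\<^sup>2)) \<in> borel_measurable lborel" for n
    proof -
      have [measurable]: "(\<lambda>s. HG n s \<omega>) \<in> borel_measurable lborel" unfolding HG_stepf by simp
      note [measurable] = H_section_measurable[OF \<omega>]
      show ?thesis by measurable
    qed
    show "(\<integral>\<^sup>+s. ennreal (4 * (R \<omega>)\<^sup>2) * indicator {0..T} s \<partial>lborel) < \<infinity>"
      using T by (simp add: nn_integral_cmult_indicator ennreal_mult_less_top)
    show "AE s in lborel. ennreal ((norm (indicator {0<..T} s *\<^sub>R HG n s \<omega> - indicator {0<..T} s *\<^sub>R H s \<omega>))\<^sup>2) \<le> ennreal (4 * (R \<omega>)\<^sup>2) * indicator {0..T} s" for n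
    proof (rule AE_I2)
      fix s
      show "ennreal ((norm (indicator {0<..T} s *\<^sub>R HG n s \<omega> - indicator {0<..T} s *\<^sub>R H s \<omega>))\<^sup>2) \<le> ennreal (4 * (R \<omega>)\<^sup>2) * indicator {0..T} s"
      proof (cases "s \<in> {0<..T}")
        case True
        then have "norm (HG n s \<omega> - H s \<omega>) \<le> 2 * R \<omega>"
          using norm_triangle_ineq4[of "HG n s \<omega>" "H s \<omega>"] HG_le[OF \<omega>, of n s] H_le[OF \<omega>, of s] by simp
        then have "(norm (HG n s \<omega> - H s \<omega>))\<^sup>2 \<le> (2 * R \<omega>)\<^sup>2" by (intro power_mono) auto
        then show ?thesis using True by (simp add: power_mult_distrib ennreal_leI)
      qed simp
    qed
    show "AE s in lborel. (\<lambda>n. ennreal ((norm (indicator {0<..T} s *\<^sub>R HG n s \<omega> - indicator {0<..T} s *\<^sub>R H s \<omega>))\<^sup>2)) \<longlonglongrightarrow> 0"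
    proof (rule AE_I2)
      fix s
      show "(\<lambda>n. ennreal ((norm (indicator {0<..T} s *\<^sub>R HG n s \<omega> - indicator {0<..T} s *\<^sub>R H s \<omega>))\<^sup>2)) \<longlonglongrightarrow> 0"
      proof (cases "s \<in> {0<..T}")
        case True
        then have "(\<lambda>n. ennreal ((norm (HG n s \<omega> - H s \<omega>))\<^sup>2)) \<longlonglongrightarrow> ennreal ((norm (H s \<omega> - H s \<omega>))\<^sup>2)"
          using HG_tendsto[OF \<omega>, of s] by (intro tendsto_ennrealI tendsto_power tendsto_norm tendsto_diff tendsto_const) auto
        then show ?thesis using True by simp
      qed simp
    qed
  qed auto
  then show ?thesis by simp
qed

text \<open>Dominated convergence is used twice: in time for a fixed path, and then over the paths,
  where \<open>R\<close> dominates the whole path and is square integrable.\<close>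

lemma dist_sq_HG_tendsto: "(\<lambda>n. \<integral>\<^sup>+\<omega>. dist_sq (HG n) \<omega> \<partial>M) \<longlonglongrightarrow> 0"
proof -
  have "(\<lambda>n. \<integral>\<^sup>+\<omega>. dist_sq (HG n) \<omega> \<partial>M) \<longlonglongrightarrow> (\<integral>\<^sup>+\<omega>. 0 \<partial>M)"
  proof (rule nn_integral_dominated_convergence[where w = "\<lambda>\<omega>. ennreal (4 * T * (R \<omega>)\<^sup>2)"])
    have "integrable M (\<lambda>\<omega>. 4 * T * (R \<omega>)\<^sup>2)" using R_sq by simp
    then have "(\<integral>\<^sup>+\<omega>. ennreal (4 * T * (R \<omega>)\<^sup>2) \<partial>M) = ennreal (expectation (\<lambda>\<omega>. 4 * T * (R \<omega>)\<^sup>2))"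
      using T by (intro nn_integral_eq_integral) auto
    then show "(\<integral>\<^sup>+\<omega>. ennreal (4 * T * (R \<omega>)\<^sup>2) \<partial>M) < \<infinity>" by simp
    show "AE \<omega> in M. dist_sq (HG n) \<omega> \<le> ennreal (4 * T * (R \<omega>)\<^sup>2)" for n
      by (intro AE_I2 dist_sq_HG_le)
    show "AE \<omega> in M. (\<lambda>n. dist_sq (HG n) \<omega>) \<longlonglongrightarrow> 0"
      by (intro AE_I2 dist_sq_HG_tendsto_pointwise)
    show "dist_sq (HG n) \<in> borel_measurable M" for n by (intro dist_sq_measurable HG_joint)
  qed auto
  then show ?thesis by simp
qed

lemma dist_sq_HG_finite: "(\<integral>\<^sup>+\<omega>. dist_sq (HG n) \<omega> \<partial>M) < \<infinity>"
proof -
  have "integrable M (\<lambda>\<omega>. 4 * T * (R \<omega>)\<^sup>2)" using R_sq by simp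
  then have "(\<integral>\<^sup>+\<omega>. ennreal (4 * T * (R \<omega>)\<^sup>2) \<partial>M) = ennreal (expectation (\<lambda>\<omega>. 4 * T * (R \<omega>)\<^sup>2))"
    using T by (intro nn_integral_eq_integral) auto
  moreover have "(\<integral>\<^sup>+\<omega>. dist_sq (HG n) \<omega> \<partial>M) \<le> (\<integral>\<^sup>+\<omega>. ennreal (4 * T * (R \<omega>)\<^sup>2) \<partial>M)"
    by (intro nn_integral_mono dist_sq_HG_le)
  ultimately show ?thesis by (simp add: le_less_trans)
qed

lemma H_in_L2: "0 \<le> s \<Longrightarrow> s \<le> T \<Longrightarrow> in_Lp M 2 (H s)"
proof (rule in_LpI_bound[OF H_meas R_sq AE_I2])
  fix \<omega> assume a: "0 \<le> s" "s \<le> T" "\<omega> \<in> space M"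
  have "norm (H s \<omega>) powr 2 = (norm (H s \<omega>))\<^sup>2" by simp
  also have "\<dots> \<le> (R \<omega>)\<^sup>2" using H_le[OF a(3,1,2)] by (intro power_mono) auto
  finally show "norm (H s \<omega>) powr 2 \<le> (R \<omega>)\<^sup>2" .
qed auto

lemma HG_sq_simple: "sq_simple M F T (NN n) (G n) (\<lambda>j. H (G n j))"
  unfolding sq_simple_def
  by (auto intro!: H_in_L2 H_adapted G_nonneg G_le_T G_mono simp: G_NN)

lemma sq_norm_split: "(norm (a - c))\<^sup>2 \<le> 2 * (norm (a - b))\<^sup>2 + 2 * (norm (b - c))\<^sup>2" for a b c :: "'c::real_normed_vector"
proof -
  have "(norm (a - c))\<^sup>2 \<le> (norm (a - b) + norm (b - c))\<^sup>2"
    using norm_triangle_ineq[of "a - b" "b - c"] by (intro power_mono) auto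
  also have "\<dots> \<le> 2 * (norm (a - b))\<^sup>2 + 2 * (norm (b - c))\<^sup>2"
    using sum_squares_bound[of "norm (a - b)" "norm (b - c)"] by (simp add: power2_sum)
  finally show ?thesis .
qed

lemma J_meas: "0 \<le> t \<Longrightarrow> t \<le> T \<Longrightarrow> J t \<in> borel_measurable M"
  using ito measurable_F_M[of "J t" t] by (auto simp: has_ito_integral_def)

lemma simple_integral_meas:
  assumes "sq_simple M F T n \<tau> \<xi>" "0 \<le> t"
  shows "(simple_integral B n \<tau> \<xi> t :: 'a \<Rightarrow> real ^ 'd) \<in> borel_measurable M"
  unfolding simple_integral_def[abs_def]
proof (intro borel_measurable_sum borel_measurable_matrix_vector_mult borel_measurable_diff B_meas_M)
  fix i assume i: "i \<in> {..<n}"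
  then show "\<xi> i \<in> borel_measurable M" using assms by (auto simp: sq_simple_def in_Lp_def)
  show "0 \<le> min (\<tau> (Suc i)) t" "0 \<le> min (\<tau> i) t"
    using sq_simple_nonneg[OF assms(1), of i] sq_simple_nonneg[OF assms(1), of "Suc i"] i assms(2) by auto
qed

text \<open>The simple processes in the definition of the integral approximate \<open>H\<close> only in \<open>L\<^sup>2\<close>, which is too
  weak for \<open>p\<close>-th moments. The bound for simple integrals with \<open>p = 2\<close> shows that they may be replaced
  by the values of \<open>H\<close> on the grid, for which \<open>p\<close>-th moments are under control.\<close>

lemma grid_integral_L2:
  assumes t: "0 \<le> t" "t \<le> T"
  shows "(\<integral>\<^sup>+\<omega>. ennreal ((norm (simple_integral B (NN n) (G n) (\<lambda>j. H (G n j)) t \<omega> - J t \<omega>))\<^sup>2) \<partial>M)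
    \<le> ennreal (4 * bdg_const CARD('q) 2) * (\<integral>\<^sup>+\<omega>. dist_sq (HG n) \<omega> \<partial>M)"
proof -
  let ?S = "simple_integral B (NN n) (G n) (\<lambda>j. H (G n j)) t"
  let ?c = "bdg_const CARD('q) 2"
  obtain m \<tau> \<xi> where S: "\<And>k. simple_integrand F T (m k) (\<tau> k) (\<xi> k)"
    and P: "(\<lambda>k. \<integral>\<^sup>+\<omega>. dist_sq (simple_process (m k) (\<tau> k) (\<xi> k)) \<omega> \<partial>M) \<longlonglongrightarrow> 0"
    and I: "(\<lambda>k. \<integral>\<^sup>+ \<omega>. ennreal ((norm (simple_integral B (m k) (\<tau> k) (\<xi> k) t \<omega> - J t \<omega>))\<^sup>2) \<partial>M) \<longlonglongrightarrow> 0"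
    using ito t unfolding has_ito_integral_def by fastforce
  have S': "sq_simple M F T (m k) (\<tau> k) (\<xi> k)" for k by (intro simple_integrand_sq_simple S)
  let ?I = "\<lambda>k. simple_integral B (m k) (\<tau> k) (\<xi> k) t"
  let ?P = "\<lambda>k. simple_process (m k) (\<tau> k) (\<xi> k)"
  have Pj: "(\<lambda>(\<omega>, s). ?P k s \<omega>) \<in> borel_measurable (M \<Otimes>\<^sub>M lborel)" for k
    using S' by (intro simple_process_joint_measurable) (auto simp: sq_simple_def in_Lp_def)
  note Sm [measurable] = simple_integral_meas[OF HG_sq_simple t(1)] simple_integral_meas[OF S' t(1)] J_meas[OF t]
  \<comment> \<open>Two insertions: the simple integral \<open>?I k\<close> between grid integral
    and \<open>J t\<close>, and \<open>H\<close> between the two integrands. As \<open>k\<close>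
    grows, only the distance of \<open>HG n\<close> from \<open>H\<close> survives.\<close>
  have step: "(\<integral>\<^sup>+\<omega>. ennreal ((norm (?S \<omega> - J t \<omega>))\<^sup>2) \<partial>M)
     \<le> 2 * (ennreal ?c * (2 * (\<integral>\<^sup>+\<omega>. dist_sq (HG n) \<omega> \<partial>M) + 2 * (\<integral>\<^sup>+\<omega>. dist_sq (?P k) \<omega> \<partial>M))) + 2 * (\<integral>\<^sup>+\<omega>. ennreal ((norm (?I k \<omega> - J t \<omega>))\<^sup>2) \<partial>M)" for k
  proof -
    have "(\<integral>\<^sup>+\<omega>. ennreal ((norm (?S \<omega> - J t \<omega>))\<^sup>2) \<partial>M)
      \<le> (\<integral>\<^sup>+\<omega>. 2 * ennreal ((norm (?S \<omega> - ?I k \<omega>))\<^sup>2) + 2 * ennreal ((norm (?I k \<omega> - J t \<omega>))\<^sup>2) \<partial>M)"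
    proof (intro nn_integral_mono)
      fix \<omega>
      have "ennreal ((norm (?S \<omega> - J t \<omega>))\<^sup>2) \<le> ennreal (2 * (norm (?S \<omega> - ?I k \<omega>))\<^sup>2 + 2 * (norm (?I k \<omega> - J t \<omega>))\<^sup>2)"
        by (intro ennreal_leI sq_norm_split)
      then show "ennreal ((norm (?S \<omega> - J t \<omega>))\<^sup>2) \<le> 2 * ennreal ((norm (?S \<omega> - ?I k \<omega>))\<^sup>2) + 2 * ennreal ((norm (?I k \<omega> - J t \<omega>))\<^sup>2)"
        by (simp add: ennreal_mult)
    qed
    also have "\<dots> = 2 * (\<integral>\<^sup>+\<omega>. ennreal ((norm (?S \<omega> - ?I k \<omega>))\<^sup>2) \<partial>M) + 2 * (\<integral>\<^sup>+\<omega>. ennreal ((norm (?I k \<omega> - J t \<omega>))\<^sup>2) \<partial>M)"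
      by (subst nn_integral_add; (measurable)?) (simp add: nn_integral_cmult)
    also have "(\<integral>\<^sup>+\<omega>. ennreal ((norm (?S \<omega> - ?I k \<omega>))\<^sup>2) \<partial>M)
      \<le> ennreal ?c * (\<integral>\<^sup>+\<omega>. (\<integral>\<^sup>+x\<in>{0..T}. ennreal ((norm (HG n x \<omega> - ?P k x \<omega>))\<^sup>2) \<partial>lborel) \<partial>M)"
      by (intro simple_integral_L2_diff HG_sq_simple S' t T)
    also have "(\<integral>\<^sup>+\<omega>. (\<integral>\<^sup>+x\<in>{0..T}. ennreal ((norm (HG n x \<omega> - ?P k x \<omega>))\<^sup>2) \<partial>lborel) \<partial>M)
      \<le> (\<integral>\<^sup>+\<omega>. 2 * dist_sq (HG n) \<omega> + 2 * dist_sq (?P k) \<omega> \<partial>M)"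
    proof (rule nn_integral_mono)
      fix \<omega> assume \<omega>: "\<omega> \<in> space M"
      let ?h = "\<lambda>Q s. ennreal ((norm (indicator {0<..T} s *\<^sub>R Q s \<omega> - indicator {0<..T} s *\<^sub>R H s \<omega>))\<^sup>2)"
      have hm: "?h Q \<in> borel_measurable lborel" if "(\<lambda>(\<omega>, s). Q s \<omega>) \<in> borel_measurable (M \<Otimes>\<^sub>M lborel)" for Q
      proof -
        have [measurable]: "(\<lambda>s. Q s \<omega>) \<in> borel_measurable lborel" using measurable_Pair2[OF that \<omega>] by simp
        note [measurable] = H_section_measurable[OF \<omega>]
        show ?thesis by measurable
      qed
      have "(\<integral>\<^sup>+x\<in>{0..T}. ennreal ((norm (HG n x \<omega> - ?P k x \<omega>))\<^sup>2) \<partial>lborel) \<le> (\<integral>\<^sup>+s. 2 * ?h (HG n) s + 2 * ?h (?P k) s \<partial>lborel)"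
      proof (rule nn_integral_mono_AE)
        show "AE x in lborel. ennreal ((norm (HG n x \<omega> - ?P k x \<omega>))\<^sup>2) * indicator {0..T} x \<le> 2 * ?h (HG n) x + 2 * ?h (?P k) x"
          using AE_lborel_singleton[of 0]
        proof eventually_elim
          case (elim x)
          show ?case
          proof (cases "x \<in> {0<..T}")
            case True
            have "ennreal ((norm (HG n x \<omega> - ?P k x \<omega>))\<^sup>2) \<le> ennreal (2 * (norm (HG n x \<omega> - H x \<omega>))\<^sup>2 + 2 * (norm (H x \<omega> - ?P k x \<omega>))\<^sup>2)"
              by (intro ennreal_leI sq_norm_split)
            then show ?thesis using True by (simp add: ennreal_mult norm_minus_commute)
          next
            case False
            then have "x \<notin> {0..T}" using elim by auto
            then show ?thesis by simp
          qed
        qed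
      qed
      also have "\<dots> = 2 * (\<integral>\<^sup>+s. ?h (HG n) s \<partial>lborel) + 2 * (\<integral>\<^sup>+s. ?h (?P k) s \<partial>lborel)"
        using hm[OF HG_joint[of n]] hm[OF Pj[of k]] by (subst nn_integral_add) (auto simp: nn_integral_cmult)
      finally show "(\<integral>\<^sup>+x\<in>{0..T}. ennreal ((norm (HG n x \<omega> - ?P k x \<omega>))\<^sup>2) \<partial>lborel) \<le> 2 * dist_sq (HG n) \<omega> + 2 * dist_sq (?P k) \<omega>"
        unfolding dist_sq_eq .
    qed
    also have "\<dots> = 2 * (\<integral>\<^sup>+\<omega>. dist_sq (HG n) \<omega> \<partial>M) + 2 * (\<integral>\<^sup>+\<omega>. dist_sq (?P k) \<omega> \<partial>M)"
      using dist_sq_measurable[OF HG_joint[of n]] dist_sq_measurable[OF Pj[of k]]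
      by (subst nn_integral_add) (auto simp: nn_integral_cmult)
    finally show ?thesis by (simp add: mult_left_mono add_right_mono)
  qed
  have "(\<integral>\<^sup>+\<omega>. ennreal ((norm (?S \<omega> - J t \<omega>))\<^sup>2) \<partial>M) \<le> 2 * (ennreal ?c * (2 * (\<integral>\<^sup>+\<omega>. dist_sq (HG n) \<omega> \<partial>M) + 2 * 0)) + 2 * 0"
  proof (rule LIMSEQ_le_const)
    show "(\<lambda>k. 2 * (ennreal ?c * (2 * (\<integral>\<^sup>+\<omega>. dist_sq (HG n) \<omega> \<partial>M) + 2 * (\<integral>\<^sup>+\<omega>. dist_sq (?P k) \<omega> \<partial>M))) + 2 * (\<integral>\<^sup>+\<omega>. ennreal ((norm (?I k \<omega> - J t \<omega>))\<^sup>2) \<partial>M))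
       \<longlonglongrightarrow> 2 * (ennreal ?c * (2 * (\<integral>\<^sup>+\<omega>. dist_sq (HG n) \<omega> \<partial>M) + 2 * 0)) + 2 * 0"
      by (intro tendsto_add ennreal_tendsto_cmult tendsto_const P I) auto
  qed (use step in auto)
  also have "\<dots> = ennreal (4 * ?c) * (\<integral>\<^sup>+\<omega>. dist_sq (HG n) \<omega> \<partial>M)"
    by (simp add: ennreal_mult' mult_ac)
  finally show ?thesis .
qed

lemma grid_sum_eq: "i \<le> NN n \<Longrightarrow> simple_integral B (NN n) (G n) (\<lambda>j. H (G n j)) (G n i) \<omega>
   = (\<Sum>j<i. H (G n j) \<omega> *v (B (G n (Suc j)) \<omega> - B (G n j) \<omega>))"
proof -
  assume i: "i \<le> NN n"
  have "simple_integral B (NN n) (G n) (\<lambda>j. H (G n j)) (G n i) \<omega>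
     = (\<Sum>j<NN n. if j < i then H (G n j) \<omega> *v (B (G n (Suc j)) \<omega> - B (G n j) \<omega>) else 0)"
    unfolding simple_integral_def
  proof (rule sum.cong)
    fix j
    show "H (G n j) \<omega> *v (B (min (G n (Suc j)) (G n i)) \<omega> - B (min (G n j) (G n i)) \<omega>)
      = (if j < i then H (G n j) \<omega> *v (B (G n (Suc j)) \<omega> - B (G n j) \<omega>) else 0)"
    proof (cases "j < i")
      case True
      then show ?thesis using G_mono[of j i n] G_mono[of "Suc j" i n] by (simp add: min_absorb1)
    next
      case False
      then show ?thesis using G_mono[of i j n] G_mono[of i "Suc j" n] by (simp add: min_absorb2)
    qed
  qed simp
  also have "\<dots> = (\<Sum>j<i. H (G n j) \<omega> *v (B (G n (Suc j)) \<omega> - B (G n j) \<omega>))"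
    using i by (intro sum.mono_neutral_cong_right) auto
  finally show ?thesis .
qed

text \<open>The squared errors at the finitely many points of grid \<open>n\<close> are added up to
  one sequence converging in \<open>L^1\<close>, so that one subsequence and one null set serve all
  of these points.\<close>

lemma grid_sum_AE_subseq:
  "\<exists>r. strict_mono r \<and> (AE \<omega> in M. \<forall>i\<le>NN n. (\<lambda>k. \<Sum>j<i * 2 ^ r k. H (G (n + r k) j) \<omega> *v (B (G (n + r k) (Suc j)) \<omega> - B (G (n + r k) j) \<omega>))
      \<longlonglongrightarrow> J (G n i) \<omega>)"
proof -
  let ?S = "\<lambda>k i \<omega>. \<Sum>j<i * 2 ^ k. H (G (n + k) j) \<omega> *v (B (G (n + k) (Suc j)) \<omega> - B (G (n + k) j) \<omega>)"
  let ?u = "\<lambda>k \<omega>. \<Sum>i\<le>NN n. (norm (?S k i \<omega> - J (G n i) \<omega>))\<^sup>2"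
  have Seq: "?S k i = simple_integral B (NN (n + k)) (G (n + k)) (\<lambda>j. H (G (n + k) j)) (G n i)" if "i \<le> NN n" for i k
    using grid_sum_eq[of "i * 2 ^ k" "n + k"] that by (simp add: NN_refine G_refine fun_eq_iff)
  have Sm: "(\<lambda>\<omega>. ?S k i \<omega> - J (G n i) \<omega>) \<in> borel_measurable M" if "i \<le> NN n" for i k
    using Seq[OF that, of k] simple_integral_meas[OF HG_sq_simple, of "G n i" "n + k"] J_meas[of "G n i"] G_nonneg G_le_T[OF that]
    by (intro borel_measurable_diff) (simp_all only: Seq[OF that])
  have um: "?u k \<in> borel_measurable M" for k
    using Sm[of _ k] by (intro borel_measurable_sum borel_measurable_power borel_measurable_norm[THEN measurable_compose_rev]) auto
  let ?E = "\<lambda>k. ennreal (real (NN n) + 1) * (ennreal (4 * bdg_const CARD('q) 2) * (\<integral>\<^sup>+\<omega>. dist_sq (HG (n + k)) \<omega> \<partial>M))"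
  have bound: "(\<integral>\<^sup>+\<omega>. ennreal (?u k \<omega>) \<partial>M) \<le> ?E k" for k
  proof -
    have "(\<integral>\<^sup>+\<omega>. ennreal (?u k \<omega>) \<partial>M) = (\<Sum>i\<le>NN n. (\<integral>\<^sup>+\<omega>. ennreal ((norm (?S k i \<omega> - J (G n i) \<omega>))\<^sup>2) \<partial>M))"
    proof (subst nn_integral_sum[symmetric])
      fix i assume "i \<in> {..NN n}"
      then have [measurable]: "(\<lambda>\<omega>. ?S k i \<omega> - J (G n i) \<omega>) \<in> borel_measurable M" by (intro Sm) simp
      show "(\<lambda>\<omega>. ennreal ((norm (?S k i \<omega> - J (G n i) \<omega>))\<^sup>2)) \<in> borel_measurable M" by measurable
    qed (simp add: sum_ennreal)
    also have "\<dots> \<le> (\<Sum>i\<le>NN n. ennreal (4 * bdg_const CARD('q) 2) * (\<integral>\<^sup>+\<omega>. dist_sq (HG (n + k)) \<omega> \<partial>M))"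
    proof (rule sum_mono)
      fix i assume "i \<in> {..NN n}"
      then have i: "i \<le> NN n" by simp
      show "(\<integral>\<^sup>+\<omega>. ennreal ((norm (?S k i \<omega> - J (G n i) \<omega>))\<^sup>2) \<partial>M) \<le> ennreal (4 * bdg_const CARD('q) 2) * (\<integral>\<^sup>+\<omega>. dist_sq (HG (n + k)) \<omega> \<partial>M)"
        using grid_integral_L2[OF G_nonneg G_le_T[OF i], of "n + k"] unfolding Seq[OF i, symmetric] .
    qed
    also have "\<dots> = ?E k" by (simp add: ennreal_of_nat_eq_real_of_nat ennreal_plus[symmetric] add.commute del: ennreal_plus)
    finally show ?thesis .
  qed
  have lim: "?E \<longlonglongrightarrow> 0"
  proof -
    have "(\<lambda>k. \<integral>\<^sup>+\<omega>. dist_sq (HG (n + k)) \<omega> \<partial>M) \<longlonglongrightarrow> 0"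
      using LIMSEQ_ignore_initial_segment[OF dist_sq_HG_tendsto, of n] by (simp add: add.commute)
    then have "?E \<longlonglongrightarrow> ennreal (real (NN n) + 1) * (ennreal (4 * bdg_const CARD('q) 2) * 0)"
      by (intro ennreal_tendsto_cmult) auto
    then show ?thesis by simp
  qed
  have fin: "?E k < \<infinity>" for k using dist_sq_HG_finite[of "n + k"] by (simp add: ennreal_mult_less_top)
  have iu: "integrable M (?u k)" for k
    using um bound[of k] fin[of k] by (intro integrableI_nonneg AE_I2 sum_nonneg) (auto intro: le_less_trans)
  have "(\<lambda>k. expectation (\<lambda>\<omega>. norm (?u k \<omega>))) \<longlonglongrightarrow> 0"
  proof -
    have nu: "norm (?u k \<omega>) = ?u k \<omega>" for k \<omega> by (simp add: sum_nonneg)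
    have "expectation (?u k) = enn2real (\<integral>\<^sup>+\<omega>. ennreal (?u k \<omega>) \<partial>M)" for k
      using um by (intro integral_eq_nn_integral AE_I2 sum_nonneg) auto
    moreover have "(\<lambda>k. \<integral>\<^sup>+\<omega>. ennreal (?u k \<omega>) \<partial>M) \<longlonglongrightarrow> 0"
      using bound lim by (intro tendsto_sandwich[OF _ _ tendsto_const lim]) auto
    then have "(\<lambda>k. enn2real (\<integral>\<^sup>+\<omega>. ennreal (?u k \<omega>) \<partial>M)) \<longlonglongrightarrow> enn2real 0"
      by (intro tendsto_enn2real) auto
    ultimately show ?thesis unfolding nu by simp
  qed
  from tendsto_L1_AE_subseq[OF iu this] obtain r where r: "strict_mono r" "AE \<omega> in M. (\<lambda>k. ?u (r k) \<omega>) \<longlonglongrightarrow> 0" by auto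
  from r(2) have "AE \<omega> in M. \<forall>i\<le>NN n. (\<lambda>k. ?S (r k) i \<omega>) \<longlonglongrightarrow> J (G n i) \<omega>"
  proof eventually_elim
    case (elim \<omega>)
    show ?case
    proof (intro allI impI)
      fix i assume i: "i \<le> NN n"
      have le: "(norm (?S k i \<omega> - J (G n i) \<omega>))\<^sup>2 \<le> ?u k \<omega>" for k
        using i by (intro member_le_sum) auto
      have "(\<lambda>k. (norm (?S (r k) i \<omega> - J (G n i) \<omega>))\<^sup>2) \<longlonglongrightarrow> 0"
        using le by (intro tendsto_sandwich[OF _ _ tendsto_const elim]) auto
      then have "(\<lambda>k. sqrt ((norm (?S (r k) i \<omega> - J (G n i) \<omega>))\<^sup>2)) \<longlonglongrightarrow> sqrt 0" by (rule tendsto_real_sqrt)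
      then have "(\<lambda>k. norm (?S (r k) i \<omega> - J (G n i) \<omega>)) \<longlonglongrightarrow> 0" by simp
      then show "(\<lambda>k. ?S (r k) i \<omega>) \<longlonglongrightarrow> J (G n i) \<omega>" using LIM_zero_iff tendsto_norm_zero_iff by blast
    qed
  qed
  with r(1) show ?thesis by blast
qed

end

section \<open>The McKean-Vlasov equation\<close>

lemma ennreal_powr_ennreal: "0 \<le> x \<Longrightarrow> ennreal_powr (ennreal x) r = ennreal (x powr r)"
  by (simp add: ennreal_powr_def)

lemma Lp_norm_le:
  assumes "(\<integral>\<^sup>+\<omega>. ennreal_powr (U \<omega>) p \<partial>M) \<le> ennreal (c powr p)" "0 \<le> c" "0 < p"
  shows "Lp_norm M p U \<le> ennreal c"
proof -
  obtain r where r: "0 \<le> r" "(\<integral>\<^sup>+\<omega>. ennreal_powr (U \<omega>) p \<partial>M) = ennreal r"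
    using assms(1) by (cases "\<integral>\<^sup>+\<omega>. ennreal_powr (U \<omega>) p \<partial>M") (auto simp: top_unique)
  have "r powr (1/p) \<le> (c powr p) powr (1/p)" using assms r by (intro powr_mono2) auto
  also have "\<dots> = c" using assms by (simp add: powr_powr)
  finally show ?thesis unfolding Lp_norm_def r using r by (simp add: ennreal_powr_ennreal ennreal_leI)
qed

lemma ennreal_powr_less_top: "ennreal_powr x r < \<top> \<longleftrightarrow> x < \<top>"
  by (simp add: ennreal_powr_def less_top)

context filtered_bm
begin

text \<open>For a single increment with an arbitrary end time, as the Euler scheme needs between its
  grid points.\<close>

lemma noise_in_Lp:
  fixes \<zeta> :: "'a \<Rightarrow> real ^ 'q ^ 'd"
  assumes s: "0 \<le> s" "s \<le> t" and \<zeta>: "\<zeta> \<in> borel_measurable (F s)" "in_Lp M p \<zeta>" and p: "p > 0"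
  shows "in_Lp M p (\<lambda>\<omega>. \<zeta> \<omega> *v (B t \<omega> - B s \<omega>))"
proof (rule in_LpI_bound)
  have [measurable]: "\<zeta> \<in> borel_measurable M" "B t \<in> borel_measurable M" "B s \<in> borel_measurable M"
    using s \<zeta> by (auto intro: in_Lp_measurable B_meas_M)
  show "(\<lambda>\<omega>. \<zeta> \<omega> *v (B t \<omega> - B s \<omega>)) \<in> borel_measurable M" by measurable
  have Y: "(\<lambda>\<omega>. norm (\<zeta> \<omega>) powr p) \<in> borel_measurable (F s)" using \<zeta>(1) by measurable
  have g: "(\<lambda>x :: real ^ 'q. norm x powr p) \<in> borel_measurable borel" by measurable
  show "integrable M (\<lambda>\<omega>. norm (\<zeta> \<omega>) powr p * norm (B t \<omega> - B s \<omega>) powr p)"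
    by (rule B_incr_indep(1)[OF s Y in_Lp_integrable[OF \<zeta>(2)] g B_incr_moment(1)[OF s p]])
  show "AE \<omega> in M. norm (\<zeta> \<omega> *v (B t \<omega> - B s \<omega>)) powr p \<le> norm (\<zeta> \<omega>) powr p * norm (B t \<omega> - B s \<omega>) powr p"
  proof (rule AE_I2)
    fix \<omega>
    have "norm (\<zeta> \<omega> *v (B t \<omega> - B s \<omega>)) powr p \<le> (norm (\<zeta> \<omega>) * norm (B t \<omega> - B s \<omega>)) powr p"
      using p by (intro powr_mono2 norm_matrix_vector_mult_le) auto
    then show "norm (\<zeta> \<omega> *v (B t \<omega> - B s \<omega>)) powr p \<le> norm (\<zeta> \<omega>) powr p * norm (B t \<omega> - B s \<omega>) powr p"
      by (simp add: powr_mult)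
  qed
qed

end

context bm_grid
begin

lemma mom_add_le:
  assumes "in_Lp M p f" "in_Lp M p g"
  shows "mom (\<lambda>\<omega>. f \<omega> + g \<omega>) \<le> 2 powr p * (mom f + mom g)"
proof -
  have p0: "p \<ge> 0" using p by simp
  have "mom (\<lambda>\<omega>. f \<omega> + g \<omega>) \<le> expectation (\<lambda>\<omega>. 2 powr p * (norm (f \<omega>) powr p + norm (g \<omega>) powr p))"
  proof (rule integral_mono)
    show "integrable M (\<lambda>\<omega>. norm (f \<omega> + g \<omega>) powr p)" by (intro in_Lp_integrable in_Lp_add assms p0)
    show "integrable M (\<lambda>\<omega>. 2 powr p * (norm (f \<omega>) powr p + norm (g \<omega>) powr p))"
      by (intro integrable_mult_right Bochner_Integration.integrable_add in_Lp_integrable assms)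
    fix \<omega>
    have "norm (f \<omega> + g \<omega>) powr p \<le> (norm (f \<omega>) + norm (g \<omega>)) powr p"
      using p0 by (intro powr_mono2 norm_triangle_ineq) auto
    also have "\<dots> \<le> 2 powr p * (norm (f \<omega>) powr p + norm (g \<omega>) powr p)"
      using p0 by (intro powr_add_le) auto
    finally show "norm (f \<omega> + g \<omega>) powr p \<le> 2 powr p * (norm (f \<omega>) powr p + norm (g \<omega>) powr p)" .
  qed
  also have "\<dots> = 2 powr p * (mom f + mom g)"
    using assms[THEN in_Lp_integrable] by simp
  finally show ?thesis .
qed

text \<open>The sums for \<open>Y'\<close> are exact on every grid, so the subsequence that works
  for \<open>Y\<close> works for the difference. Two limits along unrelated subsequences could not
  simply be subtracted.\<close>

lemma ito_approx_diff:
  fixes Y Y' :: "real \<Rightarrow> 'a \<Rightarrow> real ^ 'd"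
  assumes Y: "ito_approx \<beta> \<zeta> Y" and a: "adapted_Lp \<beta>'" "adapted_Lp \<zeta>'"
    and Y': "\<And>n i \<omega>. i \<le> NN n \<Longrightarrow> \<omega> \<in> space M \<Longrightarrow> gsum \<beta>' \<zeta>' n i \<omega> = Y' (G n i) \<omega> - Y' 0 \<omega>"
  shows "ito_approx (\<lambda>n i \<omega>. \<beta> n i \<omega> - \<beta>' n i \<omega>) (\<lambda>n i \<omega>. \<zeta> n i \<omega> - \<zeta>' n i \<omega>) (\<lambda>t \<omega>. Y t \<omega> - Y' t \<omega>)"
  unfolding ito_approx_def
proof (intro conjI allI)
  have p0: "p \<ge> 0" using p by simp
  show "adapted_Lp (\<lambda>n i \<omega>. \<beta> n i \<omega> - \<beta>' n i \<omega>)" "adapted_Lp (\<lambda>n i \<omega>. \<zeta> n i \<omega> - \<zeta>' n i \<omega>)"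
    using Y a p0 unfolding ito_approx_def adapted_Lp_def
    by (auto intro!: in_Lp_diff borel_measurable_diff)
  fix n
  obtain r where r: "strict_mono r" and lim: "AE \<omega> in M. \<forall>i\<le>NN n.
        (\<lambda>k. gsum \<beta> \<zeta> (n + r k) (i * 2 ^ r k) \<omega>) \<longlonglongrightarrow> Y (G n i) \<omega> - Y 0 \<omega>"
    using Y unfolding ito_approx_def by blast
  have split: "gsum (\<lambda>n i \<omega>. \<beta> n i \<omega> - \<beta>' n i \<omega>) (\<lambda>n i \<omega>. \<zeta> n i \<omega> - \<zeta>' n i \<omega>) k i \<omega> = gsum \<beta> \<zeta> k i \<omega> - gsum \<beta>' \<zeta>' k i \<omega>" for k i \<omega>
    unfolding gsum_def by (simp add: sum_subtractf[symmetric] scaleR_right_diff_distrib matrix_vector_mult_diff_rdistrib algebra_simps)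
  have "AE \<omega> in M. \<forall>i\<le>NN n. (\<lambda>k. gsum (\<lambda>n i \<omega>. \<beta> n i \<omega> - \<beta>' n i \<omega>) (\<lambda>n i \<omega>. \<zeta> n i \<omega> - \<zeta>' n i \<omega>) (n + r k) (i * 2 ^ r k) \<omega>)
      \<longlonglongrightarrow> (Y (G n i) \<omega> - Y' (G n i) \<omega>) - (Y 0 \<omega> - Y' 0 \<omega>)"
    using lim AE_space
  proof eventually_elim
    case (elim \<omega>)
    show ?case
    proof (intro allI impI)
      fix i assume i: "i \<le> NN n"
      have eq: "gsum \<beta>' \<zeta>' (n + r k) (i * 2 ^ r k) \<omega> = Y' (G n i) \<omega> - Y' 0 \<omega>" for k
        using Y'[of "i * 2 ^ r k" "n + r k" \<omega>] i elim by (simp add: NN_refine G_refine)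
      have "(\<lambda>k. gsum \<beta> \<zeta> (n + r k) (i * 2 ^ r k) \<omega> - (Y' (G n i) \<omega> - Y' 0 \<omega>)) \<longlonglongrightarrow> (Y (G n i) \<omega> - Y 0 \<omega>) - (Y' (G n i) \<omega> - Y' 0 \<omega>)"
        using elim i by (intro tendsto_diff tendsto_const) auto
      moreover have "(Y (G n i) \<omega> - Y 0 \<omega>) - (Y' (G n i) \<omega> - Y' 0 \<omega>) = (Y (G n i) \<omega> - Y' (G n i) \<omega>) - (Y 0 \<omega> - Y' 0 \<omega>)"
        by simp
      ultimately show "(\<lambda>k. gsum (\<lambda>n i \<omega>. \<beta> n i \<omega> - \<beta>' n i \<omega>) (\<lambda>n i \<omega>. \<zeta> n i \<omega> - \<zeta>' n i \<omega>) (n + r k) (i * 2 ^ r k) \<omega>)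
      \<longlonglongrightarrow> (Y (G n i) \<omega> - Y' (G n i) \<omega>) - (Y 0 \<omega> - Y' 0 \<omega>)"
        unfolding split eq by simp
    qed
  qed
  with r show "\<exists>r. strict_mono r \<and> (AE \<omega> in M. \<forall>i\<le>NN n. (\<lambda>k. gsum (\<lambda>n i \<omega>. \<beta> n i \<omega> - \<beta>' n i \<omega>) (\<lambda>n i \<omega>. \<zeta> n i \<omega> - \<zeta>' n i \<omega>) (n + r k) (i * 2 ^ r k) \<omega>)
      \<longlonglongrightarrow> (Y (G n i) \<omega> - Y' (G n i) \<omega>) - (Y 0 \<omega> - Y' 0 \<omega>))" by blast
qed

end

text \<open>The constants \<open>L\<close> and \<open>L'\<close> refer to the Frobenius norm, so they are those of the theorem times
  the number of matrix entries. The parameter \<open>q\<close> keeps the type \<open>'q\<close> from becoming a hidden argument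
  of the constants below.\<close>

locale mckean_vlasov = bm_grid M F B p T N
  for M :: "'a measure" and F and B :: "real \<Rightarrow> 'a \<Rightarrow> real ^ 'q" and p T N +
  fixes b :: "real \<Rightarrow> real ^ 'd \<Rightarrow> (real ^ 'd) measure \<Rightarrow> real ^ 'd"
    and \<sigma> :: "real \<Rightarrow> real ^ 'd \<Rightarrow> (real ^ 'd) measure \<Rightarrow> real ^ 'q ^ 'd"
    and L L' \<rho> K :: real and q :: nat and X0 :: "'a \<Rightarrow> real ^ 'd" and X Xb :: "real \<Rightarrow> 'a \<Rightarrow> real ^ 'd"
  assumes q: "q = CARD('q)"
    and hb: "hoelder_lipschitz T p \<rho> L L' norm b" and hs: "hoelder_lipschitz T p \<rho> L L' norm \<sigma>"
    and L: "L \<ge> 0" and L': "L' \<ge> 0" and \<rho>: "\<rho> > 0"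
    and Kb: "\<And>t. 0 \<le> t \<Longrightarrow> t \<le> T \<Longrightarrow> norm (b t 0 (return borel 0)) \<le> K"
    and Ks: "\<And>t. 0 \<le> t \<Longrightarrow> t \<le> T \<Longrightarrow> norm (\<sigma> t 0 (return borel 0)) \<le> K"
    and X0_adapted: "X0 \<in> borel_measurable (F 0)" and X0_Lp: "in_Lp M p X0"
    and sol: "mckean_vlasov_solution M F B T p b \<sigma> X0 X"
    and eul: "euler_scheme M B T b \<sigma> X0 N Xb"
begin

lemma p1: "p \<ge> 1" and p0: "p \<ge> 0" using p by auto

lemma K_nonneg: "0 \<le> K" using Kb[of 0] T norm_ge_zero order_trans by (meson less_imp_le order_refl)

text \<open>\<open>c0\<close> and \<open>c1\<close> are twice the constants of
  \<open>coeff_growth\<close>, once for the drift and once for the diffusion coefficient.\<close>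

definition c0 :: real where "c0 = 2 * 3 powr p * K powr p"
definition c1 :: real where "c1 = 4 * 3 powr p * L powr p"

lemma c0_nonneg: "0 \<le> c0" and c1_nonneg: "0 \<le> c1"
  by (auto simp: c0_def c1_def)

abbreviation at_law :: "(real \<Rightarrow> real ^ 'd \<Rightarrow> (real ^ 'd) measure \<Rightarrow> 'c) \<Rightarrow> real \<Rightarrow> ('a \<Rightarrow> real ^ 'd) \<Rightarrow> 'a \<Rightarrow> 'c" where
  "at_law f t U \<equiv> (\<lambda>\<omega>. f t (U \<omega>) (law M U))"

lemma coeffs_growth:
  assumes "0 \<le> t" "t \<le> T" "in_Lp M p U"
  shows "in_Lp M p (at_law b t U)" "in_Lp M p (at_law \<sigma> t U)"
    and "mom (at_law b t U) + mom (at_law \<sigma> t U) \<le> c0 + c1 * mom U"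
proof -
  note gb = coeff_growth[OF hb assms p1 Kb[OF assms(1,2)] L]
  note gs = coeff_growth[OF hs assms p1 Ks[OF assms(1,2)] L]
  show "in_Lp M p (at_law b t U)" "in_Lp M p (at_law \<sigma> t U)" by (fact gb(1), fact gs(1))
  show "mom (at_law b t U) + mom (at_law \<sigma> t U) \<le> c0 + c1 * mom U"
    using add_mono[OF gb(2) gs(2)] by (simp add: c0_def c1_def algebra_simps)
qed

lemma coeffs_adapted:
  assumes "0 \<le> t" "t \<le> T" "in_Lp M p U" "U \<in> borel_measurable (F t)" "t \<le> u"
  shows "at_law b t U \<in> borel_measurable (F u)" "at_law \<sigma> t U \<in> borel_measurable (F u)"
proof -
  have U: "U \<in> borel_measurable (F u)" by (rule measurable_F_mono[OF assms(4,1,5)])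
  show "at_law b t U \<in> borel_measurable (F u)" by (rule coeff_measurable[OF hb assms(1-3) p1 U])
  show "at_law \<sigma> t U \<in> borel_measurable (F u)" by (rule coeff_measurable[OF hs assms(1-3) p1 U])
qed

lemma X_adapted: "0 \<le> t \<Longrightarrow> t \<le> T \<Longrightarrow> X t \<in> borel_measurable (F t)"
  and X_cont: "\<omega> \<in> space M \<Longrightarrow> continuous_on {0..T} (\<lambda>t. X t \<omega>)"
  using sol by (auto simp: mckean_vlasov_solution_def)

lemma X_meas: "0 \<le> t \<Longrightarrow> t \<le> T \<Longrightarrow> X t \<in> borel_measurable M"
  using X_adapted measurable_F_M by blast

text \<open>A countable dense set of times, through which the supremum over the path becomes
  measurable.\<close>

definition grid_points :: "real set" where "grid_points = (\<Union>n. G n ` {..NN n})"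

lemma grid_points: "countable grid_points" "u \<in> grid_points \<Longrightarrow> 0 \<le> u \<and> u \<le> T"
  by (auto simp: grid_points_def G_nonneg G_le_T)

lemma sup_norm_X_grid: "\<omega> \<in> space M \<Longrightarrow> sup_norm {0..T} X \<omega> = sup_norm grid_points X \<omega>"
proof (rule antisym)
  assume \<omega>: "\<omega> \<in> space M"
  show "sup_norm grid_points X \<omega> \<le> sup_norm {0..T} X \<omega>"
    unfolding sup_norm_def using grid_points(2) by (intro SUP_subset_mono) auto
  show "sup_norm {0..T} X \<omega> \<le> sup_norm grid_points X \<omega>"
    unfolding sup_norm_def
  proof (rule SUP_least)
    fix u assume u: "u \<in> {0..T}"
    have lim: "(\<lambda>n. ennreal (norm (X (G n (fl n u)) \<omega>))) \<longlonglongrightarrow> ennreal (norm (X u \<omega>))"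
      using u G_nonneg G_le_T[OF fl_le_NN, of u] G_fl_tendsto[of u]
      by (intro tendsto_ennrealI tendsto_norm continuous_on_tendsto_compose[OF X_cont[OF \<omega>]]) auto
    have "ennreal (norm (X (G n (fl n u)) \<omega>)) \<le> (SUP u\<in>grid_points. ennreal (norm (X u \<omega>)))" for n
      using u fl_le_NN[of u n] by (intro SUP_upper) (auto simp: grid_points_def)
    then show "ennreal (norm (X u \<omega>)) \<le> (SUP u\<in>grid_points. ennreal (norm (X u \<omega>)))"
      by (intro LIMSEQ_le_const2[OF lim] exI allI impI)
  qed
qed

definition R :: "'a \<Rightarrow> real" where "R \<omega> = enn2real (sup_norm {0..T} X \<omega>)"

lemma R_meas [measurable]: "R \<in> borel_measurable M"
proof -
  have "(\<lambda>\<omega>. enn2real (sup_norm grid_points X \<omega>)) \<in> borel_measurable M"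
    unfolding sup_norm_def
  proof (intro borel_measurable_enn2real borel_measurable_SUP grid_points(1))
    fix u assume "u \<in> grid_points"
    then have [measurable]: "X u \<in> borel_measurable M" using grid_points(2) by (auto intro: X_meas)
    show "(\<lambda>\<omega>. ennreal (norm (X u \<omega>))) \<in> borel_measurable M" by measurable
  qed
  then show ?thesis
    by (rule measurable_cong[THEN iffD1, rotated]) (simp add: R_def sup_norm_X_grid)
qed

lemma sup_norm_X_finite: "\<omega> \<in> space M \<Longrightarrow> sup_norm {0..T} X \<omega> = ennreal (R \<omega>)"
proof -
  assume \<omega>: "\<omega> \<in> space M"
  obtain C where "\<And>s. s \<in> {0..T} \<Longrightarrow> norm (X s \<omega>) \<le> C"
    using compact_continuous_image[OF X_cont[OF \<omega>]] compact_imp_bounded[THEN bounded_iff[THEN iffD1]] by fastforce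
  then have "sup_norm {0..T} X \<omega> \<le> ennreal C"
    unfolding sup_norm_def by (intro SUP_least ennreal_leI)
  then have "sup_norm {0..T} X \<omega> < \<top>" by (rule le_less_trans) simp
  then show ?thesis by (simp add: R_def)
qed

lemma R_nonneg: "0 \<le> R \<omega>" by (simp add: R_def)

lemma X_le_R: "\<omega> \<in> space M \<Longrightarrow> 0 \<le> t \<Longrightarrow> t \<le> T \<Longrightarrow> norm (X t \<omega>) \<le> R \<omega>"
proof -
  assume \<omega>: "\<omega> \<in> space M" and t: "0 \<le> t" "t \<le> T"
  have "ennreal (norm (X t \<omega>)) \<le> ennreal (R \<omega>)"
    unfolding sup_norm_X_finite[OF \<omega>, symmetric] sup_norm_def using t by (intro SUP_upper) auto
  then show ?thesis using R_nonneg by simp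
qed

lemma R_integrable: "integrable M (\<lambda>\<omega>. R \<omega> powr p)"
proof (rule integrableI_nonneg)
  have "(\<integral>\<^sup>+\<omega>. ennreal_powr (sup_norm {0..T} X \<omega>) p \<partial>M) < \<top>"
    using sol unfolding mckean_vlasov_solution_def Lp_norm_def by (simp add: ennreal_powr_less_top)
  moreover have "(\<integral>\<^sup>+\<omega>. ennreal_powr (sup_norm {0..T} X \<omega>) p \<partial>M) = (\<integral>\<^sup>+\<omega>. ennreal (R \<omega> powr p) \<partial>M)"
    by (intro nn_integral_cong) (simp add: sup_norm_X_finite ennreal_powr_ennreal R_nonneg)
  ultimately show "(\<integral>\<^sup>+\<omega>. ennreal (R \<omega> powr p) \<partial>M) < \<infinity>" by simp
qed auto

lemma X_Lp: "0 \<le> t \<Longrightarrow> t \<le> T \<Longrightarrow> in_Lp M p (X t)"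
  using X_le_R p0 by (intro in_LpI_bound[OF X_meas R_integrable] AE_I2 powr_mono2) auto

definition HR :: real where "HR = expectation (\<lambda>\<omega>. R \<omega> powr p)"

lemma mom_X_le: "0 \<le> t \<Longrightarrow> t \<le> T \<Longrightarrow> mom (X t) \<le> HR"
  unfolding HR_def using X_le_R p0 by (intro integral_mono in_Lp_integrable X_Lp R_integrable powr_mono2) auto

lemma powr_root_le: "0 \<le> w \<Longrightarrow> w powr p \<le> c \<Longrightarrow> w \<le> c powr (1 / p)"
proof -
  assume w: "0 \<le> w" "w powr p \<le> c"
  then have "(w powr p) powr (1 / p) \<le> c powr (1 / p)" using p by (intro powr_mono2) auto
  then show ?thesis using w p by (simp add: powr_powr)
qed

lemma wasserstein_X_zero_le: "0 \<le> t \<Longrightarrow> t \<le> T \<Longrightarrow> wasserstein p (law M (X t)) (return borel 0) \<le> HR powr (1 / p)"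
  using wasserstein_law_zero_le[OF X_Lp p1] mom_X_le[of t] by (intro powr_root_le) (auto simp: wasserstein_def intro: order_trans)

text \<open>Dominated convergence with \<open>2 * R\<close>. It makes the laws of the solution
  continuous in time for the Wasserstein distance.\<close>

lemma X_Lp_continuous:
  assumes "\<And>n. 0 \<le> x n \<and> x n \<le> T" "0 \<le> a" "a \<le> T" "x \<longlonglongrightarrow> a"
  shows "(\<lambda>n. mom (\<lambda>\<omega>. X (x n) \<omega> - X a \<omega>)) \<longlonglongrightarrow> 0"
proof -
  have [measurable]: "X (x n) \<in> borel_measurable M" "X a \<in> borel_measurable M" for n
    using assms by (auto intro: X_meas)
  have "(\<lambda>n. mom (\<lambda>\<omega>. X (x n) \<omega> - X a \<omega>)) \<longlonglongrightarrow> expectation (\<lambda>\<omega>. 0)"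
  proof (rule integral_dominated_convergence[where w = "\<lambda>\<omega>. 2 powr p * R \<omega> powr p"])
    show "integrable M (\<lambda>\<omega>. 2 powr p * R \<omega> powr p)" using R_integrable by simp
    show "AE \<omega> in M. (\<lambda>n. norm (X (x n) \<omega> - X a \<omega>) powr p) \<longlonglongrightarrow> 0"
    proof (rule AE_I2)
      fix \<omega> assume \<omega>: "\<omega> \<in> space M"
      have "(\<lambda>n. X (x n) \<omega>) \<longlonglongrightarrow> X a \<omega>"
        using assms by (intro continuous_on_tendsto_compose[OF X_cont[OF \<omega>]]) auto
      then have "(\<lambda>n. norm (X (x n) \<omega> - X a \<omega>) powr p) \<longlonglongrightarrow> norm (X a \<omega> - X a \<omega>) powr p"
        using p by (intro tendsto_powr' tendsto_norm tendsto_diff tendsto_const) auto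
      then show "(\<lambda>n. norm (X (x n) \<omega> - X a \<omega>) powr p) \<longlonglongrightarrow> 0" using p by simp
    qed
    show "AE \<omega> in M. norm (norm (X (x n) \<omega> - X a \<omega>) powr p) \<le> 2 powr p * R \<omega> powr p" for n
    proof (rule AE_I2)
      fix \<omega> assume \<omega>: "\<omega> \<in> space M"
      have "norm (X (x n) \<omega> - X a \<omega>) \<le> 2 * R \<omega>"
        using X_le_R[OF \<omega>, of "x n"] X_le_R[OF \<omega>, of a] assms norm_triangle_ineq4[of "X (x n) \<omega>" "X a \<omega>"] by simp
      then have "norm (X (x n) \<omega> - X a \<omega>) powr p \<le> (2 * R \<omega>) powr p" using p0 by (intro powr_mono2) auto
      then show "norm (norm (X (x n) \<omega> - X a \<omega>) powr p) \<le> 2 powr p * R \<omega> powr p" by (simp add: powr_mult)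
    qed
  qed auto
  then show ?thesis by simp
qed

text \<open>Three moduli combine: the Hoelder condition in time, continuity of the path, and
  continuity of the laws via the \<open>L^p\<close> distance of the random variables. This is what
  makes Riemann sums and grid values of the integrand converge.\<close>

lemma coeff_path_continuous:
  fixes f :: "real \<Rightarrow> real ^ 'd \<Rightarrow> (real ^ 'd) measure \<Rightarrow> 'c::euclidean_space"
  assumes f: "hoelder_lipschitz T p \<rho> L L' norm f" and \<omega>: "\<omega> \<in> space M"
  shows "continuous_on {0..T} (\<lambda>s. f s (X s \<omega>) (law M (X s)))"
  unfolding continuous_on_sequentially comp_def
proof (intro allI ballI impI, elim conjE)
  fix x :: "nat \<Rightarrow> real" and a assume a: "a \<in> {0..T}" and x: "\<forall>n. x n \<in> {0..T}" and xa: "x \<longlonglongrightarrow> a"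
  let ?v = "\<lambda>n. mom (\<lambda>\<omega>. X (x n) \<omega> - X a \<omega>) powr (1 / p)"
  let ?C = "L' * (1 + R \<omega> + HR powr (1 / p))"
  have W: "wasserstein p (law M (X (x n))) (law M (X a)) \<le> ?v n" "wasserstein p (law M (X a)) (law M (X (x n))) \<le> ?v n" for n
    using a x wasserstein_law_le[OF X_Lp X_Lp p1, of "x n" a] wasserstein_law_le[OF X_Lp X_Lp p1, of a "x n"]
    by (auto intro!: powr_root_le simp: norm_minus_commute wasserstein_def)
  have le: "norm (f (x n) (X (x n) \<omega>) (law M (X (x n))) - f a (X a \<omega>) (law M (X a)))
     \<le> ?C * \<bar>x n - a\<bar> powr \<rho> + L * (norm (X (x n) \<omega> - X a \<omega>) + ?v n)" for n
  \<comment> \<open>The Hoelder condition orders the times and puts the growth factor at the later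
    one; \<open>R\<close> and \<open>HR\<close> bound that factor in either order.\<close>
  proof (cases "a \<le> x n")
    case True
    have ab: "\<bar>x n - a\<bar> = x n - a" using True by simp
    have "norm (f (x n) (X (x n) \<omega>) (law M (X (x n))) - f a (X a \<omega>) (law M (X a)))
      \<le> L' * (1 + norm (X (x n) \<omega>) + wasserstein p (law M (X (x n))) (return borel 0)) * (x n - a) powr \<rho>
        + L * (norm (X (x n) \<omega> - X a \<omega>) + wasserstein p (law M (X (x n))) (law M (X a)))"
      using a x True by (intro coeff_diff_le[OF f] X_Lp) auto
    also have "\<dots> \<le> ?C * \<bar>x n - a\<bar> powr \<rho> + L * (norm (X (x n) \<omega> - X a \<omega>) + ?v n)"
      unfolding ab using a x True L L' W X_le_R[OF \<omega>, of "x n"] wasserstein_X_zero_le[of "x n"]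
      by (intro add_mono mult_left_mono mult_right_mono) auto
    finally show ?thesis .
  next
    case False
    have ab: "\<bar>x n - a\<bar> = a - x n" using False by simp
    have "norm (f a (X a \<omega>) (law M (X a)) - f (x n) (X (x n) \<omega>) (law M (X (x n))))
      \<le> L' * (1 + norm (X a \<omega>) + wasserstein p (law M (X a)) (return borel 0)) * (a - x n) powr \<rho>
        + L * (norm (X a \<omega> - X (x n) \<omega>) + wasserstein p (law M (X a)) (law M (X (x n))))"
      using a x False by (intro coeff_diff_le[OF f] X_Lp) auto
    also have "\<dots> \<le> ?C * \<bar>x n - a\<bar> powr \<rho> + L * (norm (X (x n) \<omega> - X a \<omega>) + ?v n)"
      unfolding ab using a False L L' W X_le_R[OF \<omega>, of a] wasserstein_X_zero_le[of a]
      by (intro add_mono mult_left_mono mult_right_mono) (auto simp: norm_minus_commute)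
    finally show ?thesis by (simp add: norm_minus_commute)
  qed
  have "(\<lambda>n. ?C * \<bar>x n - a\<bar> powr \<rho> + L * (norm (X (x n) \<omega> - X a \<omega>) + ?v n)) \<longlonglongrightarrow> ?C * \<bar>a - a\<bar> powr \<rho> + L * (norm (X a \<omega> - X a \<omega>) + 0 powr (1 / p))"
  proof (intro tendsto_add tendsto_mult tendsto_norm tendsto_diff tendsto_const)
    show "(\<lambda>n. X (x n) \<omega>) \<longlonglongrightarrow> X a \<omega>"
      using a x xa by (intro continuous_on_tendsto_compose[OF X_cont[OF \<omega>]]) auto
    show "(\<lambda>n. \<bar>x n - a\<bar> powr \<rho>) \<longlonglongrightarrow> \<bar>a - a\<bar> powr \<rho>"
      using \<rho> xa by (intro tendsto_powr' tendsto_intros) auto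
    show "?v \<longlonglongrightarrow> 0 powr (1 / p)"
      using p a x xa by (intro tendsto_powr' tendsto_const X_Lp_continuous) (auto intro!: always_eventually mom_nonneg)
  qed
  then have lim: "(\<lambda>n. ?C * \<bar>x n - a\<bar> powr \<rho> + L * (norm (X (x n) \<omega> - X a \<omega>) + ?v n)) \<longlonglongrightarrow> 0" using \<rho> p by simp
  have "(\<lambda>n. f (x n) (X (x n) \<omega>) (law M (X (x n))) - f a (X a \<omega>) (law M (X a))) \<longlonglongrightarrow> 0"
    by (rule Lim_null_comparison[OF _ lim]) (use le in \<open>auto intro: always_eventually\<close>)
  then show "(\<lambda>n. f (x n) (X (x n) \<omega>) (law M (X (x n)))) \<longlonglongrightarrow> f a (X a \<omega>) (law M (X a))"
    by (rule LIM_zero_cancel)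
qed

section \<open>The solution as a limit of grid sums\<close>

definition \<beta>X where "\<beta>X n i = at_law b (G n i) (X (G n i))"
definition \<zeta>X where "\<zeta>X n i = at_law \<sigma> (G n i) (X (G n i))"

text \<open>Both parts rest on the same Ito integral \<open>J\<close> from the definition of a
  solution, which is obtained only inside this proof; hence the joint statement.\<close>

lemma X_init_approx: "(AE \<omega> in M. X 0 \<omega> = X0 \<omega>) \<and> ito_approx \<beta>X \<zeta>X X"
proof -
  obtain J where J: "has_ito_integral M F B T (\<lambda>s \<omega>. \<sigma> s (X s \<omega>) (law M (X s))) J"
    and XJ: "AE \<omega> in M. \<forall>t\<in>{0..T}. X t \<omega> = X0 \<omega> + (LINT s:{0..t}|lborel. b s (X s \<omega>) (law M (X s))) + J t \<omega>"
    using sol unfolding mckean_vlasov_solution_def by blast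
  let ?R = "\<lambda>\<omega>. K + L * R \<omega> + L * HR powr (1 / p)"
  interpret ito_integrand M F B p T N "\<lambda>s \<omega>. \<sigma> s (X s \<omega>) (law M (X s))" J ?R
  proof
    show "has_ito_integral M F B T (\<lambda>s \<omega>. \<sigma> s (X s \<omega>) (law M (X s))) J" by fact
    show "\<omega> \<in> space M \<Longrightarrow> continuous_on {0..T} (\<lambda>s. \<sigma> s (X s \<omega>) (law M (X s)))" for \<omega>
      by (rule coeff_path_continuous[OF hs])
    show "(\<lambda>\<omega>. \<sigma> s (X s \<omega>) (law M (X s))) \<in> borel_measurable (F s)" if "0 \<le> s" "s \<le> T" for s
      using that by (intro coeffs_adapted(2) X_Lp X_adapted) auto
    show "?R \<in> borel_measurable M" by measurable
    have R0: "0 \<le> ?R \<omega>" for \<omega> using K_nonneg L R_nonneg by simp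
    show "integrable M (\<lambda>\<omega>. (?R \<omega>)\<^sup>2)"
    proof (rule Bochner_Integration.integrable_bound)
      show "integrable M (\<lambda>\<omega>. 1 + 3 powr p * (K powr p + L powr p * R \<omega> powr p + (L * HR powr (1 / p)) powr p))"
        using R_integrable by simp
      show "AE \<omega> in M. norm ((?R \<omega>)\<^sup>2) \<le> norm (1 + 3 powr p * (K powr p + L powr p * R \<omega> powr p + (L * HR powr (1 / p)) powr p))"
      proof (rule AE_I2)
        fix \<omega>
        \<comment> \<open>Here \<open>p \<ge> 2\<close> enters: a square is at most one plus the
          \<open>p\<close>-th power.\<close>
        have "(?R \<omega>)\<^sup>2 = 1 powr (p - 2) * ?R \<omega> powr 2" using R0[of \<omega>] by simp
        also have "\<dots> \<le> 1 powr p + ?R \<omega> powr p" using p R0 by (intro powr_mult_powr_le) auto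
        also have "?R \<omega> powr p \<le> 3 powr p * (K powr p + (L * R \<omega>) powr p + (L * HR powr (1 / p)) powr p)"
          using K_nonneg L R_nonneg p0 by (intro powr_add3_le) auto
        finally have "(?R \<omega>)\<^sup>2 \<le> 1 + 3 powr p * (K powr p + L powr p * R \<omega> powr p + (L * HR powr (1 / p)) powr p)"
          using L R_nonneg by (simp add: powr_mult)
        then show "norm ((?R \<omega>)\<^sup>2) \<le> norm (1 + 3 powr p * (K powr p + L powr p * R \<omega> powr p + (L * HR powr (1 / p)) powr p))"
          by simp
      qed
    qed measurable
    fix \<omega> s assume \<omega>: "\<omega> \<in> space M" and s: "0 \<le> s" "s \<le> T"
    have "norm (\<sigma> s (X s \<omega>) (law M (X s)) - \<sigma> s 0 (law M (\<lambda>_. 0))) \<le> L * (norm (X s \<omega> - 0) + wasserstein p (law M (X s)) (law M (\<lambda>_. 0)))"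
      using coeff_diff_le[OF hs s(1) order.refl s(2) X_Lp[OF s] in_Lp_zero, of "X s \<omega>" 0] by simp
    also have "\<dots> \<le> L * (R \<omega> + HR powr (1 / p))"
      using L X_le_R[OF \<omega> s] wasserstein_X_zero_le[OF s] by (intro mult_left_mono add_mono) (auto simp: law_zero)
    finally show "norm (\<sigma> s (X s \<omega>) (law M (X s))) \<le> ?R \<omega>"
      using Ks[OF s] norm_triangle_ineq2[of "\<sigma> s (X s \<omega>) (law M (X s))" "\<sigma> s 0 (return borel 0)"]
      by (simp add: law_zero distrib_left)
  qed
  \<comment> \<open>That the integral starts at zero is read off from the grid sums, which are empty
    at time 0.\<close>
  have J0: "AE \<omega> in M. J 0 \<omega> = 0"
  proof -
    obtain r where "AE \<omega> in M. \<forall>i\<le>NN 0. (\<lambda>k. \<Sum>j<i * 2 ^ r k. \<sigma> (G (0 + r k) j) (X (G (0 + r k) j) \<omega>) (law M (X (G (0 + r k) j))) *v (B (G (0 + r k) (Suc j)) \<omega> - B (G (0 + r k) j) \<omega>)) \<longlonglongrightarrow> J (G 0 i) \<omega>"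
      using grid_sum_AE_subseq[of 0] by blast
    then show ?thesis
    proof eventually_elim
      case (elim \<omega>)
      from elim[rule_format, of 0] have "(\<lambda>k::nat. 0) \<longlonglongrightarrow> J 0 \<omega>" by simp
      then show ?case by (simp add: LIMSEQ_const_iff)
    qed
  qed
  have init: "AE \<omega> in M. X 0 \<omega> = X0 \<omega>"
    using XJ J0
  proof eventually_elim
    case (elim \<omega>)
    have "X 0 \<omega> = X0 \<omega> + (LINT s:{0..0}|lborel. b s (X s \<omega>) (law M (X s))) + J 0 \<omega>"
      using elim(1) T by auto
    moreover have "(LINT s:{0..0}|lborel. b s (X s \<omega>) (law M (X s))) = 0"
    proof -
      have "(LINT s:{0..0}|lborel. b s (X s \<omega>) (law M (X s))) = (LINT s|(lborel :: real measure). 0 :: real ^ 'd)"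
        unfolding set_lebesgue_integral_def
      proof (rule integral_cong_AE)
        show "(\<lambda>s. indicator {0..0} s *\<^sub>R b s (X s \<omega>) (law M (X s))) \<in> borel_measurable lborel"
        proof -
          have "(\<lambda>s. indicator {0..0} s *\<^sub>R b s (X s \<omega>) (law M (X s))) = (\<lambda>s. indicator {0} s *\<^sub>R b 0 (X 0 \<omega>) (law M (X 0)))"
            by (auto simp: indicator_def)
          then show ?thesis by simp
        qed
        show "AE s in lborel. indicator {0..0} s *\<^sub>R b s (X s \<omega>) (law M (X s)) = 0"
          using AE_lborel_singleton[of 0] by eventually_elim (auto simp: indicator_def)
      qed simp
      then show ?thesis by simp
    qed
    ultimately show ?case using elim(2) by simp
  qed
  have "ito_approx \<beta>X \<zeta>X X"
    unfolding ito_approx_def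
  proof (intro conjI allI)
    show "adapted_Lp \<beta>X" "adapted_Lp \<zeta>X"
      unfolding adapted_Lp_def \<beta>X_def \<zeta>X_def
      by (auto intro!: coeffs_adapted coeffs_growth X_Lp X_adapted G_nonneg G_le_T)
    fix n
    obtain r where r: "strict_mono r" and lim: "AE \<omega> in M. \<forall>i\<le>NN n. (\<lambda>k. \<Sum>j<i * 2 ^ r k. \<zeta>X (n + r k) j \<omega> *v (B (G (n + r k) (Suc j)) \<omega> - B (G (n + r k) j) \<omega>)) \<longlonglongrightarrow> J (G n i) \<omega>"
      using grid_sum_AE_subseq[of n] unfolding \<zeta>X_def by blast
    have "AE \<omega> in M. \<forall>i\<le>NN n. (\<lambda>k. gsum \<beta>X \<zeta>X (n + r k) (i * 2 ^ r k) \<omega>) \<longlonglongrightarrow> X (G n i) \<omega> - X 0 \<omega>"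
      using lim XJ init AE_space
    proof eventually_elim
      case (elim \<omega>)
      show ?case
      proof (intro allI impI)
        fix i assume i: "i \<le> NN n"
        have "(\<lambda>k. \<Sum>j<i * 2 ^ k. dt (n + k) *\<^sub>R \<beta>X (n + k) j \<omega>) \<longlonglongrightarrow> (LINT s:{0..G n i}|lborel. b s (X s \<omega>) (law M (X s)))"
          unfolding \<beta>X_def using riemann_sum_tendsto[OF coeff_path_continuous[OF hb elim(4)] i] .
        \<comment> \<open>The Riemann sums converge along the full sequence, hence also along the
          subsequence imposed by the noise.\<close>
        from tendsto_add[OF LIMSEQ_subseq_LIMSEQ[OF this r, unfolded comp_def] elim(1)[rule_format, OF i]]
        have "(\<lambda>k. gsum \<beta>X \<zeta>X (n + r k) (i * 2 ^ r k) \<omega>) \<longlonglongrightarrow> (LINT s:{0..G n i}|lborel. b s (X s \<omega>) (law M (X s))) + J (G n i) \<omega>"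
          unfolding gsum_def sum.distrib .
        moreover have "X (G n i) \<omega> = X0 \<omega> + (LINT s:{0..G n i}|lborel. b s (X s \<omega>) (law M (X s))) + J (G n i) \<omega>"
          using elim(2) G_nonneg G_le_T[OF i] by auto
        ultimately show "(\<lambda>k. gsum \<beta>X \<zeta>X (n + r k) (i * 2 ^ r k) \<omega>) \<longlonglongrightarrow> X (G n i) \<omega> - X 0 \<omega>"
          using elim(3) by (simp add: algebra_simps)
      qed
    qed
    with r show "\<exists>r. strict_mono r \<and> (AE \<omega> in M. \<forall>i\<le>NN n. (\<lambda>k. gsum \<beta>X \<zeta>X (n + r k) (i * 2 ^ r k) \<omega>) \<longlonglongrightarrow> X (G n i) \<omega> - X 0 \<omega>)" by blast
  qed
  with init show ?thesis by blast
qed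

lemmas X_init = X_init_approx[THEN conjunct1] and X_approx = X_init_approx[THEN conjunct2]

lemma mom_X_init: "mom (X 0) = mom X0"
  using X_init X_meas[of 0] T in_Lp_measurable[OF X0_Lp] by (intro integral_cong_AE) auto

end

section \<open>The Euler scheme and its error\<close>

context mckean_vlasov
begin

lemma G0: "G 0 m = real m * T / real N" by (simp add: G_def dt_def)
lemma NN0: "NN 0 = N" by (simp add: NN_def)

lemma Xb_0: "\<omega> \<in> space M \<Longrightarrow> Xb 0 \<omega> = X0 \<omega>"
  using eul by (simp add: euler_scheme_def)

lemma Xb_step:
  assumes "m < N" "G 0 m \<le> t" "t \<le> G 0 (Suc m)" "\<omega> \<in> space M"
  shows "Xb t \<omega> = Xb (G 0 m) \<omega> + (t - G 0 m) *\<^sub>R at_law b (G 0 m) (Xb (G 0 m)) \<omega>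
     + at_law \<sigma> (G 0 m) (Xb (G 0 m)) \<omega> *v (B t \<omega> - B (G 0 m) \<omega>)"
  using assms(2,3) unfolding G0
  by (intro eul[unfolded euler_scheme_def Let_def, THEN conjunct2, rule_format, OF assms(1) _ assms(4)]) simp

text \<open>Adaptedness and moments propagate through one Euler step, including times strictly
  inside it, since the refined grids visit those too.\<close>

lemma Xb_block:
  assumes m: "m < N" and Xm: "Xb (G 0 m) \<in> borel_measurable (F (G 0 m))" "in_Lp M p (Xb (G 0 m))"
    and t: "G 0 m \<le> t" "t \<le> G 0 (Suc m)"
  shows "Xb t \<in> borel_measurable (F t)" "in_Lp M p (Xb t)"
proof -
  have mT: "0 \<le> G 0 m" "G 0 m \<le> T" using m by (auto intro: G_nonneg G_le_T simp: NN0)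
  have t0: "0 \<le> t" using mT t by simp
  note c = coeffs_growth[OF mT Xm(2)] and ca = coeffs_adapted[OF mT Xm(2,1)]
  let ?f = "\<lambda>\<omega>. Xb (G 0 m) \<omega> + (t - G 0 m) *\<^sub>R at_law b (G 0 m) (Xb (G 0 m)) \<omega>
     + at_law \<sigma> (G 0 m) (Xb (G 0 m)) \<omega> *v (B t \<omega> - B (G 0 m) \<omega>)"
  have eq: "Xb t \<omega> = ?f \<omega>" if "\<omega> \<in> space M" for \<omega> by (rule Xb_step[OF m t that])
  have "?f \<in> borel_measurable (F t)"
    by (intro borel_measurable_add borel_measurable_scaleR borel_measurable_const borel_measurable_matrix_vector_mult
        borel_measurable_diff ca(1)[OF t(1)] ca(2)[OF t(1)] B_meas[OF mT(1) t(1)] B_meas[OF t0 order.refl]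
        measurable_F_mono[OF Xm(1) mT(1) t(1)])
  then show "Xb t \<in> borel_measurable (F t)"
    by (rule measurable_cong[THEN iffD1, rotated]) (simp add: eq space_F[OF t0])
  have "in_Lp M p ?f"
    using p by (intro in_Lp_add in_Lp_scaleR Xm(2) c noise_in_Lp[OF mT(1) t(1) ca(2)[OF order.refl] c(2)]) auto
  moreover have "in_Lp M p (Xb t) \<longleftrightarrow> in_Lp M p ?f"
    unfolding in_Lp_def
    by (intro conj_cong measurable_cong Bochner_Integration.integrable_cong refl) (simp_all add: eq)
  ultimately show "in_Lp M p (Xb t)" by simp
qed

lemma Xb_coarse: "m \<le> N \<Longrightarrow> Xb (G 0 m) \<in> borel_measurable (F (G 0 m)) \<and> in_Lp M p (Xb (G 0 m))"
proof (induction m)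
  case 0
  have "Xb 0 \<in> borel_measurable (F 0)"
    using X0_adapted by (rule measurable_cong[THEN iffD1, rotated]) (simp add: Xb_0 space_F)
  moreover have "in_Lp M p (Xb 0) \<longleftrightarrow> in_Lp M p X0"
    unfolding in_Lp_def
    by (intro conj_cong measurable_cong Bochner_Integration.integrable_cong refl) (simp_all add: Xb_0)
  ultimately show ?case using X0_Lp by simp
next
  case (Suc m)
  then show ?case using Xb_block[of m "G 0 (Suc m)"] G_mono[of m "Suc m" 0] by auto
qed

text \<open>The Euler step that contains step \<open>j\<close> of grid \<open>n\<close>.\<close>

definition eta :: "nat \<Rightarrow> nat \<Rightarrow> nat" where "eta n j = j div 2 ^ n"

lemma eta_less: "j < NN n \<Longrightarrow> eta n j < N"
  by (simp add: eta_def NN_def less_mult_imp_div_less)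

lemma eta_bounds: "G 0 (eta n j) \<le> G n j" "G n (Suc j) \<le> G 0 (Suc (eta n j))"
proof -
  have r: "G 0 m = G n (m * 2 ^ n)" for m using G_refine[of 0 n m] by simp
  show "G 0 (eta n j) \<le> G n j" unfolding r eta_def by (intro G_mono) simp
  have "j < Suc (j div 2 ^ n) * 2 ^ n"
    using dividend_less_div_times[of "2 ^ n" j] by simp
  then show "G n (Suc j) \<le> G 0 (Suc (eta n j))" unfolding r eta_def by (intro G_mono) simp
qed

lemma eta_T: "j < NN n \<Longrightarrow> 0 \<le> G 0 (eta n j) \<and> G 0 (eta n j) \<le> T"
  using eta_less[of j n] by (auto intro!: G_nonneg G_le_T simp: NN0)

lemma Xb_eta: "j < NN n \<Longrightarrow> Xb (G 0 (eta n j)) \<in> borel_measurable (F (G 0 (eta n j)))"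
    "j < NN n \<Longrightarrow> in_Lp M p (Xb (G 0 (eta n j)))"
  using Xb_coarse[of "eta n j"] eta_less[of j n] by auto

lemma Xb_Lp: "0 \<le> t \<Longrightarrow> t \<le> T \<Longrightarrow> in_Lp M p (Xb t)"
proof (cases "t = 0")
  case True
  then show ?thesis using Xb_coarse[of 0] by simp
next
  case False
  assume t: "0 \<le> t" "t \<le> T"
  with False have t0: "0 < t" by simp
  have "cl 0 t < N"
    using cl_bounds(1)[OF t0, of 0] t(2) G_mono[of N "cl 0 t" 0] G_NN[of 0] unfolding NN0 by linarith
  then show ?thesis
    using Xb_block(2)[of "cl 0 t" t] Xb_coarse[of "cl 0 t"] cl_bounds[OF t0, of 0] by auto
qed

definition \<beta>E where "\<beta>E n j = at_law b (G 0 (eta n j)) (Xb (G 0 (eta n j)))"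
definition \<zeta>E where "\<zeta>E n j = at_law \<sigma> (G 0 (eta n j)) (Xb (G 0 (eta n j)))"

lemma euler_adapted: "adapted_Lp \<beta>E" "adapted_Lp \<zeta>E"
  unfolding adapted_Lp_def \<beta>E_def \<zeta>E_def
  using eta_T eta_bounds Xb_eta by (auto intro!: coeffs_adapted coeffs_growth)

text \<open>The Euler coefficients are constant over an Euler step, so on every refinement the sums
  telescope to the scheme without error.\<close>

lemma euler_gsum: "i \<le> NN n \<Longrightarrow> \<omega> \<in> space M \<Longrightarrow> gsum \<beta>E \<zeta>E n i \<omega> = Xb (G n i) \<omega> - Xb 0 \<omega>"
proof (induction i)
  case 0
  then show ?case by (simp add: gsum_def)
next
  case (Suc j)
  let ?m = "eta n j"
  have m: "?m < N" using Suc by (intro eta_less) simp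
  have b1: "G n j \<le> G 0 (Suc ?m)" using eta_bounds(2)[of n j] G_mono[of j "Suc j" n] by simp
  have b2: "G 0 ?m \<le> G n (Suc j)" using eta_bounds(1)[of n j] G_mono[of j "Suc j" n] by simp
  note e1 = Xb_step[OF m eta_bounds(1) b1 Suc.prems(2)] and e2 = Xb_step[OF m b2 eta_bounds(2) Suc.prems(2)]
  have step: "Xb (G n (Suc j)) \<omega> - Xb (G n j) \<omega> = dt n *\<^sub>R \<beta>E n j \<omega> + \<zeta>E n j \<omega> *v (B (G n (Suc j)) \<omega> - B (G n j) \<omega>)"
    unfolding e1 e2 \<beta>E_def \<zeta>E_def
    by (simp add: G_Suc matrix_vector_mult_diff_distrib algebra_simps)
  have "gsum \<beta>E \<zeta>E n (Suc j) \<omega> = gsum \<beta>E \<zeta>E n j \<omega> + (Xb (G n (Suc j)) \<omega> - Xb (G n j) \<omega>)"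
    unfolding step by (simp only: gsum_def sum.lessThan_Suc)
  also have "gsum \<beta>E \<zeta>E n j \<omega> = Xb (G n j) \<omega> - Xb 0 \<omega>" using Suc by simp
  finally show ?case by simp
qed

lemma euler_approx: "ito_approx \<beta>E \<zeta>E Xb"
  unfolding ito_approx_def
proof (intro conjI allI euler_adapted)
  fix n
  have "AE \<omega> in M. \<forall>i\<le>NN n. (\<lambda>k. gsum \<beta>E \<zeta>E (n + id k) (i * 2 ^ id k) \<omega>) \<longlonglongrightarrow> Xb (G n i) \<omega> - Xb 0 \<omega>"
  proof (intro AE_I2 allI impI)
    fix \<omega> i assume "\<omega> \<in> space M" "i \<le> NN n"
    then have "gsum \<beta>E \<zeta>E (n + k) (i * 2 ^ k) \<omega> = Xb (G n i) \<omega> - Xb 0 \<omega>" for k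
      using euler_gsum[of "i * 2 ^ k" "n + k" \<omega>] by (simp add: NN_refine G_refine)
    then show "(\<lambda>k. gsum \<beta>E \<zeta>E (n + id k) (i * 2 ^ id k) \<omega>) \<longlonglongrightarrow> Xb (G n i) \<omega> - Xb 0 \<omega>" by simp
  qed
  moreover have "strict_mono (id :: nat \<Rightarrow> nat)" by (simp add: strict_mono_def)
  ultimately show "\<exists>r. strict_mono r \<and> (AE \<omega> in M. \<forall>i\<le>NN n. (\<lambda>k. gsum \<beta>E \<zeta>E (n + r k) (i * 2 ^ r k) \<omega>) \<longlonglongrightarrow> Xb (G n i) \<omega> - Xb 0 \<omega>)"
    by (intro exI[of _ id] conjI)
qed

text \<open>The scheme inherits continuity from the Brownian path step by step, hence only almost
  surely.\<close>

lemma Xb_cont: "AE \<omega> in M. continuous_on {0..T} (\<lambda>t. Xb t \<omega>)"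
  using B_cont AE_space
proof eventually_elim
  case (elim \<omega>)
  have "continuous_on {0..G 0 m} (\<lambda>t. Xb t \<omega>)" if "m \<le> N" for m
    using that
  proof (induction m)
    case (Suc m)
    have "continuous_on {G 0 m..G 0 (Suc m)} (\<lambda>t. Xb (G 0 m) \<omega> + (t - G 0 m) *\<^sub>R at_law b (G 0 m) (Xb (G 0 m)) \<omega>
     + at_law \<sigma> (G 0 m) (Xb (G 0 m)) \<omega> *v (B t \<omega> - B (G 0 m) \<omega>))"
      using G_nonneg[of 0 m]
      by (intro continuous_intros bounded_bilinear.continuous_on[OF bounded_bilinear_matrix_vector_mult] continuous_on_subset[OF elim(1)]) auto
    then have "continuous_on {G 0 m..G 0 (Suc m)} (\<lambda>t. Xb t \<omega>)"
    proof (rule continuous_on_eq)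
      fix t assume "t \<in> {G 0 m..G 0 (Suc m)}"
      then show "Xb (G 0 m) \<omega> + (t - G 0 m) *\<^sub>R at_law b (G 0 m) (Xb (G 0 m)) \<omega>
        + at_law \<sigma> (G 0 m) (Xb (G 0 m)) \<omega> *v (B t \<omega> - B (G 0 m) \<omega>) = Xb t \<omega>"
        using Suc.prems elim(2) by (intro Xb_step[symmetric]) auto
    qed
    then have "continuous_on ({0..G 0 m} \<union> {G 0 m..G 0 (Suc m)}) (\<lambda>t. Xb t \<omega>)"
      using Suc by (intro continuous_on_closed_Un) auto
    moreover have "{0..G 0 m} \<union> {G 0 m..G 0 (Suc m)} = {0..G 0 (Suc m)}"
      using G_nonneg[of 0 m] G_mono[of m "Suc m" 0] by auto
    ultimately show ?case by simp
  qed simp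
  from this[of N] show ?case using G_NN[of 0] by (simp add: NN0)
qed

section \<open>Moment bounds for the solution and the scheme\<close>

abbreviation "SC \<equiv> sup_const q p T c1"

lemma X_sup_bound: "(\<integral>\<^sup>+\<omega>. ennreal_powr (sup_norm {0..T} X \<omega>) p \<partial>M) \<le> ennreal (SC * (mom X0 + c0))"
proof -
  have "(\<integral>\<^sup>+\<omega>. ennreal_powr (sup_norm {0..T} X \<omega>) p \<partial>M) \<le> ennreal (SC * (mom (X 0) + c0))"
  proof (rule approx_sup_bound[OF X_approx _ _ c0_nonneg c1_nonneg, folded q])
    show "in_Lp M p (X (G n i))" "mom (X (G n i)) \<le> HR" if "i \<le> NN n" for n i
      using that by (auto intro!: X_Lp mom_X_le G_nonneg G_le_T)
    show "AE \<omega> in M. continuous_on {0..T} (\<lambda>t. X t \<omega>)" using X_cont by (rule AE_I2)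
    fix l Q :: real and n i :: nat
    assume Q: "\<And>n i. i \<le> NN n \<Longrightarrow> mom (X (G n i)) \<le> Q * exp (l * G n i)" and i: "i < NN n"
    have "mom (\<beta>X n i) + mom (\<zeta>X n i) \<le> c0 + c1 * mom (X (G n i))"
      unfolding \<beta>X_def \<zeta>X_def using i by (intro coeffs_growth X_Lp G_nonneg G_le_T) auto
    also have "\<dots> \<le> c0 + c1 * (Q * exp (l * G n i))"
      using i by (intro add_left_mono mult_left_mono Q c1_nonneg) auto
    finally show "mom (\<beta>X n i) + mom (\<zeta>X n i) \<le> c0 + c1 * (Q * exp (l * G n i))" .
  qed
  then show ?thesis by (simp add: mom_X_init)
qed

text \<open>The finiteness that the closing argument presupposes. Only \<open>N\<close> different
  coefficients occur on all grids together, so the sum of their moments gives a bound; it depends on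
  \<open>N\<close> but drops out afterwards.\<close>

lemma Xb_fin: "\<exists>H. \<forall>n i. i \<le> NN n \<longrightarrow> mom (Xb (G n i)) \<le> H"
proof -
  define S where "S = T * (\<Sum>m<N. mom (at_law b (G 0 m) (Xb (G 0 m))) + mom (at_law \<sigma> (G 0 m) (Xb (G 0 m))))"
  have S0: "0 \<le> S" unfolding S_def using T by (intro mult_nonneg_nonneg sum_nonneg add_nonneg_nonneg mom_nonneg) auto
  have S: "(\<Sum>l\<in>{0 * 2^k..<i * 2^k}. dt (n + k) * (mom (\<beta>E (n + k) l) + mom (\<zeta>E (n + k) l))) \<le> S"
    if i: "i \<le> NN n" for n i k
  proof -
    have "(\<Sum>l\<in>{0 * 2^k..<i * 2^k}. dt (n + k) * (mom (\<beta>E (n + k) l) + mom (\<zeta>E (n + k) l)))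
      \<le> (\<Sum>l\<in>{0 * 2^k..<i * 2^k}. dt (n + k) * (S / T))"
    proof (intro sum_mono mult_left_mono)
      fix l assume "l \<in> {0 * 2^k..<i * 2^k}"
      then have "l < NN (n + k)" using i by (simp add: NN_refine) (meson mult_le_mono1 order_less_le_trans)
      then have "eta (n + k) l \<in> {..<N}" using eta_less by simp
      then have "mom (\<beta>E (n + k) l) + mom (\<zeta>E (n + k) l) \<le> (\<Sum>m<N. mom (at_law b (G 0 m) (Xb (G 0 m))) + mom (at_law \<sigma> (G 0 m) (Xb (G 0 m))))"
        unfolding \<beta>E_def \<zeta>E_def by (rule member_le_sum) (auto intro!: add_nonneg_nonneg mom_nonneg)
      then show "mom (\<beta>E (n + k) l) + mom (\<zeta>E (n + k) l) \<le> S / T" using T by (simp add: S_def)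
    qed (use dt_pos less_imp_le in auto)
    also have "\<dots> = G (n + k) (i * 2 ^ k) * (S / T)" by (simp add: G_def)
    also have "\<dots> \<le> T * (S / T)" using G_le_T[OF i] S0 T by (intro mult_right_mono) (auto simp: G_refine)
    finally show ?thesis using T by simp
  qed
  define Q where "Q = incr_const CARD('q) p T * (T powr (p / 2 - 1) * S)"
  have Q0: "0 \<le> Q" using S0 p by (simp add: Q_def incr_const_nonneg)
  have "mom (Xb (G n i)) \<le> 2 powr p * (mom (Xb 0) + Q)" if i: "i \<le> NN n" for n i
  proof -
    have Lp: "in_Lp M p (Xb 0)" "in_Lp M p (\<lambda>\<omega>. Xb (G n i) \<omega> - Xb 0 \<omega>)"
      using T i p0 by (auto intro!: in_Lp_diff Xb_Lp G_nonneg G_le_T)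
    have "(\<integral>\<^sup>+\<omega>. ennreal (norm (Xb (G n i) \<omega> - Xb 0 \<omega>) powr p) \<partial>M)
       \<le> (\<integral>\<^sup>+\<omega>. ennreal (runmax (\<lambda>l. norm (Xb (G n (0 + l)) \<omega> - Xb (G n 0) \<omega>)) (i - 0) powr p) \<partial>M)"
    proof (intro nn_integral_mono ennreal_leI powr_mono2)
      show "norm (Xb (G n i) \<omega> - Xb 0 \<omega>) \<le> runmax (\<lambda>l. norm (Xb (G n (0 + l)) \<omega> - Xb (G n 0) \<omega>)) (i - 0)" for \<omega>
        using le_runmax[of i i "\<lambda>l. norm (Xb (G n l) \<omega> - Xb 0 \<omega>)"] by simp
    qed (use p in auto)
    also have "\<dots> \<le> ennreal Q"
      unfolding Q_def using G_le_T[OF i] by (intro approx_incr_bound[OF euler_approx le0 i _ T order.refl S[OF i]]) simp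
    finally have d: "mom (\<lambda>\<omega>. Xb (G n i) \<omega> - Xb 0 \<omega>) \<le> Q" using Q0 by (rule mom_le_of_nn)
    have "mom (Xb (G n i)) \<le> 2 powr p * (mom (Xb 0) + mom (\<lambda>\<omega>. Xb (G n i) \<omega> - Xb 0 \<omega>))"
      using mom_add_le[OF Lp] by simp
    also have "\<dots> \<le> 2 powr p * (mom (Xb 0) + Q)" using d by (intro mult_left_mono add_left_mono) auto
    finally show ?thesis .
  qed
  then show ?thesis by blast
qed

lemma mom_Xb_init: "mom (Xb 0) = mom X0"
  by (intro Bochner_Integration.integral_cong) (auto simp: Xb_0)

lemma euler_coeffs: "j < NN n \<Longrightarrow> mom (\<beta>E n j) + mom (\<zeta>E n j) \<le> c0 + c1 * mom (Xb (G 0 (eta n j)))"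
  unfolding \<beta>E_def \<zeta>E_def using eta_T Xb_eta by (intro coeffs_growth) auto

lemma Xb_sup_bound: "(\<integral>\<^sup>+\<omega>. ennreal_powr (sup_norm {0..T} Xb \<omega>) p \<partial>M) \<le> ennreal (SC * (mom X0 + c0))"
proof -
  obtain H where H: "\<And>n i. i \<le> NN n \<Longrightarrow> mom (Xb (G n i)) \<le> H" using Xb_fin by blast
  have "(\<integral>\<^sup>+\<omega>. ennreal_powr (sup_norm {0..T} Xb \<omega>) p \<partial>M) \<le> ennreal (SC * (mom (Xb 0) + c0))"
  proof (rule approx_sup_bound[OF euler_approx _ _ c0_nonneg c1_nonneg Xb_cont, folded q])
    show "in_Lp M p (Xb (G n i))" "mom (Xb (G n i)) \<le> H" if "i \<le> NN n" for n i
      using that by (auto intro!: Xb_Lp G_nonneg G_le_T H)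
    fix l Q :: real and n i :: nat
    assume l: "0 \<le> l" "0 \<le> Q" and Q: "\<And>n i. i \<le> NN n \<Longrightarrow> mom (Xb (G n i)) \<le> Q * exp (l * G n i)" and i: "i < NN n"
    have "mom (Xb (G 0 (eta n i))) \<le> Q * exp (l * G 0 (eta n i))"
      using eta_less[OF i] by (intro Q) (simp add: NN0)
    \<comment> \<open>The scheme looks back to the start of its Euler step; as the weight increases
      in time, the bound at the earlier point implies the one required here.\<close>
    also have "\<dots> \<le> Q * exp (l * G n i)"
      using l eta_bounds(1)[of n i] by (simp add: mult_left_mono)
    finally have "c0 + c1 * mom (Xb (G 0 (eta n i))) \<le> c0 + c1 * (Q * exp (l * G n i))"
      using c1_nonneg by (simp add: mult_left_mono)
    with euler_coeffs[OF i] show "mom (\<beta>E n i) + mom (\<zeta>E n i) \<le> c0 + c1 * (Q * exp (l * G n i))" by simp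
  qed
  then show ?thesis by (simp add: mom_Xb_init)
qed

definition mom_bound :: real where "mom_bound = SC * (mom X0 + c0)"

lemma mom_le_sup:
  assumes U: "(\<integral>\<^sup>+\<omega>. ennreal_powr (sup_norm {0..T} U \<omega>) p \<partial>M) \<le> ennreal mom_bound" and t: "0 \<le> t" "t \<le> T"
    and SC: "0 \<le> mom_bound"
  shows "mom (U t) \<le> mom_bound"
proof (rule mom_le_of_nn[OF _ SC])
  have "(\<integral>\<^sup>+\<omega>. ennreal (norm (U t \<omega>) powr p) \<partial>M) \<le> (\<integral>\<^sup>+\<omega>. ennreal_powr (sup_norm {0..T} U \<omega>) p \<partial>M)"
  proof (rule nn_integral_mono)
    fix \<omega>
    have le: "ennreal (norm (U t \<omega>)) \<le> sup_norm {0..T} U \<omega>"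
      unfolding sup_norm_def using t by (intro SUP_upper) auto
    show "ennreal (norm (U t \<omega>) powr p) \<le> ennreal_powr (sup_norm {0..T} U \<omega>) p"
    proof (cases "sup_norm {0..T} U \<omega>")
      case (real r)
      then show ?thesis using le p by (auto simp: ennreal_powr_ennreal intro!: ennreal_leI powr_mono2)
    qed (simp add: ennreal_powr_def)
  qed
  also note U
  finally show "(\<integral>\<^sup>+\<omega>. ennreal (norm (U t \<omega>) powr p) \<partial>M) \<le> ennreal mom_bound" .
qed

lemma sup_const_nonneg: "0 \<le> c \<Longrightarrow> 0 \<le> sup_const q p T c"
  using p T by (simp add: sup_const_def Let_def incr_const_nonneg)

lemma mom_bound_nonneg: "0 \<le> mom_bound"
  unfolding mom_bound_def using sup_const_nonneg[OF c1_nonneg] c0_nonneg mom_nonneg[of X0] by simp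

lemma mom_X_bound: "0 \<le> t \<Longrightarrow> t \<le> T \<Longrightarrow> mom (X t) \<le> mom_bound"
  and mom_Xb_bound: "0 \<le> t \<Longrightarrow> t \<le> T \<Longrightarrow> mom (Xb t) \<le> mom_bound"
  by (rule mom_le_sup[OF X_sup_bound[folded mom_bound_def] _ _ mom_bound_nonneg],
      assumption, assumption,
      rule mom_le_sup[OF Xb_sup_bound[folded mom_bound_def] _ _ mom_bound_nonneg])

abbreviation "IC \<equiv> incr_const q p T * (c0 + c1 * mom_bound)"

lemma X_increment:
  assumes "0 \<le> s" "s \<le> t" "t \<le> T"
  shows "(\<integral>\<^sup>+\<omega>. ennreal (norm (X t \<omega> - X s \<omega>) powr p) \<partial>M) \<le> ennreal (IC * (t - s) powr (p / 2))"
proof (rule approx_increment[OF X_approx _ _ _ assms, folded q])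
  show "in_Lp M p (X (G n i))" if "i \<le> NN n" for n i
    using that by (auto intro!: X_Lp G_nonneg G_le_T)
  show "AE \<omega> in M. continuous_on {0..T} (\<lambda>t. X t \<omega>)" using X_cont by (rule AE_I2)
  fix n i assume i: "i < NN n"
  have "mom (\<beta>X n i) + mom (\<zeta>X n i) \<le> c0 + c1 * mom (X (G n i))"
    unfolding \<beta>X_def \<zeta>X_def using i by (intro coeffs_growth X_Lp G_nonneg G_le_T) auto
  also have "\<dots> \<le> c0 + c1 * mom_bound"
    using i by (intro add_left_mono mult_left_mono mom_X_bound c1_nonneg G_nonneg G_le_T) auto
  finally show "mom (\<beta>X n i) + mom (\<zeta>X n i) \<le> c0 + c1 * mom_bound" .
qed

lemma Xb_increment:
  assumes "0 \<le> s" "s \<le> t" "t \<le> T"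
  shows "(\<integral>\<^sup>+\<omega>. ennreal (norm (Xb t \<omega> - Xb s \<omega>) powr p) \<partial>M) \<le> ennreal (IC * (t - s) powr (p / 2))"
proof (rule approx_increment[OF euler_approx _ Xb_cont _ assms, folded q])
  show "in_Lp M p (Xb (G n i))" if "i \<le> NN n" for n i
    using that by (auto intro!: Xb_Lp G_nonneg G_le_T)
  fix n i assume i: "i < NN n"
  have "c0 + c1 * mom (Xb (G 0 (eta n i))) \<le> c0 + c1 * mom_bound"
    using i eta_T by (intro add_left_mono mult_left_mono mom_Xb_bound c1_nonneg) auto
  with euler_coeffs[OF i] show "mom (\<beta>E n i) + mom (\<zeta>E n i) \<le> c0 + c1 * mom_bound" by simp
qed

lemma IC_nonneg: "0 \<le> IC"
  using incr_const_nonneg[OF p0] c0_nonneg c1_nonneg mom_bound_nonneg by simp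

section \<open>The error of the scheme\<close>

definition h :: real where "h = T / real N"

lemma h: "0 < h" "h \<le> T"
  using T N by (auto simp: h_def divide_le_eq)

text \<open>Twice the terms of \<open>coeff_diff_moment\<close>, for the two coefficients, with the
  moment increment of the scheme over one step inserted. The base 8 is the 4 from there times the 2
  of one further splitting.\<close>

definition err :: real where
  "err = 2 * 6 powr p * L' powr p * (1 + 2 * mom_bound) * h powr (\<rho> * p) + 4 * 8 powr p * L powr p * (IC * h powr (p / 2))"

definition c2 :: real where "c2 = 4 * 8 powr p * L powr p"

lemma diff_coeff:
  fixes f :: "real \<Rightarrow> real ^ 'd \<Rightarrow> (real ^ 'd) measure \<Rightarrow> 'c::euclidean_space"
  assumes f: "hoelder_lipschitz T p \<rho> L L' norm f" and j: "j < NN n"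
  shows "mom (\<lambda>\<omega>. f (G n j) (X (G n j) \<omega>) (law M (X (G n j))) - f (G 0 (eta n j)) (Xb (G 0 (eta n j)) \<omega>) (law M (Xb (G 0 (eta n j)))))
    \<le> err / 2 + c2 / 2 * mom (\<lambda>\<omega>. X (G n j) \<omega> - Xb (G n j) \<omega>)"
proof -
  let ?t = "G n j" and ?s = "G 0 (eta n j)"
  have t: "0 \<le> ?t" "?t \<le> T" using j by (auto intro!: G_nonneg G_le_T)
  have s: "0 \<le> ?s" "?s \<le> T" using eta_T[OF j] by auto
  have st: "?s \<le> ?t" by (rule eta_bounds)
  have "?t \<le> G 0 (Suc (eta n j))" using eta_bounds(2)[of n j] G_mono[of j "Suc j" n] by simp
  then have ts: "?t - ?s \<le> h" by (simp add: G_Suc h_def dt_def)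
  have d: "mom (\<lambda>\<omega>. X ?t \<omega> - Xb ?s \<omega>) \<le> 2 powr p * (mom (\<lambda>\<omega>. X ?t \<omega> - Xb ?t \<omega>) + IC * h powr (p / 2))"
  proof -
    have "mom (\<lambda>\<omega>. X ?t \<omega> - Xb ?s \<omega>) = mom (\<lambda>\<omega>. (X ?t \<omega> - Xb ?t \<omega>) + (Xb ?t \<omega> - Xb ?s \<omega>))" by simp
    also have "\<dots> \<le> 2 powr p * (mom (\<lambda>\<omega>. X ?t \<omega> - Xb ?t \<omega>) + mom (\<lambda>\<omega>. Xb ?t \<omega> - Xb ?s \<omega>))"
      by (intro mom_add_le in_Lp_diff X_Lp Xb_Lp t s p0)
    also have "mom (\<lambda>\<omega>. Xb ?t \<omega> - Xb ?s \<omega>) \<le> IC * (?t - ?s) powr (p / 2)"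
      using IC_nonneg by (intro mom_le_of_nn Xb_increment s st t) simp
    also have "\<dots> \<le> IC * h powr (p / 2)"
      using IC_nonneg st ts p by (intro mult_left_mono powr_mono2) auto
    finally show ?thesis by simp
  qed
  have "mom (\<lambda>\<omega>. f ?t (X ?t \<omega>) (law M (X ?t)) - f ?s (Xb ?s \<omega>) (law M (Xb ?s)))
    \<le> 6 powr p * L' powr p * (1 + 2 * mom (X ?t)) * (?t - ?s) powr (\<rho> * p)
      + 2 * 4 powr p * L powr p * mom (\<lambda>\<omega>. X ?t \<omega> - Xb ?s \<omega>)"
    by (rule coeff_diff_moment[OF f s(1) st t(2) X_Lp[OF t] Xb_Lp[OF s] p1 L L'])
  also have "\<dots> \<le> 6 powr p * L' powr p * (1 + 2 * mom_bound) * h powr (\<rho> * p)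
      + 2 * 4 powr p * L powr p * (2 powr p * (mom (\<lambda>\<omega>. X ?t \<omega> - Xb ?t \<omega>) + IC * h powr (p / 2)))"
    using ts st p \<rho> mom_X_bound[OF t] mom_bound_nonneg
    by (intro add_mono mult_mono mult_left_mono d powr_mono2) auto
  also have "\<dots> = 6 powr p * L' powr p * (1 + 2 * mom_bound) * h powr (\<rho> * p)
      + 2 * (4 powr p * 2 powr p) * L powr p * (mom (\<lambda>\<omega>. X ?t \<omega> - Xb ?t \<omega>) + IC * h powr (p / 2))"
    by simp
  also have "4 powr p * 2 powr p = 8 powr p" by (simp flip: powr_mult)
  also have "6 powr p * L' powr p * (1 + 2 * mom_bound) * h powr (\<rho> * p)
      + 2 * 8 powr p * L powr p * (mom (\<lambda>\<omega>. X ?t \<omega> - Xb ?t \<omega>) + IC * h powr (p / 2))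
    = err / 2 + c2 / 2 * mom (\<lambda>\<omega>. X ?t \<omega> - Xb ?t \<omega>)"
  proof -
    have "x * y * z * w + 2 * u * v * (m + i) = (2 * x * y * z * w + 4 * u * v * i) / 2 + 4 * u * v / 2 * m"
      for x y z w u v m i :: real by (simp add: algebra_simps)
    then show ?thesis unfolding err_def c2_def .
  qed
  finally show ?thesis .
qed

text \<open>The closing argument for the difference process, with \<open>err\<close> as constant
  part and \<open>c2\<close> as growth constant. The starting values agree almost surely, so
  \<open>err\<close> is the only source.\<close>

lemma diff_sup_bound:
  "(\<integral>\<^sup>+\<omega>. ennreal_powr (sup_norm {0..T} (\<lambda>t \<omega>. X t \<omega> - Xb t \<omega>) \<omega>) p \<partial>M) \<le> ennreal (sup_const q p T c2 * err)"
proof -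
  have c: "0 \<le> err" "0 \<le> c2" using IC_nonneg mom_bound_nonneg by (auto simp: err_def c2_def)
  note approx = ito_approx_diff[OF X_approx euler_adapted euler_gsum]
  have fin: "mom (\<lambda>\<omega>. X t \<omega> - Xb t \<omega>) \<le> 2 powr p * (mom_bound + mom_bound)" if "0 \<le> t" "t \<le> T" for t
  proof -
    have "mom (\<lambda>\<omega>. X t \<omega> - Xb t \<omega>) = mom (\<lambda>\<omega>. X t \<omega> + (-1) *\<^sub>R Xb t \<omega>)" by simp
    also have "\<dots> \<le> 2 powr p * (mom (X t) + mom (\<lambda>\<omega>. (-1) *\<^sub>R Xb t \<omega>))"
      by (intro mom_add_le in_Lp_scaleR X_Lp Xb_Lp that)
    also have "\<dots> \<le> 2 powr p * (mom_bound + mom_bound)"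
      using mom_X_bound[OF that] mom_Xb_bound[OF that] by (intro mult_left_mono add_mono) auto
    finally show ?thesis .
  qed
  have "(\<integral>\<^sup>+\<omega>. ennreal_powr (sup_norm {0..T} (\<lambda>t \<omega>. X t \<omega> - Xb t \<omega>) \<omega>) p \<partial>M)
    \<le> ennreal (sup_const q p T c2 * (mom (\<lambda>\<omega>. X 0 \<omega> - Xb 0 \<omega>) + err))"
  proof (rule approx_sup_bound[OF approx _ _ c, folded q])
    show "in_Lp M p (\<lambda>\<omega>. X (G n i) \<omega> - Xb (G n i) \<omega>)" if "i \<le> NN n" for n i
      using that by (intro in_Lp_diff X_Lp Xb_Lp G_nonneg G_le_T p0)
    show "mom (\<lambda>\<omega>. X (G n i) \<omega> - Xb (G n i) \<omega>) \<le> 2 powr p * (mom_bound + mom_bound)" if "i \<le> NN n" for n i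
      using that by (intro fin G_nonneg G_le_T)
    show "AE \<omega> in M. continuous_on {0..T} (\<lambda>t. X t \<omega> - Xb t \<omega>)"
      using Xb_cont AE_space by eventually_elim (intro continuous_on_diff X_cont)
    fix l Q :: real and n i :: nat
    assume Q: "\<And>n i. i \<le> NN n \<Longrightarrow> mom (\<lambda>\<omega>. X (G n i) \<omega> - Xb (G n i) \<omega>) \<le> Q * exp (l * G n i)" and i: "i < NN n"
    have "mom (\<lambda>\<omega>. \<beta>X n i \<omega> - \<beta>E n i \<omega>) + mom (\<lambda>\<omega>. \<zeta>X n i \<omega> - \<zeta>E n i \<omega>)
      \<le> err + c2 * mom (\<lambda>\<omega>. X (G n i) \<omega> - Xb (G n i) \<omega>)"
      using add_mono[OF diff_coeff[OF hb i] diff_coeff[OF hs i]]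
      unfolding \<beta>X_def \<zeta>X_def \<beta>E_def \<zeta>E_def by simp
    also have "\<dots> \<le> err + c2 * (Q * exp (l * G n i))"
      using i c by (intro add_left_mono mult_left_mono Q) auto
    finally show "mom (\<lambda>\<omega>. \<beta>X n i \<omega> - \<beta>E n i \<omega>) + mom (\<lambda>\<omega>. \<zeta>X n i \<omega> - \<zeta>E n i \<omega>) \<le> err + c2 * (Q * exp (l * G n i))" .
  qed auto
  also have "mom (\<lambda>\<omega>. X 0 \<omega> - Xb 0 \<omega>) = expectation (\<lambda>\<omega>. 0)"
  proof (rule integral_cong_AE)
    have [measurable]: "X 0 \<in> borel_measurable M" "Xb 0 \<in> borel_measurable M"
      using T Xb_Lp[of 0] by (auto intro: X_meas in_Lp_measurable)
    show "(\<lambda>\<omega>. norm (X 0 \<omega> - Xb 0 \<omega>) powr p) \<in> borel_measurable M" by measurable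
    show "AE \<omega> in M. norm (X 0 \<omega> - Xb 0 \<omega>) powr p = 0"
      using X_init AE_space by eventually_elim (simp add: Xb_0)
  qed simp
  finally show ?thesis by simp
qed

end

section \<open>From moments to norms\<close>

lemma ennreal_powr_mono:
  assumes "x \<le> y" "0 \<le> r"
  shows "ennreal_powr x r \<le> ennreal_powr y r"
proof (cases y)
  case (real z)
  then obtain w where w: "x = ennreal w" "0 \<le> w" using assms by (cases x) (auto simp: top_unique)
  then have "w \<le> z" using assms real by simp
  then show ?thesis using w real assms by (simp add: ennreal_powr_ennreal ennreal_leI powr_mono2)
qed (simp add: ennreal_powr_def)

context prob_space
begin

lemma in_Lp_of_Lp_norm:
  assumes "U \<in> borel_measurable M" "Lp_norm_vec M p U < \<infinity>"
  shows "in_Lp M p U"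
proof -
  have "(\<integral>\<^sup>+\<omega>. ennreal (norm (U \<omega>) powr p) \<partial>M) < \<infinity>"
    using assms(2) by (simp add: Lp_norm_def ennreal_powr_less_top ennreal_powr_ennreal)
  then show ?thesis unfolding in_Lp_def using assms(1) by (auto intro!: integrableI_nonneg)
qed

lemma Lp_norm_vec_eq:
  assumes "in_Lp M p U"
  shows "Lp_norm_vec M p U = ennreal (expectation (\<lambda>\<omega>. norm (U \<omega>) powr p) powr (1 / p))"
  using nn_integral_in_Lp[OF assms] by (simp add: Lp_norm_def ennreal_powr_ennreal)

end

context mckean_vlasov
begin

lemma Lp_norm_init: "Lp_norm_vec M p X0 = ennreal (mom X0 powr (1 / p))"
  by (rule Lp_norm_vec_eq[OF X0_Lp])

lemma mom_X0_eq: "mom X0 = enn2real (Lp_norm_vec M p X0) powr p"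
  unfolding Lp_norm_init using p mom_nonneg[of X0] by (simp add: powr_powr)

lemma sup_norm_Lp_le:
  assumes U: "(\<integral>\<^sup>+\<omega>. ennreal_powr (sup_norm {0..T} U \<omega>) p \<partial>M) \<le> ennreal (SC * (mom X0 + c0))" and t: "t \<le> T"
  shows "Lp_norm M p (sup_norm {0..t} U) \<le> ennreal ((2 * SC * (1 + c0)) powr (1 / p)) * (1 + Lp_norm_vec M p X0)"
proof -
  define x where "x = mom X0 powr (1 / p)"
  have x: "0 \<le> x" "x powr p = mom X0" using p mom_nonneg[of X0] by (auto simp: x_def powr_powr)
  have SC: "0 \<le> SC" by (rule sup_const_nonneg[OF c1_nonneg])
  have "(\<integral>\<^sup>+\<omega>. ennreal_powr (sup_norm {0..t} U \<omega>) p \<partial>M) \<le> (\<integral>\<^sup>+\<omega>. ennreal_powr (sup_norm {0..T} U \<omega>) p \<partial>M)"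
    unfolding sup_norm_def using t p0 by (intro nn_integral_mono ennreal_powr_mono SUP_subset_mono) auto
  also note U
  also have "ennreal (SC * (mom X0 + c0)) \<le> ennreal (((2 * SC * (1 + c0)) powr (1 / p) * (1 + x)) powr p)"
  proof (rule ennreal_leI)
    \<comment> \<open>Both \<open>1\<close> and \<open>x\<close> are at most \<open>1 + x\<close>,
      whence the factor 2 in the constant.\<close>
    have "1 + x powr p \<le> 2 * (1 + x) powr p"
      using x p powr_mono2[of p 1 "1 + x"] powr_mono2[of p x "1 + x"] by simp
    then have "(1 + c0) * (1 + x powr p) \<le> (1 + c0) * (2 * (1 + x) powr p)"
      using c0_nonneg by (intro mult_left_mono) auto
    moreover have "x powr p + c0 \<le> (1 + c0) * (1 + x powr p)"
      using c0_nonneg by (simp add: algebra_simps)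
    ultimately have "SC * (mom X0 + c0) \<le> SC * ((1 + c0) * (2 * (1 + x) powr p))"
      unfolding x(2)[symmetric] using SC by (intro mult_left_mono) auto
    also have "\<dots> = ((2 * SC * (1 + c0)) powr (1 / p) * (1 + x)) powr p"
      using SC c0_nonneg x p by (simp add: powr_mult powr_powr)
    finally show "SC * (mom X0 + c0) \<le> ((2 * SC * (1 + c0)) powr (1 / p) * (1 + x)) powr p" .
  qed
  finally have "Lp_norm M p (sup_norm {0..t} U) \<le> ennreal ((2 * SC * (1 + c0)) powr (1 / p) * (1 + x))"
    using x p by (intro Lp_norm_le) auto
  also have "\<dots> = ennreal ((2 * SC * (1 + c0)) powr (1 / p)) * (1 + Lp_norm_vec M p X0)"
    unfolding Lp_norm_init x_def[symmetric] using x by (simp add: ennreal_mult ennreal_plus)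
  finally show ?thesis .
qed

lemma sup_Lp:
  assumes "t \<in> {0..T}"
  shows "max (Lp_norm M p (sup_norm {0..t} X)) (Lp_norm M p (sup_norm {0..t} Xb))
    \<le> ennreal ((2 * SC * (1 + c0)) powr (1 / p)) * (1 + Lp_norm_vec M p X0)"
  using assms sup_norm_Lp_le[OF X_sup_bound, of t] sup_norm_Lp_le[OF Xb_sup_bound, of t] by simp

lemma powr_root_mult: "0 \<le> y \<Longrightarrow> 0 \<le> z \<Longrightarrow> (y powr (1 / p) * z) powr p = y * z powr p" for y z :: real
  using p by (simp add: powr_mult powr_powr)

lemma increment_Lp_le:
  assumes "(\<integral>\<^sup>+\<omega>. ennreal (norm (U \<omega>) powr p) \<partial>M) \<le> ennreal (IC * r powr (p / 2))" "0 \<le> r"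
  shows "Lp_norm_vec M p U \<le> ennreal (IC powr (1 / p) * sqrt r)"
proof (rule Lp_norm_le)
  have "(IC powr (1 / p) * sqrt r) powr p = IC * r powr (p / 2)"
    using powr_root_mult[OF IC_nonneg, of "sqrt r"] assms(2)
    by (simp add: powr_powr powr_half_sqrt[symmetric])
  then show "(\<integral>\<^sup>+\<omega>. ennreal_powr (ennreal (norm (U \<omega>))) p \<partial>M) \<le> ennreal ((IC powr (1 / p) * sqrt r) powr p)"
    using assms(1) by (simp add: ennreal_powr_ennreal)
qed (use p assms in auto)

lemma increment_Lp:
  assumes "0 \<le> s" "s \<le> t" "t \<le> T"
  shows "max (Lp_norm_vec M p (\<lambda>\<omega>. Xb t \<omega> - Xb s \<omega>)) (Lp_norm_vec M p (\<lambda>\<omega>. X t \<omega> - X s \<omega>))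
    \<le> ennreal (IC powr (1 / p) * sqrt (t - s))"
  using increment_Lp_le[OF X_increment[OF assms]] increment_Lp_le[OF Xb_increment[OF assms]] assms by simp

lemma diff_Lp:
  "Lp_norm M p (sup_norm {0..T} (\<lambda>t \<omega>. X t \<omega> - Xb t \<omega>))
    \<le> ennreal ((sup_const q p T c2 * (2 * 6 powr p * L' powr p * (1 + 2 * mom_bound) * T powr ((\<rho> - min (1 / 2) \<rho>) * p)
        + 4 * 8 powr p * L powr p * (IC * T powr ((1 / 2 - min (1 / 2) \<rho>) * p)))) powr (1 / p) * (T / real N) powr (min (1 / 2) \<rho>))"
proof (rule Lp_norm_le)
  let ?g = "min (1 / 2) \<rho>"
  let ?E = "2 * 6 powr p * L' powr p * (1 + 2 * mom_bound) * T powr ((\<rho> - ?g) * p) + 4 * 8 powr p * L powr p * (IC * T powr ((1 / 2 - ?g) * p))"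
  have S0: "0 \<le> sup_const q p T c2" by (rule sup_const_nonneg) (simp add: c2_def)
  have E0: "0 \<le> ?E" using mom_bound_nonneg IC_nonneg by simp
  \<comment> \<open>As \<open>h \<le> T\<close>, a rate above the minimum may be lowered to it at
    the price of a power of \<open>T\<close>. This unites the rates \<open>\<rho>\<close> and
    \<open>1/2\<close>.\<close>
  have hp: "h powr (a * p) \<le> T powr ((a - ?g) * p) * h powr (?g * p)" if "?g \<le> a" for a
  proof -
    have "h powr (a * p) = h powr ((a - ?g) * p) * h powr (?g * p)" by (simp flip: powr_add add: algebra_simps)
    also have "\<dots> \<le> T powr ((a - ?g) * p) * h powr (?g * p)" using h that p by (intro mult_right_mono powr_mono2) auto
    finally show ?thesis .
  qed
  have "err \<le> 2 * 6 powr p * L' powr p * (1 + 2 * mom_bound) * (T powr ((\<rho> - ?g) * p) * h powr (?g * p))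
     + 4 * 8 powr p * L powr p * (IC * (T powr ((1 / 2 - ?g) * p) * h powr (?g * p)))"
    unfolding err_def using hp[of \<rho>] hp[of "1/2"] mom_bound_nonneg IC_nonneg
    by (intro add_mono mult_left_mono) auto
  also have "\<dots> = ?E * h powr (?g * p)"
  proof -
    have "x * (y * z) + u * (v * (w * z)) = (x * y + u * (v * w)) * z" for x y z u v w :: real
      by (simp add: algebra_simps)
    then show ?thesis .
  qed
  finally have "sup_const q p T c2 * err \<le> sup_const q p T c2 * (?E * h powr (?g * p))"
    using S0 by (rule mult_left_mono)
  also have "\<dots> = ((sup_const q p T c2 * ?E) powr (1 / p) * h powr ?g) powr p"
  proof -
    have "((sup_const q p T c2 * ?E) powr (1 / p) * h powr ?g) powr p = sup_const q p T c2 * ?E * (h powr ?g) powr p"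
      using S0 E0 by (intro powr_root_mult mult_nonneg_nonneg) auto
    then show ?thesis by (simp only: powr_powr mult.assoc)
  qed
  finally show "(\<integral>\<^sup>+\<omega>. ennreal_powr (sup_norm {0..T} (\<lambda>t \<omega>. X t \<omega> - Xb t \<omega>) \<omega>) p \<partial>M)
    \<le> ennreal (((sup_const q p T c2 * ?E) powr (1 / p) * (T / real N) powr ?g) powr p)"
    unfolding h_def[symmetric] by (intro order_trans[OF diff_sup_bound] ennreal_leI)
qed (use p in auto)

end

section \<open>Constants uniform in the data\<close>

lemma return_finite_moment: "return borel (0 :: 'b::euclidean_space) \<in> finite_moment_measures p"
  by (auto simp: finite_moment_measures_def prob_space_return nn_integral_return)

text \<open>The bound must be fixed before \<open>\<rho>\<close> and \<open>L'\<close>. The function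
  is fixed, however: if it satisfies the condition for some triple of constants, any one of these
  triples yields a bound on the values at the origin, and this bound then holds whichever triple is
  used later. If there is no such triple, nothing is claimed.\<close>

lemma hoelder_lipschitz_bounded_at_zero:
  fixes f :: "real \<Rightarrow> 'b::euclidean_space \<Rightarrow> 'b measure \<Rightarrow> 'c::real_normed_vector"
  assumes T: "T > 0"
  shows "\<exists>K. \<forall>\<rho> L L'. \<rho> > 0 \<and> L' > 0 \<and> hoelder_lipschitz T p \<rho> L L' norm f \<longrightarrow>
    (\<forall>t. 0 \<le> t \<and> t \<le> T \<longrightarrow> norm (f t 0 (return borel 0)) \<le> K)"
proof (cases "\<exists>\<rho> L L'. \<rho> > 0 \<and> L' > 0 \<and> hoelder_lipschitz T p \<rho> L L' norm f")
  case True
  then obtain \<rho> L L' where f: "\<rho> > 0" "L' > 0" "hoelder_lipschitz T p \<rho> L L' norm f" by blast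
  let ?w = "wasserstein p (return borel (0::'b)) (return borel 0)"
  have w: "0 \<le> ?w" by (simp add: wasserstein_def)
  have "norm (f t 0 (return borel 0)) \<le> norm (f 0 0 (return borel 0)) + L' * (1 + ?w) * T powr \<rho>" if t: "0 \<le> t" "t \<le> T" for t
  proof -
    have "norm (f t 0 (return borel 0) - f 0 0 (return borel 0)) \<le> L' * (1 + norm (0::'b) + ?w) * (t - 0) powr \<rho>"
      using f(3) t return_finite_moment unfolding hoelder_lipschitz_def by blast
    also have "\<dots> \<le> L' * (1 + ?w) * T powr \<rho>"
      using f t w by (simp, intro mult_left_mono powr_mono2) auto
    finally show ?thesis using norm_triangle_ineq2[of "f t 0 (return borel 0)" "f 0 0 (return borel 0)"] by linarith
  qed
  then show ?thesis by blast
next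
  case False
  then show ?thesis by blast
qed

text \<open>The dependence of the constants is expressed by the order of quantifiers: they are
  chosen once \<open>T\<close>, \<open>p\<close>, \<open>L\<close>, \<open>b\<close> and
  \<open>\<sigma>\<close> are given and before the filtered space, the Brownian motion, the initial
  value and the step number. Dependence on \<open>L'\<close>, \<open>\<rho>\<close> and the norm of
  the initial value appears as arguments.\<close>

theorem proposition2p1:
  fixes T p L :: real
    and b :: "real \<Rightarrow> real ^ 'd \<Rightarrow> (real ^ 'd) measure \<Rightarrow> real ^ 'd"
    and \<sigma> :: "real \<Rightarrow> real ^ 'd \<Rightarrow> (real ^ 'd) measure \<Rightarrow> real ^ 'q ^ 'd"
  assumes "T > 0" and "p \<ge> 2" and "L > 0"
  shows "\<exists>(C :: real) (\<kappa> :: real \<Rightarrow> real) (C' :: real \<Rightarrow> real \<Rightarrow> real \<Rightarrow> real).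
    \<forall>(\<rho> :: real) (L' :: real)
      (\<theta> :: real \<Rightarrow> real ^ 'd \<Rightarrow> (real ^ 'd) measure \<Rightarrow> real ^ 'q ^ 'd)
      (M :: 'a measure) (F :: real \<Rightarrow> 'a measure) (B :: real \<Rightarrow> 'a \<Rightarrow> real ^ 'q)
      (X0 :: 'a \<Rightarrow> real ^ 'd) (Y0 :: 'a \<Rightarrow> real ^ 'd) (X :: real \<Rightarrow> 'a \<Rightarrow> real ^ 'd).
      \<rho> > 0 \<and> L' > 0 \<and>
      hoelder_lipschitz T p \<rho> L L' norm b \<and>
      hoelder_lipschitz T p \<rho> L L' op_norm \<sigma> \<and>
      hoelder_lipschitz T p \<rho> L L' op_norm \<theta> \<and>
      usual_filtration M F \<and> brownian_motion M F B \<and>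
      X0 \<in> borel_measurable (F 0) \<and> Y0 \<in> borel_measurable (F 0) \<and>
      max (Lp_norm_vec M p X0) (Lp_norm_vec M p Y0) < \<infinity> \<and>
      mckean_vlasov_solution M F B T p b \<sigma> X0 X
      \<longrightarrow>
      (\<forall>(N :: nat) (Xb :: real \<Rightarrow> 'a \<Rightarrow> real ^ 'd).
        N \<ge> 1 \<and> euler_scheme M B T b \<sigma> X0 N Xb
        \<longrightarrow>
        (\<forall>t\<in>{0..T}.
           max (Lp_norm M p (sup_norm {0..t} X)) (Lp_norm M p (sup_norm {0..t} Xb))
             \<le> ennreal C * (1 + Lp_norm_vec M p X0)) \<and>
        (\<forall>s t. 0 \<le> s \<and> s \<le> t \<and> t \<le> T \<longrightarrow>
           max (Lp_norm_vec M p (\<lambda>\<omega>. Xb t \<omega> - Xb s \<omega>)) (Lp_norm_vec M p (\<lambda>\<omega>. X t \<omega> - X s \<omega>))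
             \<le> ennreal (\<kappa> (enn2real (Lp_norm_vec M p X0)) * sqrt (t - s))) \<and>
        Lp_norm M p (sup_norm {0..T} (\<lambda>t \<omega>. X t \<omega> - Xb t \<omega>))
          \<le> ennreal (C' L' \<rho> (enn2real (Lp_norm_vec M p X0)) * (T / real N) powr (min (1 / 2) \<rho>)))"
proof -
  define q where "q = CARD('q)"
  define c where "c = real (CARD('d) * CARD('q))"
  have "1 \<le> CARD('d) * CARD('q)" by (simp add: Suc_le_eq)
  then have c: "1 \<le> c" unfolding c_def by linarith
  obtain K1 where K1: "\<And>\<rho> L L' t. \<rho> > 0 \<Longrightarrow> L' > 0 \<Longrightarrow> hoelder_lipschitz T p \<rho> L L' norm b \<Longrightarrow> 0 \<le> t \<Longrightarrow> t \<le> T \<Longrightarrow> norm (b t 0 (return borel 0)) \<le> K1"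
    using hoelder_lipschitz_bounded_at_zero[OF assms(1), of p b] by blast
  obtain K2 where K2: "\<And>\<rho> L L' t. \<rho> > 0 \<Longrightarrow> L' > 0 \<Longrightarrow> hoelder_lipschitz T p \<rho> L L' norm \<sigma> \<Longrightarrow> 0 \<le> t \<Longrightarrow> t \<le> T \<Longrightarrow> norm (\<sigma> t 0 (return borel 0)) \<le> K2"
    using hoelder_lipschitz_bounded_at_zero[OF assms(1), of p \<sigma>] by blast
  define K where "K = max K1 K2"
  define l where "l = c * L"
  \<comment> \<open>From here on the constants of the locale are rebuilt as functions of the norm
    \<open>x\<close> of the initial value, because the witnesses have to be named before there is a
    process with which the locale could be interpreted.\<close>
  define a0 where "a0 = 2 * 3 powr p * K powr p"
  define a1 where "a1 = 4 * 3 powr p * l powr p"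
  define a2 where "a2 = 4 * 8 powr p * l powr p"
  define mb where "mb x = sup_const q p T a1 * (x powr p + a0)" for x
  define ic where "ic x = incr_const q p T * (a0 + a1 * mb x)" for x
  define C where "C = (2 * sup_const q p T a1 * (1 + a0)) powr (1 / p)"
  define \<kappa> where "\<kappa> x = ic x powr (1 / p)" for x
  define C' where "C' L' \<rho> x = (sup_const q p T a2 * (2 * 6 powr p * (c * L') powr p * (1 + 2 * mb x) * T powr ((\<rho> - min (1 / 2) \<rho>) * p)
        + 4 * 8 powr p * l powr p * (ic x * T powr ((1 / 2 - min (1 / 2) \<rho>) * p)))) powr (1 / p)" for L' \<rho> x
  show ?thesis
  proof (rule exI[of _ C], rule exI[of _ \<kappa>], rule exI[of _ C'], intro allI impI, elim conjE)
    fix \<rho> L' :: real and \<theta> :: "real \<Rightarrow> real ^ 'd \<Rightarrow> (real ^ 'd) measure \<Rightarrow> real ^ 'q ^ 'd"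
      and M :: "'a measure" and F :: "real \<Rightarrow> 'a measure" and B :: "real \<Rightarrow> 'a \<Rightarrow> real ^ 'q"
      and X0 Y0 :: "'a \<Rightarrow> real ^ 'd" and X :: "real \<Rightarrow> 'a \<Rightarrow> real ^ 'd" and N :: nat and Xb :: "real \<Rightarrow> 'a \<Rightarrow> real ^ 'd"
    assume \<rho>: "\<rho> > 0" and L': "L' > 0" and b: "hoelder_lipschitz T p \<rho> L L' norm b"
      and \<sigma>: "hoelder_lipschitz T p \<rho> L L' op_norm \<sigma>"
      and usual: "usual_filtration M F" and bm: "brownian_motion M F B"
      and X0: "X0 \<in> borel_measurable (F 0)" and fin: "max (Lp_norm_vec M p X0) (Lp_norm_vec M p Y0) < \<infinity>"
      and sol: "mckean_vlasov_solution M F B T p b \<sigma> X0 X" and N: "N \<ge> 1" and eul: "euler_scheme M B T b \<sigma> X0 N Xb"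
    have hb: "hoelder_lipschitz T p \<rho> l (c * L') norm b"
      using assms(3) L' c by (intro hoelder_lipschitz_norm[OF b, of 1]) (auto simp: l_def)
    have hs: "hoelder_lipschitz T p \<rho> l (c * L') norm \<sigma>"
      using c by (intro hoelder_lipschitz_norm[OF \<sigma>, of c]) (auto simp: l_def c_def norm_le_op_norm simp del: of_nat_mult)
    have cL: "0 < c * L'" using c L' by simp
    interpret bm: filtered_bm M F B by unfold_locales (fact usual, fact bm)
    have X0_Lp: "in_Lp M p X0"
      using fin by (intro bm.in_Lp_of_Lp_norm bm.measurable_F_M[OF X0]) auto
    interpret mckean_vlasov M F B p T N b \<sigma> l "c * L'" \<rho> K q X0 X Xb
    proof
      show "norm (b t 0 (return borel 0)) \<le> K" "norm (\<sigma> t 0 (return borel 0)) \<le> K" if "0 \<le> t" "t \<le> T" for t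
        using K1[OF \<rho> cL hb that] K2[OF \<rho> cL hs that] by (auto simp: K_def)
    qed (use assms N q_def hb hs \<rho> cL X0 X0_Lp sol eul c in \<open>auto simp: l_def\<close>)
    have eqs: "c0 = a0" "c1 = a1" "c2 = a2"
      by (simp_all add: a0_def a1_def a2_def c0_def c1_def c2_def)
    show "(\<forall>t\<in>{0..T}.
           max (Lp_norm M p (sup_norm {0..t} X)) (Lp_norm M p (sup_norm {0..t} Xb))
             \<le> ennreal C * (1 + Lp_norm_vec M p X0)) \<and>
        (\<forall>s t. 0 \<le> s \<and> s \<le> t \<and> t \<le> T \<longrightarrow>
           max (Lp_norm_vec M p (\<lambda>\<omega>. Xb t \<omega> - Xb s \<omega>)) (Lp_norm_vec M p (\<lambda>\<omega>. X t \<omega> - X s \<omega>))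
             \<le> ennreal (\<kappa> (enn2real (Lp_norm_vec M p X0)) * sqrt (t - s))) \<and>
        Lp_norm M p (sup_norm {0..T} (\<lambda>t \<omega>. X t \<omega> - Xb t \<omega>))
          \<le> ennreal (C' L' \<rho> (enn2real (Lp_norm_vec M p X0)) * (T / real N) powr (min (1 / 2) \<rho>))"
    proof (intro conjI allI impI ballI)
      have mb: "mom_bound = mb (enn2real (Lp_norm_vec M p X0))"
        unfolding mb_def mom_bound_def eqs mom_X0_eq ..
      have ic: "incr_const q p T * (c0 + c1 * mom_bound) = ic (enn2real (Lp_norm_vec M p X0))"
        unfolding ic_def eqs mb ..
      show "max (Lp_norm M p (sup_norm {0..t} X)) (Lp_norm M p (sup_norm {0..t} Xb)) \<le> ennreal C * (1 + Lp_norm_vec M p X0)"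
        if "t \<in> {0..T}" for t
        using sup_Lp[OF that] unfolding C_def eqs .
      show "max (Lp_norm_vec M p (\<lambda>\<omega>. Xb t \<omega> - Xb s \<omega>)) (Lp_norm_vec M p (\<lambda>\<omega>. X t \<omega> - X s \<omega>))
        \<le> ennreal (\<kappa> (enn2real (Lp_norm_vec M p X0)) * sqrt (t - s))"
        if "0 \<le> s \<and> s \<le> t \<and> t \<le> T" for s t
        using increment_Lp[of s t] that unfolding \<kappa>_def ic by simp
      show "Lp_norm M p (sup_norm {0..T} (\<lambda>t \<omega>. X t \<omega> - Xb t \<omega>))
        \<le> ennreal (C' L' \<rho> (enn2real (Lp_norm_vec M p X0)) * (T / real N) powr (min (1 / 2) \<rho>))"
        using diff_Lp unfolding C'_def ic unfolding eqs mb .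
    qed
  qed
qed

end
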